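(* Let $\mathcal H$ be an infinite-dimensional separable complex Hilbert space and let $A,X\in B(\mathcal H)$ be self-adjoint. Then $$s(AX-XA)\prec_w\tfrac12\,\mathrm{Spr}^+(A\oplus A)\cdot \mathrm{Spr}^+(X\oplus X).$$ If moreover $A$ or $X$ is compact, then for every unitarily invariant norm $N$ with symmetric gauge function $g_N$, $$N(AX-XA)\le\tfrac12\,g_N\big(\mathrm{Spr}^+(A\oplus A)\cdot \mathrm{Spr}^+(X\oplus X)\big).$$
   Context: $\mathbb N=\{1,2,\dots\}$, $\mathbb Z_0=\mathbb Z\setminus\{0\}$. For operators $A,B$ on $\mathcal H$, $A\oplus B$ is the block diagonal operator on $\mathcal H\oplus\mathcal H$. The product $\cdot$ of sequences is entrywise. Spectral scale: for a bounded self-adjoint operator $A$ on an infinite-dimensional separable complex Hilbert space $\mathcal L$, $\lambda(A)=(\lambda_i(A))_{i\in\mathbb Z_0}$ is defined, for $i\in\mathbb N$, by $$\lambda_i(A)=\inf_{\dim\mathcal S=i-1}\ \sup_{\psi\in\mathcal S^\perp,\|\psi\|=1}\langle A\psi,\psi\rangle,\qquad \lambda_{-i}(A)=\sup_{\dim\mathcal S=i-1}\ \inf_{\psi\in\mathcal S^\perp,\|\psi\|=1}\langle A\psi,\psi\rangle,$$ where $\mathcal S$ ranges over $(i-1)$-dimensional subspaces of $\mathcal L$. Spectral spread: $\mathrm{Spr}^+(A)=(\lambda_i(A)-\lambda_{-i}(A))_{i\in\mathbb N}$. Generalized singular values of a bounded operator $T$: $s(T)=(\lambda_i(|T|))_{i\in\mathbb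 N}$, $|T|=(T^*T)^{1/2}$. Submajorization: for a bounded real sequence $a=(a_i)_{i\in\mathbb M}$, $\mathbb M\in\{\mathbb N,\mathbb Z_0\}$, put $a^\downarrow_i=\lambda_i(D_a)$, $i\in\mathbb N$, where $D_a$ is the diagonal operator with diagonal $a$ on $\ell^2(\mathbb M)$; equivalently $\sum_{i=1}^k a_i^\downarrow=\sup\{\sum_{i\in F}a_i: F\subseteq\mathbb M, |F|=k\}$. Then $a\prec_w b$ means $\sum_{i=1}^k a_i^\downarrow\le\sum_{i=1}^k b_i^\downarrow$ for all $k\in\mathbb N$. Unitarily invariant norm: a norm $N$ on a proper two-sided ideal $\mathcal C$ of $B(\mathcal H)$ (so $\mathcal C\subseteq$ compact operators) with $N(DAE)\le\|D\|N(A)\|E\|$ for $A\in\mathcal C$, $D,E\in B(\mathcal H)$, and $N(A)=\|A\|$ for rank one $A$. It is determined by a symmetric gauge function $g_N$ through $N(A)=g_N(s(A))$; for $a$ a non-negative non-increasing null sequence, $g_N(a)=\sup_n N(\mathrm{diag}(a_1,\dots,a_n,0,0,\dots))\in[0,\infty]$, with diagonal taken in a fixed orthonormal basis. $N(A)=g_N(s(A))$ is used for all compact $A$ (value $+\infty$ allowed), and $s(A)\prec_w s(B)$ implies $g_N(s(A))\le g_N(s(B))$. *)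

theory Defs
  imports "HOL-Analysis.Analysis"
begin

section \<open>Complex Hilbert spaces\<close>

text \<open>The underlying real Banach space supplies the norm and the topology; \<open>cinner_self\<close> says
  that the norm is the one of the inner product, so positive definiteness needs no axiom of its own.
  The inner product is linear in the first argument.\<close>

class chilbert_space = banach +
  fixes scaleC :: "complex \<Rightarrow> 'a \<Rightarrow> 'a" (infixr "*\<^sub>C" 75)
    and cinner :: "'a \<Rightarrow> 'a \<Rightarrow> complex" ("\<langle>_,/ _\<rangle>")
  assumes scaleC_add_right: "c *\<^sub>C (x + y) = c *\<^sub>C x + c *\<^sub>C y"
    and scaleC_add_left: "(c + d) *\<^sub>C x = c *\<^sub>C x + d *\<^sub>C x"
    and scaleC_scaleC: "c *\<^sub>C d *\<^sub>C x = (c * d) *\<^sub>C x"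
    and scaleC_of_real: "complex_of_real r *\<^sub>C x = r *\<^sub>R x"
    and cinner_commute: "\<langle>x, y\<rangle> = cnj \<langle>y, x\<rangle>"
    and cinner_add_left: "\<langle>x + y, z\<rangle> = \<langle>x, z\<rangle> + \<langle>y, z\<rangle>"
    and cinner_scaleC_left: "\<langle>c *\<^sub>C x, y\<rangle> = c * \<langle>x, y\<rangle>"
    and cinner_self: "\<langle>x, x\<rangle> = complex_of_real ((norm x)\<^sup>2)"

global_interpretation cvec: vector_space "scaleC :: complex \<Rightarrow> 'a \<Rightarrow> 'a::chilbert_space"
  defines cspan = cvec.span and cdependent = cvec.dependent
proof
  fix x :: 'a
  show "1 *\<^sub>C x = x"
    using scaleC_of_real[of 1 x] by simp
qed (simp_all add: scaleC_add_right scaleC_add_left scaleC_scaleC)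

text \<open>On the orthogonal sum \<open>H \<times> H\<close> the block diagonal operator \<open>A \<oplus> B\<close> is
  \<^term>\<open>map_prod A B\<close>.\<close>

instantiation prod :: (chilbert_space, chilbert_space) chilbert_space
begin

definition scaleC_prod :: "complex \<Rightarrow> 'a \<times> 'b \<Rightarrow> 'a \<times> 'b" where
  "scaleC_prod c x = (c *\<^sub>C fst x, c *\<^sub>C snd x)"

definition cinner_prod :: "'a \<times> 'b \<Rightarrow> 'a \<times> 'b \<Rightarrow> complex" where
  "cinner_prod x y = \<langle>fst x, fst y\<rangle> + \<langle>snd x, snd y\<rangle>"

instance
proof
  fix x y z :: "'a \<times> 'b" and c d :: complex and r :: real
  show "c *\<^sub>C (x + y) = c *\<^sub>C x + c *\<^sub>C y"
    by (simp add: scaleC_prod_def scaleC_add_right)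
  show "(c + d) *\<^sub>C x = c *\<^sub>C x + d *\<^sub>C x"
    by (simp add: scaleC_prod_def scaleC_add_left)
  show "c *\<^sub>C d *\<^sub>C x = (c * d) *\<^sub>C x"
    by (simp add: scaleC_prod_def scaleC_scaleC)
  show "complex_of_real r *\<^sub>C x = r *\<^sub>R x"
    by (simp add: scaleC_prod_def scaleC_of_real scaleR_prod_def)
  show "\<langle>x, y\<rangle> = cnj \<langle>y, x\<rangle>"
    unfolding cinner_prod_def complex_cnj_add
    by (metis cinner_commute)
  show "\<langle>x + y, z\<rangle> = \<langle>x, z\<rangle> + \<langle>y, z\<rangle>"
    by (simp add: cinner_prod_def cinner_add_left)
  show "\<langle>c *\<^sub>C x, y\<rangle> = c * \<langle>x, y\<rangle>"
    by (simp add: cinner_prod_def scaleC_prod_def cinner_scaleC_left distrib_left)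
  show "\<langle>x, x\<rangle> = complex_of_real ((norm x)\<^sup>2)"
    by (simp add: cinner_prod_def cinner_self norm_prod_def)
qed

end

section \<open>Bounded operators\<close>

definition bounded_op :: "('a::chilbert_space \<Rightarrow> 'b::chilbert_space) \<Rightarrow> bool" where
  "bounded_op T \<longleftrightarrow> bounded_linear T \<and> (\<forall>c x. T (c *\<^sub>C x) = c *\<^sub>C T x)"

definition selfadjoint_op :: "('a::chilbert_space \<Rightarrow> 'a) \<Rightarrow> bool" where
  "selfadjoint_op T \<longleftrightarrow> bounded_op T \<and> (\<forall>x y. \<langle>T x, y\<rangle> = \<langle>x, T y\<rangle>)"

definition positive_op :: "('a::chilbert_space \<Rightarrow> 'a) \<Rightarrow> bool" where
  "positive_op T \<longleftrightarrow> selfadjoint_op T \<and> (\<forall>x. 0 \<le> Re \<langle>T x, x\<rangle>)"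

definition compact_op :: "('a::chilbert_space \<Rightarrow> 'b::chilbert_space) \<Rightarrow> bool" where
  "compact_op T \<longleftrightarrow> bounded_op T \<and> compact (closure (T ` cball 0 1))"

definition adj_op :: "('a::chilbert_space \<Rightarrow> 'b::chilbert_space) \<Rightarrow> 'b \<Rightarrow> 'a" where
  "adj_op T = (THE S. bounded_op S \<and> (\<forall>x y. \<langle>T x, y\<rangle> = \<langle>x, S y\<rangle>))"

definition abs_op :: "('a::chilbert_space \<Rightarrow> 'b::chilbert_space) \<Rightarrow> 'a \<Rightarrow> 'a" where
  "abs_op T = (THE P. positive_op P \<and> P \<circ> P = adj_op T \<circ> T)"

section \<open>Spectral scale, spectral spread, singular values\<close>

text \<open>The cardinality of a finite basis is used because \<open>cvec.dim\<close> is \<open>0\<close> on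
  infinite-dimensional subspaces.\<close>

definition subspaces_of_dim :: "nat \<Rightarrow> 'a::chilbert_space set set" where
  "subspaces_of_dim n = {cspan B | B. finite B \<and> card B = n \<and> \<not> cdependent B}"

definition infinite_dim :: "'a::chilbert_space itself \<Rightarrow> bool" where
  "infinite_dim _ \<longleftrightarrow> \<not> (\<exists>B :: 'a set. finite B \<and> cspan B = UNIV)"

definition unit_vectors_orth :: "'a::chilbert_space set \<Rightarrow> 'a set" where
  "unit_vectors_orth S = {x. norm x = 1 \<and> (\<forall>y\<in>S. \<langle>x, y\<rangle> = 0)}"

text \<open>Meant for self-adjoint \<open>A\<close> on an infinite-dimensional space: there \<open>\<langle>A x, x\<rangle>\<close> is real
  and all suprema and infima are over nonempty bounded sets.  The index \<open>0\<close> is not used.\<close>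

definition spectral_scale :: "('a::chilbert_space \<Rightarrow> 'a) \<Rightarrow> int \<Rightarrow> real" where
  "spectral_scale A i =
    (if i > 0 then INF S\<in>subspaces_of_dim (nat (i - 1)). SUP x\<in>unit_vectors_orth S. Re \<langle>A x, x\<rangle>
     else if i < 0 then SUP S\<in>subspaces_of_dim (nat (- i - 1)). INF x\<in>unit_vectors_orth S. Re \<langle>A x, x\<rangle>
     else 0)"

text \<open>Sequences indexed by \<open>{1, 2, \<dots>}\<close> are functions on \<^typ>\<open>nat\<close>, the argument \<open>n\<close> standing for
  the index \<open>n + 1\<close>.\<close>

definition spectral_spread :: "('a::chilbert_space \<Rightarrow> 'a) \<Rightarrow> nat \<Rightarrow> real" where
  "spectral_spread A n = spectral_scale A (int (n + 1)) - spectral_scale A (- int (n + 1))"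

definition singular_values :: "('a::chilbert_space \<Rightarrow> 'b::chilbert_space) \<Rightarrow> nat \<Rightarrow> real" where
  "singular_values T n = spectral_scale (abs_op T) (int (n + 1))"

section \<open>The Hilbert space of square-summable families\<close>

typedef 'i ell2 = "{f :: 'i \<Rightarrow> complex. (\<lambda>i. (cmod (f i))\<^sup>2) summable_on UNIV}"
  morphisms ell2_nth Abs_ell2
  by (rule exI[of _ "\<lambda>_. 0"]) simp

setup_lifting type_definition_ell2

lemma ell2_summable: "(\<lambda>i. (cmod (ell2_nth x i))\<^sup>2) summable_on UNIV"
  using ell2_nth[of x] by simp

lemma ell2_bound:
  assumes "\<And>F. finite F \<Longrightarrow> L2_set (\<lambda>i. cmod (f i)) F \<le> B"
  shows "(\<lambda>i. (cmod (f i))\<^sup>2) summable_on UNIV"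
    and "sqrt (\<Sum>\<^sub>\<infinity>i. (cmod (f i))\<^sup>2) \<le> B"
proof -
  have B: "0 \<le> B"
    using assms[of "{}"] by simp
  have le: "(\<Sum>i\<in>F. (cmod (f i))\<^sup>2) \<le> B\<^sup>2" if "finite F" for F
    using assms[OF that] B unfolding L2_set_def
    by (simp add: real_sqrt_le_iff' sum_nonneg sqrt_le_D)
  show S: "(\<lambda>i. (cmod (f i))\<^sup>2) summable_on UNIV"
    by (rule nonneg_bdd_above_summable_on) (auto intro!: bdd_aboveI2[where M = "B\<^sup>2"] le)
  have "(\<Sum>\<^sub>\<infinity>i. (cmod (f i))\<^sup>2) \<le> B\<^sup>2"
    by (rule infsum_le_finite_sums[OF S]) (auto intro: le)
  then show "sqrt (\<Sum>\<^sub>\<infinity>i. (cmod (f i))\<^sup>2) \<le> B"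
    by (simp add: B real_le_lsqrt infsum_nonneg)
qed

lemma L2_set_le_ell2:
  assumes "(\<lambda>i. (cmod (f i))\<^sup>2) summable_on UNIV"
  shows "L2_set (\<lambda>i. cmod (f i)) F \<le> sqrt (\<Sum>\<^sub>\<infinity>i. (cmod (f i))\<^sup>2)"
proof (cases "finite F")
  case True
  then show ?thesis
    unfolding L2_set_def using assms by (simp add: finite_sum_le_infsum)
qed (simp add: infsum_nonneg)

lemma ell2_add_bound:
  assumes f: "(\<lambda>i. (cmod (f i))\<^sup>2) summable_on UNIV" and g: "(\<lambda>i. (cmod (g i))\<^sup>2) summable_on UNIV"
  shows "L2_set (\<lambda>i. cmod (f i + g i)) F
    \<le> sqrt (\<Sum>\<^sub>\<infinity>i. (cmod (f i))\<^sup>2) + sqrt (\<Sum>\<^sub>\<infinity>i. (cmod (g i))\<^sup>2)"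
proof -
  have "L2_set (\<lambda>i. cmod (f i + g i)) F \<le> L2_set (\<lambda>i. cmod (f i) + cmod (g i)) F"
    by (rule L2_set_mono) (auto intro: norm_triangle_ineq)
  also have "\<dots> \<le> L2_set (\<lambda>i. cmod (f i)) F + L2_set (\<lambda>i. cmod (g i)) F"
    by (rule L2_set_triangle_ineq)
  finally show ?thesis
    using L2_set_le_ell2[OF f, of F] L2_set_le_ell2[OF g, of F] by linarith
qed

lemma ell2_scale:
  assumes "(\<lambda>i. (cmod (f i))\<^sup>2) summable_on UNIV"
  shows "(\<lambda>i. (cmod (c * f i))\<^sup>2) summable_on UNIV"
  unfolding norm_mult power_mult_distrib using assms by (rule summable_on_cmult_right)

lemma ell2_mult_summable:
  assumes f: "(\<lambda>i. (cmod (f i))\<^sup>2) summable_on UNIV" and g: "(\<lambda>i. (cmod (g i))\<^sup>2) summable_on UNIV"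
  shows "(\<lambda>i. f i * cnj (g i)) summable_on UNIV"
proof -
  have "(\<lambda>i. (cmod (f i))\<^sup>2 + (cmod (g i))\<^sup>2) summable_on UNIV"
    using f g by (rule summable_on_add)
  moreover have "cmod (f i * cnj (g i)) \<le> (cmod (f i))\<^sup>2 + (cmod (g i))\<^sup>2" for i
  proof -
    have "2 * (cmod (f i) * cmod (g i)) \<le> (cmod (f i))\<^sup>2 + (cmod (g i))\<^sup>2"
      using sum_squares_bound[of "cmod (f i)" "cmod (g i)"] by (simp add: mult.assoc)
    moreover have "0 \<le> cmod (f i) * cmod (g i)"
      by simp
    ultimately show ?thesis
      unfolding norm_mult complex_mod_cnj by linarith
  qed
  ultimately have "(\<lambda>i. norm (f i * cnj (g i))) summable_on UNIV"
    by (rule Infinite_Sum.abs_summable_on_comparison_test')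
  then show ?thesis
    by (rule abs_summable_summable)
qed

instantiation ell2 :: (type) real_normed_vector
begin

lift_definition zero_ell2 :: "'a ell2" is "\<lambda>_. 0"
  by simp

lift_definition plus_ell2 :: "'a ell2 \<Rightarrow> 'a ell2 \<Rightarrow> 'a ell2" is "\<lambda>f g i. f i + g i"
  by (rule ell2_bound(1)) (rule ell2_add_bound)

lift_definition uminus_ell2 :: "'a ell2 \<Rightarrow> 'a ell2" is "\<lambda>f i. - f i"
  by simp

definition minus_ell2 :: "'a ell2 \<Rightarrow> 'a ell2 \<Rightarrow> 'a ell2" where
  "minus_ell2 x y = x + - y"

lift_definition scaleR_ell2 :: "real \<Rightarrow> 'a ell2 \<Rightarrow> 'a ell2" is "\<lambda>r f i. complex_of_real r * f i"
  by (rule ell2_scale)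

lift_definition norm_ell2 :: "'a ell2 \<Rightarrow> real" is
  "\<lambda>f. sqrt (\<Sum>\<^sub>\<infinity>i. (cmod (f i))\<^sup>2)" .

definition sgn_ell2 :: "'a ell2 \<Rightarrow> 'a ell2" where
  "sgn_ell2 x = scaleR (inverse (norm x)) x"

definition dist_ell2 :: "'a ell2 \<Rightarrow> 'a ell2 \<Rightarrow> real" where
  "dist_ell2 x y = norm (x - y)"

definition uniformity_ell2 :: "('a ell2 \<times> 'a ell2) filter" where
  "uniformity_ell2 = (INF e\<in>{0<..}. principal {(x, y). dist x y < e})"

definition open_ell2 :: "'a ell2 set \<Rightarrow> bool" where
  "open_ell2 U \<longleftrightarrow> (\<forall>x\<in>U. \<forall>\<^sub>F (x', y) in uniformity. x' = x \<longrightarrow> y \<in> U)"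

instance
proof
  fix x y z :: "'a ell2" and a b :: real and U :: "'a ell2 set"
  show "x + y + z = x + (y + z)"
    by transfer (simp add: add.assoc)
  show "x + y = y + x"
    by transfer (simp add: add.commute)
  show "0 + x = x"
    by transfer simp
  show "- x + x = 0"
    by transfer simp
  show "x - y = x + - y"
    by (rule minus_ell2_def)
  show "a *\<^sub>R (x + y) = a *\<^sub>R x + a *\<^sub>R y"
    by transfer (simp add: distrib_left)
  show "(a + b) *\<^sub>R x = a *\<^sub>R x + b *\<^sub>R x"
    by transfer (simp add: distrib_right)
  show "a *\<^sub>R b *\<^sub>R x = (a * b) *\<^sub>R x"
    by transfer (simp add: mult.assoc)
  show "1 *\<^sub>R x = x"
    by transfer simp
  show "sgn x = scaleR (inverse (norm x)) x"
    by (rule sgn_ell2_def)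
  show "dist x y = norm (x - y)"
    by (rule dist_ell2_def)
  show "uniformity = (INF e\<in>{0<..}. principal {(x :: 'a ell2, y). dist x y < e})"
    by (rule uniformity_ell2_def)
  show "open U = (\<forall>x\<in>U. \<forall>\<^sub>F (x', y) in uniformity. x' = x \<longrightarrow> y \<in> U)"
    by (rule open_ell2_def)
  show "norm x = 0 \<longleftrightarrow> x = 0"
  proof transfer
    fix f :: "'a \<Rightarrow> complex"
    assume f: "(\<lambda>i. (cmod (f i))\<^sup>2) summable_on UNIV"
    have "f i = 0" if "sqrt (\<Sum>\<^sub>\<infinity>i. (cmod (f i))\<^sup>2) = 0" for i
      using L2_set_le_ell2[OF f, of "{i}"] that by simp
    then show "sqrt (\<Sum>\<^sub>\<infinity>i. (cmod (f i))\<^sup>2) = 0 \<longleftrightarrow> f = (\<lambda>_. 0)"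
      by (intro iffI ext) simp_all
  qed
  show "norm (x + y) \<le> norm x + norm y"
    by transfer (rule ell2_bound(2), rule ell2_add_bound)
  show "norm (a *\<^sub>R x) = \<bar>a\<bar> * norm x"
    by transfer (simp add: norm_mult power_mult_distrib infsum_cmult_right' real_sqrt_mult)
qed

end

instance ell2 :: (type) banach
proof
  fix X :: "nat \<Rightarrow> 'a ell2"
  assume X: "Cauchy X"
  have diff: "ell2_nth (u - v) i = ell2_nth u i - ell2_nth v i" for u v :: "'a ell2" and i
    unfolding minus_ell2_def plus_ell2.rep_eq uminus_ell2.rep_eq by simp
  have coord: "cmod (ell2_nth u i) \<le> norm u" for u :: "'a ell2" and i
    using L2_set_le_ell2[OF ell2_summable, of u "{i}"] by (simp add: norm_ell2.rep_eq)
  have "Cauchy (\<lambda>n. ell2_nth (X n) i)" for i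
  proof (rule metric_CauchyI)
    fix e :: real
    assume "e > 0"
    then obtain M where M: "\<And>m n. m \<ge> M \<Longrightarrow> n \<ge> M \<Longrightarrow> dist (X m) (X n) < e"
      using metric_CauchyD[OF X] by blast
    have "dist (ell2_nth (X m) i) (ell2_nth (X n) i) < e" if "m \<ge> M" "n \<ge> M" for m n
      using coord[of "X m - X n" i] M[OF that] by (simp add: dist_norm diff)
    then show "\<exists>M. \<forall>m\<ge>M. \<forall>n\<ge>M. dist (ell2_nth (X m) i) (ell2_nth (X n) i) < e"
      by blast
  qed
  then obtain f where f: "(\<lambda>n. ell2_nth (X n) i) \<longlonglongrightarrow> f i" for i
    unfolding Cauchy_convergent_iff convergent_def by metis
  have key: "\<exists>M. \<forall>m\<ge>M. \<forall>F. finite F \<longrightarrow> L2_set (\<lambda>i. cmod (f i - ell2_nth (X m) i)) F \<le> e"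
    if e: "e > 0" for e
  proof -
    obtain M where M: "\<And>m n. m \<ge> M \<Longrightarrow> n \<ge> M \<Longrightarrow> dist (X m) (X n) < e"
      using metric_CauchyD[OF X e] by blast
    have "L2_set (\<lambda>i. cmod (f i - ell2_nth (X m) i)) F \<le> e" if m: "m \<ge> M" for m F
    proof (rule LIMSEQ_le_const2)
      show "(\<lambda>n. L2_set (\<lambda>i. cmod (ell2_nth (X n) i - ell2_nth (X m) i)) F)
          \<longlonglongrightarrow> L2_set (\<lambda>i. cmod (f i - ell2_nth (X m) i)) F"
        unfolding L2_set_def by (intro tendsto_intros f)
      have "L2_set (\<lambda>i. cmod (ell2_nth (X n) i - ell2_nth (X m) i)) F \<le> e" if "n \<ge> M" for n
        using L2_set_le_ell2[OF ell2_summable, of "X n - X m" F] M[OF that m]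
        by (simp add: diff dist_norm norm_ell2.rep_eq)
      then show "\<exists>N. \<forall>n\<ge>N. L2_set (\<lambda>i. cmod (ell2_nth (X n) i - ell2_nth (X m) i)) F \<le> e"
        by blast
    qed
    then show ?thesis
      by blast
  qed
  obtain m where "\<forall>F. finite F \<longrightarrow> L2_set (\<lambda>i. cmod (f i - ell2_nth (X m) i)) F \<le> 1"
    using key[of 1] by auto
  then have "(\<lambda>i. (cmod (f i - ell2_nth (X m) i))\<^sup>2) summable_on UNIV"
    by (intro ell2_bound(1)) blast
  then have "(\<lambda>i. (cmod ((f i - ell2_nth (X m) i) + ell2_nth (X m) i))\<^sup>2) summable_on UNIV"
    by (rule ell2_bound(1)[OF ell2_add_bound[OF _ ell2_summable]])
  then have nth: "ell2_nth (Abs_ell2 f) = f"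
    by (simp add: Abs_ell2_inverse)
  have "X \<longlonglongrightarrow> Abs_ell2 f"
  proof (rule metric_LIMSEQ_I)
    fix e :: real
    assume "e > 0"
    then obtain M where M: "\<forall>m\<ge>M. \<forall>F. finite F \<longrightarrow> L2_set (\<lambda>i. cmod (f i - ell2_nth (X m) i)) F \<le> e / 2"
      using key[of "e / 2"] by auto
    have "dist (X m) (Abs_ell2 f) < e" if "m \<ge> M" for m
    proof -
      have "norm (Abs_ell2 f - X m) \<le> e / 2"
        unfolding norm_ell2.rep_eq diff nth using M that by (intro ell2_bound(2)) blast
      then show ?thesis
        using \<open>e > 0\<close> by (simp add: dist_norm norm_minus_commute)
    qed
    then show "\<exists>M. \<forall>m\<ge>M. dist (X m) (Abs_ell2 f) < e"
      by blast
  qed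
  then show "convergent X"
    by (rule convergentI)
qed

instantiation ell2 :: (type) chilbert_space
begin

lift_definition scaleC_ell2 :: "complex \<Rightarrow> 'a ell2 \<Rightarrow> 'a ell2" is "\<lambda>c f i. c * f i"
  by (rule ell2_scale)

lift_definition cinner_ell2 :: "'a ell2 \<Rightarrow> 'a ell2 \<Rightarrow> complex" is
  "\<lambda>f g. \<Sum>\<^sub>\<infinity>i. f i * cnj (g i)" .

instance
proof
  fix x y z :: "'a ell2" and a :: real and c d :: complex
  show "c *\<^sub>C (x + y) = c *\<^sub>C x + c *\<^sub>C y"
    by transfer (simp add: distrib_left)
  show "(c + d) *\<^sub>C x = c *\<^sub>C x + d *\<^sub>C x"
    by transfer (simp add: distrib_right)
  show "c *\<^sub>C d *\<^sub>C x = (c * d) *\<^sub>C x"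
    by transfer (simp add: mult.assoc)
  show "complex_of_real a *\<^sub>C x = a *\<^sub>R x"
    by transfer simp
  show "\<langle>x, y\<rangle> = cnj \<langle>y, x\<rangle>"
    by transfer (subst infsum_cnj[symmetric], simp add: mult.commute)
  show "\<langle>x + y, z\<rangle> = \<langle>x, z\<rangle> + \<langle>y, z\<rangle>"
    by transfer (simp add: distrib_right infsum_add ell2_mult_summable)
  show "\<langle>c *\<^sub>C x, y\<rangle> = c * \<langle>x, y\<rangle>"
    by transfer (simp add: mult.assoc infsum_cmult_right')
  show "\<langle>x, x\<rangle> = complex_of_real ((norm x)\<^sup>2)"
  proof transfer
    fix f :: "'a \<Rightarrow> complex"
    assume f: "(\<lambda>i. (cmod (f i))\<^sup>2) summable_on UNIV"
    have "complex_of_real ((sqrt (\<Sum>\<^sub>\<infinity>i. (cmod (f i))\<^sup>2))\<^sup>2) = complex_of_real (\<Sum>\<^sub>\<infinity>i. (cmod (f i))\<^sup>2)"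
      by (simp add: infsum_nonneg)
    also have "\<dots> = (\<Sum>\<^sub>\<infinity>i. complex_of_real ((cmod (f i))\<^sup>2))"
      by (intro infsumI[symmetric] has_sum_of_real_iff[THEN iffD2] has_sum_infsum f)
    also have "\<dots> = (\<Sum>\<^sub>\<infinity>i. f i * cnj (f i))"
      by (simp only: complex_norm_square)
    finally show "(\<Sum>\<^sub>\<infinity>i. f i * cnj (f i)) = complex_of_real ((sqrt (\<Sum>\<^sub>\<infinity>i. (cmod (f i))\<^sup>2))\<^sup>2)"
      by (rule sym)
  qed
qed

end

section \<open>Submajorization\<close>

text \<open>For a bounded family \<open>a\<close> the family under \<^const>\<open>Abs_ell2\<close> is square-summable.\<close>

definition diag_ell2 :: "('i \<Rightarrow> real) \<Rightarrow> 'i ell2 \<Rightarrow> 'i ell2" where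
  "diag_ell2 a x = Abs_ell2 (\<lambda>i. complex_of_real (a i) * ell2_nth x i)"

definition decr_rearrangement :: "('i \<Rightarrow> real) \<Rightarrow> nat \<Rightarrow> real" where
  "decr_rearrangement a n = spectral_scale (diag_ell2 a) (int (n + 1))"

definition submajorized :: "('i \<Rightarrow> real) \<Rightarrow> ('j \<Rightarrow> real) \<Rightarrow> bool" (infix "\<prec>\<^sub>w" 50) where
  "a \<prec>\<^sub>w b \<longleftrightarrow> (\<forall>k. (\<Sum>n<k. decr_rearrangement a n) \<le> (\<Sum>n<k. decr_rearrangement b n))"

section \<open>Unitarily invariant norms\<close>

definition orthonormal_basis :: "(nat \<Rightarrow> 'a::chilbert_space) \<Rightarrow> bool" where
  "orthonormal_basis e \<longleftrightarrow>
    (\<forall>i j. \<langle>e i, e j\<rangle> = (if i = j then 1 else 0)) \<and> closure (cspan (range e)) = UNIV"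

definition proper_ideal :: "('a::chilbert_space \<Rightarrow> 'a) set \<Rightarrow> bool" where
  "proper_ideal C \<longleftrightarrow> C \<subset> {T. bounded_op T} \<and> (\<lambda>_. 0) \<in> C
    \<and> (\<forall>S\<in>C. \<forall>T\<in>C. (\<lambda>x. S x + T x) \<in> C)
    \<and> (\<forall>T\<in>C. \<forall>D E. bounded_op D \<and> bounded_op E \<longrightarrow> D \<circ> T \<circ> E \<in> C)"

definition diag_op :: "(nat \<Rightarrow> 'a::chilbert_space) \<Rightarrow> (nat \<Rightarrow> real) \<Rightarrow> nat \<Rightarrow> 'a \<Rightarrow> 'a" where
  "diag_op e a n x = (\<Sum>i<n. (complex_of_real (a i) * \<langle>x, e i\<rangle>) *\<^sub>C e i)"

definition gauge_function ::
  "(nat \<Rightarrow> 'a::chilbert_space) \<Rightarrow> (('a \<Rightarrow> 'a) \<Rightarrow> real) \<Rightarrow> (nat \<Rightarrow> real) \<Rightarrow> ennreal" where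
  "gauge_function e N a = (SUP n. ennreal (N (diag_op e a n)))"

text \<open>The rank-one clause includes that rank-one operators lie in \<open>C\<close>, which only excludes
  \<open>C = {0}\<close>.  The last clause, that \<open>N\<close> is determined by its gauge function, does not
  follow from the others: adding a multiple of a Dixmier trace of \<open>|T|\<close> to a norm on the
  Dixmier--Macaev ideal changes \<open>N\<close> but not its values on finite-rank operators.\<close>

definition unitarily_invariant_norm ::
  "(nat \<Rightarrow> 'a::chilbert_space) \<Rightarrow> ('a \<Rightarrow> 'a) set \<Rightarrow> (('a \<Rightarrow> 'a) \<Rightarrow> real) \<Rightarrow> bool" where
  "unitarily_invariant_norm e C N \<longleftrightarrow> proper_ideal C
    \<and> (\<forall>T\<in>C. 0 \<le> N T \<and> (N T = 0 \<longleftrightarrow> T = (\<lambda>_. 0)))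
    \<and> (\<forall>T\<in>C. \<forall>c. N (\<lambda>x. c *\<^sub>C T x) = cmod c * N T)
    \<and> (\<forall>S\<in>C. \<forall>T\<in>C. N (\<lambda>x. S x + T x) \<le> N S + N T)
    \<and> (\<forall>T\<in>C. \<forall>D E. bounded_op D \<and> bounded_op E \<longrightarrow> N (D \<circ> T \<circ> E) \<le> onorm D * N T * onorm E)
    \<and> (\<forall>T. bounded_op T \<and> range T \<in> subspaces_of_dim 1 \<longrightarrow> T \<in> C \<and> N T = onorm T)
    \<and> (\<forall>T\<in>C. ennreal (N T) = gauge_function e N (singular_values T))"

text \<open>\<open>N\<close> extended by \<open>N(T) = g\<^sub>N(s(T))\<close>, with values in \<open>[0,\<infinity>]\<close>, to compact
  operators outside its ideal.\<close>

definition ext_norm ::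
  "(nat \<Rightarrow> 'a::chilbert_space) \<Rightarrow> ('a \<Rightarrow> 'a) set \<Rightarrow> (('a \<Rightarrow> 'a) \<Rightarrow> real) \<Rightarrow> ('a \<Rightarrow> 'a) \<Rightarrow> ennreal" where
  "ext_norm e C N T = (if T \<in> C then ennreal (N T) else gauge_function e N (singular_values T))"

end

theory Submission
  imports Defs
begin

text \<open>With \<open>K = \<i> (A X - X A)\<close> self-adjoint, \<open>\<langle>K u, u\<rangle> = 2 Im \<langle>A u, X u\<rangle>\<close>.  Summed over an
  orthonormal family, only the parts of \<open>A u\<close> and \<open>X u\<close> orthogonal to its span contribute,
  since the trace of a product of two Hermitian matrices is real.  Twice the sum of the
  first singular values of an off-diagonal block of \<open>A\<close> is at most the corresponding sum of
  spreads, so a singular value decomposition and two summations by parts bound the sum of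
  \<open>2 Im \<langle>A u, X u\<rangle>\<close> by half the sum of products of spreads.  The singular values of \<open>K\<close> merge
  its positive and negative spectral scale; this is handled by placing the family for \<open>K\<close> and
  the family for \<open>- K\<close> in the two summands of \<open>H \<oplus> H\<close>, where the spreads of \<open>A \<oplus> A\<close> and
  \<open>X \<oplus> X\<close> appear.\<close>

text \<open>The infima and suprema that define the scale of a bounded operator need not be attained.
  Families adapted to \<open>K\<close> and \<open>- K\<close> are therefore optimal only up to an
  arbitrarily small \<open>d\<close>, and exact singular vectors are used only on the
  finite-dimensional span of such a family. Nearly optimal families for \<open>K\<close> and for
  \<open>- K\<close> need not be orthogonal to each other in \<open>H\<close>, so they cannot be
  joined there to one orthonormal family; in \<open>H \<oplus> H\<close> they can, at the price of a
  sign on the second summand. The constant 1/2 is the product of 2, 1/2 and 1/2: the factor 2 is the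
  one in \<open>2 Im \<langle>A u, X u\<rangle>\<close>, and each summation by parts contributes the
  1/2 of the off-diagonal estimate, once for \<open>X\<close> and once for \<open>A\<close>. The
  norm inequality follows from the same partial sums by Fan dominance.\<close>

section \<open>Inner products\<close>

lemma cinner_add_right: "\<langle>x, y + z\<rangle> = \<langle>x, y\<rangle> + \<langle>x, z\<rangle>"
  by (metis cinner_add_left cinner_commute complex_cnj_add)

lemma cinner_scaleC_right: "\<langle>x, c *\<^sub>C y\<rangle> = cnj c * \<langle>x, y\<rangle>"
  by (metis cinner_scaleC_left cinner_commute complex_cnj_mult)

lemma Re_cinner_self: "Re \<langle>x, x\<rangle> = (norm x)\<^sup>2"
  by (simp add: cinner_self)

lemma Re_cinner_commute: "Re \<langle>x, y\<rangle> = Re \<langle>y, x\<rangle>"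
  by (subst cinner_commute) simp

lemma norm_add_square:
  fixes x y :: "'a::chilbert_space"
  shows "(norm (x + y))\<^sup>2 = (norm x)\<^sup>2 + 2 * Re \<langle>x, y\<rangle> + (norm y)\<^sup>2"
  using Re_cinner_commute[of y x]
  by (simp add: cinner_add_left cinner_add_right flip: Re_cinner_self)

lemma norm_scaleC: "norm (c *\<^sub>C x) = cmod c * norm x"
proof -
  have "complex_of_real ((norm (c *\<^sub>C x))\<^sup>2) = complex_of_real ((cmod c * norm x)\<^sup>2)"
    unfolding cinner_self[symmetric] cinner_scaleC_left cinner_scaleC_right
    using complex_norm_square[of c] by (auto simp: cinner_self power_mult_distrib mult.commute)
  then have "(norm (c *\<^sub>C x))\<^sup>2 = (cmod c * norm x)\<^sup>2"
    unfolding of_real_eq_iff .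
  then show ?thesis
    by (simp add: power2_eq_iff_nonneg)
qed

lemma cmod_cinner_le: "cmod \<langle>x, y\<rangle> \<le> norm x * norm y"
proof (cases "\<langle>x, y\<rangle> = 0")
  case False
  define a where "a = cmod \<langle>x, y\<rangle>"
  \<comment> \<open>This scalar makes the inner product of \<open>x\<close> with
    \<open>c *\<^sub>C y\<close> equal to \<open>- (norm x)\<^sup>2\<close>, so expanding the
    squared norm of their sum leaves \<open>norm x \<le> norm (c *\<^sub>C y)\<close>.\<close>
  define c where "c = complex_of_real (- ((norm x)\<^sup>2 / a\<^sup>2)) * \<langle>x, y\<rangle>"
  have a: "a > 0"
    using False by (simp add: a_def)
  have 1: "Re \<langle>x, c *\<^sub>C y\<rangle> = - (norm x)\<^sup>2"
  proof -
    have "\<langle>x, c *\<^sub>C y\<rangle> = complex_of_real (- ((norm x)\<^sup>2 / a\<^sup>2)) * (\<langle>x, y\<rangle> * cnj \<langle>x, y\<rangle>)"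
      unfolding cinner_scaleC_right c_def complex_cnj_mult complex_cnj_complex_of_real by simp
    also have "\<langle>x, y\<rangle> * cnj \<langle>x, y\<rangle> = complex_of_real (a\<^sup>2)"
      unfolding a_def by (rule complex_norm_square[symmetric])
    finally show ?thesis
      using a by (simp flip: of_real_mult)
  qed
  have 2: "norm (c *\<^sub>C y) = (norm x)\<^sup>2 / a * norm y"
    using a unfolding c_def norm_scaleC norm_mult norm_of_real a_def[symmetric]
    by (simp add: power2_eq_square)
  have "0 \<le> (norm (x + c *\<^sub>C y))\<^sup>2"
    by simp
  then have "(norm x)\<^sup>2 \<le> ((norm x)\<^sup>2 / a * norm y)\<^sup>2"
    unfolding norm_add_square 1 2 by simp
  then have "norm x \<le> (norm x)\<^sup>2 / a * norm y"
    using a by (simp add: abs_le_square_iff[symmetric])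
  moreover have "norm x > 0"
    using False cinner_scaleC_left[of 0 x y] by (auto simp: cvec.scale_zero_left)
  ultimately show ?thesis
    using a by (simp add: field_simps power2_eq_square flip: a_def)
qed simp

lemma scaleC_scaleR: "c *\<^sub>C (r *\<^sub>R x) = r *\<^sub>R (c *\<^sub>C x)"
  by (simp add: scaleC_scaleC mult.commute flip: scaleC_of_real)

lemma scaleR_scaleC_left: "(r *\<^sub>R c) *\<^sub>C x = r *\<^sub>R (c *\<^sub>C x)"
  by (simp add: scaleC_scaleC scaleR_conv_of_real flip: scaleC_of_real)

lemma cinner_scaleR_left: "\<langle>r *\<^sub>R x, y\<rangle> = r *\<^sub>R \<langle>x, y\<rangle>"
  by (simp add: cinner_scaleC_left scaleR_conv_of_real flip: scaleC_of_real)

lemma cinner_scaleR_right: "\<langle>x, r *\<^sub>R y\<rangle> = r *\<^sub>R \<langle>x, y\<rangle>"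
  by (simp add: cinner_scaleC_right scaleR_conv_of_real flip: scaleC_of_real)

global_interpretation cinner: bounded_bilinear "cinner :: 'a::chilbert_space \<Rightarrow> 'a \<Rightarrow> complex"
  by (rule bounded_bilinear.intro)
    (auto simp: cinner_add_left cinner_add_right cinner_scaleR_left cinner_scaleR_right
      intro!: exI[of _ 1] cmod_cinner_le)

global_interpretation scaleC: bounded_bilinear "scaleC :: complex \<Rightarrow> 'a::chilbert_space \<Rightarrow> 'a"
  by (rule bounded_bilinear.intro)
    (auto simp: scaleC_add_left scaleC_add_right scaleC_scaleR scaleR_scaleC_left norm_scaleC
      intro!: exI[of _ 1])

lemma cinner_ext: "(\<And>z. \<langle>x, z\<rangle> = \<langle>y, z\<rangle>) \<Longrightarrow> x = y"
  using cinner_self[of "x - y"] by (simp add: cinner.diff_left)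

lemma cinner_cspan_right: "y \<in> cspan B \<Longrightarrow> (\<And>b. b \<in> B \<Longrightarrow> \<langle>x, b\<rangle> = 0) \<Longrightarrow> \<langle>x, y\<rangle> = 0"
  by (induction rule: cvec.span_induct_alt) (auto simp: cinner_add_right cinner_scaleC_right cinner.zero_right)

text \<open>The first-order condition at a minimum, in the form shared by the variational arguments
  below: a parabola through the origin that stays nonnegative has slope zero there.\<close>

lemma linear_term_eq_0:
  fixes a b :: real
  assumes "\<And>t. 0 \<le> 2 * t * b + t\<^sup>2 * a"
  shows "b = 0"
proof (rule ccontr)
  assume b: "b \<noteq> 0"
  \<comment> \<open>The vertex \<open>- b / a\<close> is replaced by a point that is defined for
    every sign of \<open>a\<close>, including \<open>a = 0\<close>.\<close>
  define t where "t = - b / (\<bar>a\<bar> + 1)"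
  have "2 * t * b + t\<^sup>2 * a \<le> 2 * t * b + t\<^sup>2 * (\<bar>a\<bar> + 1)"
    by (simp add: mult_left_mono)
  also have "\<dots> = - (b\<^sup>2 / (\<bar>a\<bar> + 1))"
    by (simp add: t_def power2_eq_square)
  also have "\<dots> < 0"
    using b by (simp add: divide_pos_pos add_nonneg_pos)
  finally show False
    using assms[of t] by simp
qed

section \<open>Bounded operators\<close>

lemma bounded_op_linear: "bounded_op T \<Longrightarrow> bounded_linear T"
  by (simp add: bounded_op_def)

lemma bounded_opI:
  assumes "\<And>x y. T (x + y) = T x + T y" "\<And>c x. T (c *\<^sub>C x) = c *\<^sub>C T x"
    and "\<And>x. norm (T x) \<le> norm x * K"
  shows "bounded_op T"
  unfolding bounded_op_def using assms
  by (auto intro!: bounded_linear_intro[where K = K] simp flip: scaleC_of_real)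

lemma bounded_op_simps:
  assumes "bounded_op T"
  shows "T (x + y) = T x + T y" "T (x - y) = T x - T y" "T (- x) = - T x" "T 0 = 0"
    "T (c *\<^sub>C x) = c *\<^sub>C T x" "T (r *\<^sub>R x) = r *\<^sub>R T x" "T (sum f I) = (\<Sum>i\<in>I. T (f i))"
proof -
  have "linear T"
    using assms by (rule bounded_linear.linear[OF bounded_op_linear])
  show "T (x + y) = T x + T y" "T (x - y) = T x - T y" "T (- x) = - T x" "T 0 = 0"
    "T (c *\<^sub>C x) = c *\<^sub>C T x" "T (r *\<^sub>R x) = r *\<^sub>R T x" "T (sum f I) = (\<Sum>i\<in>I. T (f i))"
    using assms \<open>linear T\<close> by (simp_all add: linear_add linear_diff linear_neg linear_0 linear_scale
        linear_sum bounded_op_def)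
qed

lemma bounded_op_bound:
  assumes "bounded_op T"
  obtains K where "0 < K" "\<And>x. norm (T x) \<le> norm x * K"
  using bounded_linear.pos_bounded[OF bounded_op_linear[OF assms]] by auto

lemma bounded_op_compose: "bounded_op S \<Longrightarrow> bounded_op T \<Longrightarrow> bounded_op (\<lambda>x. S (T x))"
  by (auto simp: bounded_op_def intro: bounded_linear_compose)

lemma bounded_op_add: "bounded_op S \<Longrightarrow> bounded_op T \<Longrightarrow> bounded_op (\<lambda>x. S x + T x)"
  by (auto simp: bounded_op_def scaleC_add_right intro: bounded_linear_add)

lemma bounded_op_diff: "bounded_op S \<Longrightarrow> bounded_op T \<Longrightarrow> bounded_op (\<lambda>x. S x - T x)"
  by (auto simp: bounded_op_def scaleC.diff_right intro: bounded_linear_sub)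

lemma bounded_op_minus: "bounded_op T \<Longrightarrow> bounded_op (\<lambda>x. - T x)"
  by (auto simp: bounded_op_def scaleC.minus_right intro: bounded_linear_minus)

lemma bounded_op_scaleC: "bounded_op T \<Longrightarrow> bounded_op (\<lambda>x. c *\<^sub>C T x)"
  by (auto simp: bounded_op_def scaleC_scaleC mult.commute
      intro: bounded_linear_compose[OF scaleC.bounded_linear_right])

lemma bounded_op_sum: "(\<And>i. i \<in> I \<Longrightarrow> bounded_op (T i)) \<Longrightarrow> bounded_op (\<lambda>x. \<Sum>i\<in>I. T i x)"
proof (induction I rule: infinite_finite_induct)
  case (insert i I)
  then show ?case
    by (simp add: bounded_op_add)
qed (simp_all add: bounded_op_def bounded_linear_zero scaleC.zero_right)

lemma bounded_op_rank_one: "bounded_op (\<lambda>x. \<langle>x, a\<rangle> *\<^sub>C b)"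
  by (rule bounded_opI[where K = "norm a * norm b"])
    (auto simp: cinner_add_left scaleC_add_left cinner_scaleC_left scaleC_scaleC norm_scaleC
      mult.assoc[symmetric] intro!: mult_right_mono cmod_cinner_le)

lemma selfadjointD: "selfadjoint_op T \<Longrightarrow> \<langle>T x, y\<rangle> = \<langle>x, T y\<rangle>"
  by (simp add: selfadjoint_op_def)

lemma selfadjoint_bounded: "selfadjoint_op T \<Longrightarrow> bounded_op T"
  by (simp add: selfadjoint_op_def)

text \<open>The nonnegative form vanishes at \<open>x\<close>, so \<open>x\<close> is a minimum; the
  derivative in the direction \<open>R x\<close> is twice the squared norm of
  \<open>R x\<close>.\<close>

lemma positive_op_kernel:
  assumes R: "positive_op R" and x: "Re \<langle>R x, x\<rangle> = 0"
  shows "R x = 0"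
proof -
  note S = R[unfolded positive_op_def, THEN conjunct1]
  note simps = bounded_op_simps[OF selfadjoint_bounded[OF S]]
  have "Re \<langle>R x, R x\<rangle> = 0"
  proof (rule linear_term_eq_0)
    fix t :: real
    have "0 \<le> Re \<langle>R (x + t *\<^sub>R R x), x + t *\<^sub>R R x\<rangle>"
      using R unfolding positive_op_def by blast
    also have "\<dots> = 2 * t * Re \<langle>R x, R x\<rangle> + t\<^sup>2 * Re \<langle>R (R x), R x\<rangle>"
      using x selfadjointD[OF S, of "R x" x]
      by (simp add: simps cinner_add_left cinner_add_right cinner.scaleR_left cinner.scaleR_right
          power2_eq_square algebra_simps)
    finally show "0 \<le> 2 * t * Re \<langle>R x, R x\<rangle> + t\<^sup>2 * Re \<langle>R (R x), R x\<rangle>" .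
  qed
  then show ?thesis
    by (simp add: Re_cinner_self)
qed

section \<open>Finite orthonormal families\<close>

text \<open>Only the values below \<open>n\<close> are constrained, so that a family is extended by
  \<open>u(n := w)\<close> and truncated by lowering \<open>n\<close>.\<close>

definition orthonormal_upto :: "nat \<Rightarrow> (nat \<Rightarrow> 'a::chilbert_space) \<Rightarrow> bool" where
  "orthonormal_upto n u \<longleftrightarrow> (\<forall>i<n. \<forall>j<n. \<langle>u i, u j\<rangle> = (if i = j then 1 else 0))"

lemma orthonormal_uptoD: "orthonormal_upto n u \<Longrightarrow> i < n \<Longrightarrow> j < n \<Longrightarrow> \<langle>u i, u j\<rangle> = (if i = j then 1 else 0)"
  by (simp add: orthonormal_upto_def)

lemma orthonormal_upto_norm: "orthonormal_upto n u \<Longrightarrow> i < n \<Longrightarrow> norm (u i) = 1"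
  using orthonormal_uptoD[of n u i i] Re_cinner_self[of "u i"] norm_ge_zero[of "u i"]
  by (auto simp: power2_eq_1_iff simp del: norm_ge_zero)

lemma orthonormal_upto_mono: "orthonormal_upto n u \<Longrightarrow> m \<le> n \<Longrightarrow> orthonormal_upto m u"
  by (simp add: orthonormal_upto_def)

lemma orthonormal_upto_Suc:
  "orthonormal_upto (Suc n) u \<longleftrightarrow> orthonormal_upto n u \<and> norm (u n) = 1 \<and> (\<forall>i<n. \<langle>u n, u i\<rangle> = 0)"
proof -
  have "- 1 \<noteq> norm (u n)"
    using norm_ge_zero[of "u n"] by linarith
  then have "\<langle>u n, u n\<rangle> = 1 \<longleftrightarrow> norm (u n) = 1"
    unfolding cinner_self of_real_eq_1_iff power2_eq_1_iff by auto
  moreover have "\<langle>u i, u n\<rangle> = 0 \<longleftrightarrow> \<langle>u n, u i\<rangle> = 0" if "i < n" for i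
    by (metis cinner_commute complex_cnj_zero)
  ultimately show ?thesis
    unfolding orthonormal_upto_def All_less_Suc by auto
qed

lemma orthonormal_upto_update: "orthonormal_upto n u \<Longrightarrow> orthonormal_upto n (u(n := w))"
  by (simp add: orthonormal_upto_def)

lemma cinner_sum_orthonormal:
  assumes "orthonormal_upto n u" "j < n"
  shows "\<langle>\<Sum>i<n. c i *\<^sub>C u i, u j\<rangle> = c j"
  using assms by (simp add: cinner.sum_left cinner_scaleC_left orthonormal_uptoD if_distrib cong: if_cong)

definition cproj :: "nat \<Rightarrow> (nat \<Rightarrow> 'a::chilbert_space) \<Rightarrow> 'a \<Rightarrow> 'a" where
  "cproj n u x = (\<Sum>i<n. \<langle>x, u i\<rangle> *\<^sub>C u i)"

lemma cproj_in_span: "cproj n u x \<in> cspan (u ` {..<n})"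
  unfolding cproj_def by (intro cvec.span_sum cvec.span_scale cvec.span_base) auto

lemma bounded_op_cproj: "bounded_op (cproj n u)"
  unfolding cproj_def by (intro bounded_op_sum bounded_op_rank_one)

lemma cproj_orth:
  assumes "orthonormal_upto n u" "y \<in> cspan (u ` {..<n})"
  shows "\<langle>x - cproj n u x, y\<rangle> = 0"
  using assms(2)
proof (rule cinner_cspan_right)
  fix b assume "b \<in> u ` {..<n}"
  then show "\<langle>x - cproj n u x, b\<rangle> = 0"
    by (auto simp: cproj_def cinner.diff_left cinner_sum_orthonormal[OF assms(1)])
qed

lemma cproj_span:
  assumes u: "orthonormal_upto n u" and x: "x \<in> cspan (u ` {..<n})"
  shows "cproj n u x = x"
proof -
  have "x - cproj n u x \<in> cspan (u ` {..<n})"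
    by (intro cvec.span_diff x cproj_in_span)
  from cproj_orth[OF u this, of x] have "norm (x - cproj n u x) = 0"
    by (simp add: cinner_self)
  then show ?thesis
    by simp
qed

lemma cinner_cproj:
  assumes "orthonormal_upto n u"
  shows "\<langle>cproj n u x, x\<rangle> = complex_of_real (\<Sum>i<n. (cmod \<langle>x, u i\<rangle>)\<^sup>2)"
  unfolding cproj_def cinner.sum_left cinner_scaleC_left of_real_sum
  by (intro sum.cong refl) (metis complex_norm_square cinner_commute)

lemma norm_diff_cproj:
  assumes "orthonormal_upto n u"
  shows "(norm (x - cproj n u x))\<^sup>2 = (norm x)\<^sup>2 - (\<Sum>i<n. (cmod \<langle>x, u i\<rangle>)\<^sup>2)"
proof -
  have "\<langle>x - cproj n u x, x - cproj n u x\<rangle> = \<langle>x - cproj n u x, x\<rangle>"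
    using cproj_orth[OF assms cproj_in_span, of x x] by (simp add: cinner.diff_right)
  then have "Re \<langle>x - cproj n u x, x - cproj n u x\<rangle> = Re \<langle>x - cproj n u x, x\<rangle>"
    by simp
  then show ?thesis
    unfolding Re_cinner_self by (simp add: cinner.diff_left cinner_cproj[OF assms] Re_cinner_self)
qed

lemma bessel: "orthonormal_upto n u \<Longrightarrow> (\<Sum>i<n. (cmod \<langle>x, u i\<rangle>)\<^sup>2) \<le> (norm x)\<^sup>2"
  using norm_diff_cproj[of n u x] zero_le_power2[of "norm (x - cproj n u x)"] by linarith

lemma parseval:
  assumes "orthonormal_upto n u" "x \<in> cspan (u ` {..<n})"
  shows "(norm x)\<^sup>2 = (\<Sum>i<n. (cmod \<langle>x, u i\<rangle>)\<^sup>2)"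
  using norm_diff_cproj[OF assms(1), of x] cproj_span[OF assms] by simp

lemma norm_sum_orthonormal:
  assumes "orthonormal_upto n u"
  shows "(norm (\<Sum>i<n. c i *\<^sub>C u i))\<^sup>2 = (\<Sum>i<n. (cmod (c i))\<^sup>2)"
proof -
  have "(\<Sum>i<n. c i *\<^sub>C u i) \<in> cspan (u ` {..<n})"
    by (intro cvec.span_sum cvec.span_scale cvec.span_base) auto
  from parseval[OF assms this] show ?thesis
    using assms by (simp add: cinner_sum_orthonormal)
qed

text \<open>Summing Bessel's defect of the \<open>u j\<close> against \<open>v\<close> gives \<open>n - n = 0\<close>, since the
  double sum of \<open>|\<langle>v i, u j\<rangle>|\<^sup>2\<close> can be evaluated in either order.\<close>

lemma cspan_orthonormal_eq:
  assumes u: "orthonormal_upto n u" and v: "orthonormal_upto n v"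
    and sub: "\<And>i. i < n \<Longrightarrow> v i \<in> cspan (u ` {..<n})"
  shows "cspan (v ` {..<n}) = cspan (u ` {..<n})"
proof
  show "cspan (v ` {..<n}) \<subseteq> cspan (u ` {..<n})"
    using sub by (intro cvec.span_minimal) (auto simp: cvec.subspace_span)
  have "(\<Sum>j<n. (norm (u j - cproj n v (u j)))\<^sup>2) = (\<Sum>j<n. 1 - (\<Sum>i<n. (cmod \<langle>u j, v i\<rangle>)\<^sup>2))"
    by (intro sum.cong refl) (simp add: norm_diff_cproj[OF v] orthonormal_upto_norm[OF u])
  also have "\<dots> = real n - (\<Sum>i<n. \<Sum>j<n. (cmod \<langle>u j, v i\<rangle>)\<^sup>2)"
    unfolding sum_subtractf by (subst sum.swap) simp
  also have "(\<Sum>i<n. \<Sum>j<n. (cmod \<langle>u j, v i\<rangle>)\<^sup>2) = (\<Sum>i<n. (norm (v i))\<^sup>2)"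
    by (intro sum.cong refl) (metis (no_types, lifting) parseval[OF u] sub lessThan_iff
        cinner_commute complex_mod_cnj sum.cong)
  also have "\<dots> = real n"
    by (simp add: orthonormal_upto_norm[OF v])
  finally have "(\<Sum>j<n. (norm (u j - cproj n v (u j)))\<^sup>2) = 0"
    by simp
  then have "\<forall>j<n. u j = cproj n v (u j)"
    by (subst (asm) sum_nonneg_eq_0_iff) auto
  then have "u ` {..<n} \<subseteq> cspan (v ` {..<n})"
    by (metis cproj_in_span image_subsetI lessThan_iff)
  then show "cspan (u ` {..<n}) \<subseteq> cspan (v ` {..<n})"
    by (intro cvec.span_minimal) (auto simp: cvec.subspace_span)
qed

text \<open>Both sums are the trace of one sesquilinear form on the common span. Expanding
  \<open>u i\<close> in the \<open>v j\<close> in the first slot and moving the coefficients into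
  the second slot reassembles \<open>v j\<close> from the \<open>u i\<close>.\<close>

lemma trace_invariance:
  assumes u: "orthonormal_upto n u" and v: "orthonormal_upto n v"
    and span: "cspan (v ` {..<n}) = cspan (u ` {..<n})" and S: "bounded_op S" and T: "bounded_op T"
  shows "(\<Sum>i<n. \<langle>S (u i), T (u i)\<rangle>) = (\<Sum>i<n. \<langle>S (v i), T (v i)\<rangle>)"
proof -
  have uv: "u i \<in> cspan (v ` {..<n})" "v i \<in> cspan (u ` {..<n})" if "i < n" for i
    using that span by (metis cvec.span_base imageI lessThan_iff)+
  have "(\<Sum>i<n. \<langle>S (u i), T (u i)\<rangle>) = (\<Sum>i<n. \<langle>S (cproj n v (u i)), T (u i)\<rangle>)"
    by (intro sum.cong refl) (simp add: cproj_span[OF v] uv)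
  also have "\<dots> = (\<Sum>i<n. \<Sum>j<n. \<langle>S (v j), \<langle>v j, u i\<rangle> *\<^sub>C T (u i)\<rangle>)"
    by (simp add: cproj_def bounded_op_simps[OF S] cinner.sum_left cinner_scaleC_left
        cinner_scaleC_right flip: cinner_commute)
  also have "\<dots> = (\<Sum>j<n. \<langle>S (v j), T (cproj n u (v j))\<rangle>)"
    by (subst sum.swap) (simp add: cproj_def bounded_op_simps[OF T] cinner.sum_right)
  also have "\<dots> = (\<Sum>j<n. \<langle>S (v j), T (v j)\<rangle>)"
    by (intro sum.cong refl) (simp add: cproj_span[OF u] uv)
  finally show ?thesis .
qed

section \<open>Dimension counts and the extension of orthonormal families\<close>

text \<open>Gaussian elimination, by induction on the equations: one with a nonzero coefficient is
  solved for its unknown \<open>k\<close>, which costs one equation and one unknown.\<close>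

lemma homogeneous_system_solution:
  fixes g :: "'i \<Rightarrow> 'b \<Rightarrow> complex"
  assumes "finite B" "finite I" "card B < card I"
  shows "\<exists>c. (\<exists>i\<in>I. c i \<noteq> 0) \<and> (\<forall>b\<in>B. (\<Sum>i\<in>I. c i * g i b) = 0)"
  using assms
proof (induction B arbitrary: I g rule: finite_induct)
  case empty
  then show ?case
    by (auto intro!: exI[of _ "\<lambda>_. 1"] simp: card_gt_0_iff)
next
  case (insert b B)
  show ?case
  proof (cases "\<forall>i\<in>I. g i b = 0")
    case True
    with insert show ?thesis
      using insert.IH[of I g] by auto
  next
    case False
    then obtain k where k: "k \<in> I" "g k b \<noteq> 0"
      by blast
    \<comment> \<open>The system that remains after the unknown \<open>k\<close> is eliminated by
      means of equation \<open>b\<close>.\<close>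
    define h where "h i b' = g i b' - g i b / g k b * g k b'" for i b'
    have "card B < card (I - {k})"
      using insert k by simp
    with insert.IH[of "I - {k}" h] insert.prems obtain c where
      c: "\<exists>i\<in>I - {k}. c i \<noteq> 0" "\<forall>b'\<in>B. (\<Sum>i\<in>I - {k}. c i * h i b') = 0"
      by auto
    \<comment> \<open>Back substitution: the value at \<open>k\<close> is the one that makes
      equation \<open>b\<close> hold.\<close>
    define d where "d = c(k := - (\<Sum>i\<in>I - {k}. c i * g i b) / g k b)"
    have d: "(\<Sum>i\<in>I. d i * g i b') = (\<Sum>i\<in>I - {k}. c i * h i b')" for b'
    proof -
      have "(\<Sum>i\<in>I. d i * g i b') = d k * g k b' + (\<Sum>i\<in>I - {k}. d i * g i b')"
        by (rule sum.remove[OF insert.prems(1) k(1)])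
      also have "(\<Sum>i\<in>I - {k}. d i * g i b') = (\<Sum>i\<in>I - {k}. c i * g i b')"
        by (intro sum.cong) (auto simp: d_def)
      also have "d k * g k b' = - (\<Sum>i\<in>I - {k}. c i * (g i b / g k b * g k b'))"
        by (simp add: d_def sum_distrib_left sum_distrib_right sum_divide_distrib mult.assoc)
      finally show ?thesis
        by (simp add: h_def right_diff_distrib sum_subtractf)
    qed
    have "(\<Sum>i\<in>I - {k}. c i * h i b) = 0"
      using k by (simp add: h_def)
    then have "\<forall>b'\<in>insert b B. (\<Sum>i\<in>I. d i * g i b') = 0"
      using c(2) d by auto
    moreover have "\<exists>i\<in>I. d i \<noteq> 0"
      using c(1) by (auto simp: d_def)
    ultimately show ?thesis
      by blast
  qed
qed

text \<open>The conditions are fewer than \<open>n\<close> homogeneous equations for the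
  \<open>n\<close> coefficients with respect to \<open>u\<close>, so a nonzero combination exists
  and can be normalized.\<close>

lemma unit_vector_orthogonal:
  assumes u: "orthonormal_upto n u" and B: "finite B" "card B < n"
  obtains x where "x \<in> cspan (u ` {..<n})" "norm x = 1" "\<And>b. b \<in> B \<Longrightarrow> \<langle>x, b\<rangle> = 0"
proof -
  obtain c where c: "\<exists>i\<in>{..<n}. c i \<noteq> 0" "\<forall>b\<in>B. (\<Sum>i<n. c i * \<langle>u i, b\<rangle>) = 0"
    using homogeneous_system_solution[of B "{..<n}" "\<lambda>i b. \<langle>u i, b\<rangle>"] B by auto
  define y where "y = (\<Sum>i<n. c i *\<^sub>C u i)"
  have "y \<noteq> 0"
    using c(1) cinner_sum_orthonormal[OF u, of _ c] by (auto simp: y_def cinner.zero_left)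
  show ?thesis
  proof
    show "(1 / norm y) *\<^sub>R y \<in> cspan (u ` {..<n})"
      unfolding y_def scaleC_of_real[symmetric]
      by (intro cvec.span_sum cvec.span_scale cvec.span_base) auto
    show "norm ((1 / norm y) *\<^sub>R y) = 1"
      using \<open>y \<noteq> 0\<close> by simp
    show "\<langle>(1 / norm y) *\<^sub>R y, b\<rangle> = 0" if "b \<in> B" for b
      using c(2) that by (simp add: y_def cinner.scaleR_left cinner.sum_left cinner_scaleC_left)
  qed
qed

text \<open>The prescribed vector goes last because the inductions below split off the last
  vector.\<close>

lemma orthonormal_upto_extend:
  assumes u: "orthonormal_upto (Suc n) u" and w: "w \<in> cspan (u ` {..<Suc n})" "norm w = 1"
  obtains v where "orthonormal_upto (Suc n) v" "v n = w"
    "cspan (v ` {..<Suc n}) = cspan (u ` {..<Suc n})"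
proof -
  have "\<exists>v. orthonormal_upto m v \<and> (\<forall>i<m. v i \<in> cspan (u ` {..<Suc n}) \<and> \<langle>v i, w\<rangle> = 0)" if "m \<le> n" for m
    using that
  proof (induction m)
    case 0
    then show ?case
      by (simp add: orthonormal_upto_def)
  next
    case (Suc m)
    then obtain v where v: "orthonormal_upto m v"
      "\<forall>i<m. v i \<in> cspan (u ` {..<Suc n}) \<and> \<langle>v i, w\<rangle> = 0"
      by auto
    \<comment> \<open>At most \<open>m + 1 \<le> n\<close> conditions in a span of dimension
      \<open>n + 1\<close>.\<close>
    have "card (insert w (v ` {..<m})) < Suc n"
      using Suc.prems card_image_le[of "{..<m}" v] card_insert_le_m1[of "Suc m" "v ` {..<m}" w]
      by simp
    then obtain x where x: "x \<in> cspan (u ` {..<Suc n})" "norm x = 1"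
      "\<And>b. b \<in> insert w (v ` {..<m}) \<Longrightarrow> \<langle>x, b\<rangle> = 0"
      using unit_vector_orthogonal[OF u, of "insert w (v ` {..<m})"] by auto
    have "orthonormal_upto (Suc m) (v(m := x))"
      using v(1) x unfolding orthonormal_upto_Suc by (simp add: orthonormal_upto_update)
    moreover have "\<forall>i<Suc m. (v(m := x)) i \<in> cspan (u ` {..<Suc n}) \<and> \<langle>(v(m := x)) i, w\<rangle> = 0"
      using v(2) x by (simp add: less_Suc_eq)
    ultimately show ?case
      by blast
  qed
  then obtain v where v: "orthonormal_upto n v"
    "\<And>i. i < n \<Longrightarrow> v i \<in> cspan (u ` {..<Suc n})" "\<And>i. i < n \<Longrightarrow> \<langle>v i, w\<rangle> = 0"
    by blast
  have "\<langle>w, v i\<rangle> = 0" if "i < n" for i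
    using v(3)[OF that] by (metis cinner_commute complex_cnj_zero)
  then have on: "orthonormal_upto (Suc n) (v(n := w))"
    using v(1) w(2) unfolding orthonormal_upto_Suc by (simp add: orthonormal_upto_update)
  have "cspan ((v(n := w)) ` {..<Suc n}) = cspan (u ` {..<Suc n})"
    by (rule cspan_orthonormal_eq[OF u on]) (use v(2) w(1) in \<open>auto simp: less_Suc_eq\<close>)
  with on show ?thesis
    by (intro that[of "v(n := w)"]) auto
qed

lemma orthonormal_upto_exists:
  assumes "infinite_dim TYPE('a::chilbert_space)"
  shows "\<exists>u :: nat \<Rightarrow> 'a. orthonormal_upto n u"
proof (induction n)
  case 0
  show ?case
    by (simp add: orthonormal_upto_def)
next
  case (Suc n)
  then obtain u :: "nat \<Rightarrow> 'a" where u: "orthonormal_upto n u"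
    by blast
  have "cspan (u ` {..<n}) \<noteq> UNIV"
    using assms unfolding infinite_dim_def by blast
  then obtain y where y: "y \<notin> cspan (u ` {..<n})"
    by blast
  define z where "z = y - cproj n u y"
  have "z \<noteq> 0"
    using y cproj_in_span[of n u y] by (auto simp: z_def)
  moreover have "\<langle>z, u i\<rangle> = 0" if "i < n" for i
    unfolding z_def using cproj_orth[OF u, of "u i"] that by (simp add: cvec.span_base)
  ultimately have "orthonormal_upto (Suc n) (u(n := (1 / norm z) *\<^sub>R z))"
    using u unfolding orthonormal_upto_Suc by (simp add: orthonormal_upto_update cinner.scaleR_left)
  then show ?case
    by blast
qed

lemma infinite_dimI:
  assumes "\<And>n. \<exists>u :: nat \<Rightarrow> 'a::chilbert_space. orthonormal_upto n u"
  shows "infinite_dim TYPE('a)"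
  unfolding infinite_dim_def
proof
  assume "\<exists>B :: 'a set. finite B \<and> cspan B = UNIV"
  then obtain B :: "'a set" where B: "finite B" "cspan B = UNIV"
    by blast
  obtain u :: "nat \<Rightarrow> 'a" where "orthonormal_upto (Suc (card B)) u"
    using assms by blast
  then obtain x where x: "norm x = 1" "\<And>b. b \<in> B \<Longrightarrow> \<langle>x, b\<rangle> = 0"
    using unit_vector_orthogonal[of "Suc (card B)" u B] B(1) by auto
  have "\<langle>x, x\<rangle> = 0"
    using B(2) x(2) by (intro cinner_cspan_right[of x B]) auto
  then show False
    using x(1) by (simp add: cinner_self)
qed

lemma infinite_dim_orthogonal:
  fixes B :: "'a::chilbert_space set"
  assumes "infinite_dim TYPE('a)" "finite B"
  obtains x where "norm x = 1" "\<And>b. b \<in> B \<Longrightarrow> \<langle>x, b\<rangle> = 0"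
proof -
  obtain u :: "nat \<Rightarrow> 'a" where "orthonormal_upto (Suc (card B)) u"
    using orthonormal_upto_exists[OF assms(1)] by blast
  then show ?thesis
    using unit_vector_orthogonal[of "Suc (card B)" u B] assms(2) that by auto
qed

section \<open>The spectral scale\<close>

definition upper_scale :: "('a::chilbert_space \<Rightarrow> 'a) \<Rightarrow> nat \<Rightarrow> real" where
  "upper_scale A n = spectral_scale A (int (n + 1))"

lemma upper_scale_INF_SUP:
  "upper_scale A n = (INF S\<in>subspaces_of_dim n. SUP x\<in>unit_vectors_orth S. Re \<langle>A x, x\<rangle>)"
  by (simp add: upper_scale_def spectral_scale_def)

text \<open>Negation exchanges inf-sup with sup-inf, so the negative half of the scale is minus an
  upper scale, and it suffices to study \<open>upper_scale\<close>.\<close>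

lemma spectral_spread_upper_scale:
  "spectral_spread A n = upper_scale A n + upper_scale (\<lambda>x. - A x) n"
proof -
  have "spectral_scale A (- int (n + 1)) = - upper_scale (\<lambda>x. - A x) n"
    unfolding upper_scale_INF_SUP
    by (simp add: spectral_scale_def Inf_real_def image_image cinner.minus_left)
  then show ?thesis
    by (simp add: spectral_spread_def upper_scale_def)
qed

lemma unit_vectors_orth_cspan:
  "unit_vectors_orth (cspan B) = {x. norm x = 1 \<and> (\<forall>b\<in>B. \<langle>x, b\<rangle> = 0)}"
  unfolding unit_vectors_orth_def
  by (auto intro: cvec.span_base cinner_cspan_right)

lemma unit_vectors_orth_nonempty:
  fixes B :: "'a::chilbert_space set"
  assumes "infinite_dim TYPE('a)" "finite B"
  shows "unit_vectors_orth (cspan B) \<noteq> {}"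
proof -
  obtain x where "norm x = 1" "\<And>b. b \<in> B \<Longrightarrow> \<langle>x, b\<rangle> = 0"
    using infinite_dim_orthogonal[OF assms] by metis
  then show ?thesis
    by (auto simp: unit_vectors_orth_cspan)
qed

text \<open>The scale ranges over subspaces of dimension exactly \<open>n\<close>, while the
  constraint sets that arise below may be dependent or have fewer elements; infinite dimension
  supplies the missing vectors.\<close>

lemma independent_superset_of_card:
  fixes B :: "'a::chilbert_space set"
  assumes inf: "infinite_dim TYPE('a)" and B: "finite B" "card B \<le> n"
  shows "\<exists>B'. finite B' \<and> card B' = n \<and> \<not> cdependent B' \<and> B \<subseteq> cspan B'"
proof -
  obtain B0 where B0: "B0 \<subseteq> B" "\<not> cdependent B0" "B \<subseteq> cspan B0"
    using cvec.maximal_independent_subset[of B] by blast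
  have fin: "finite B0"
    using B0(1) B(1) by (rule finite_subset)
  have "card B0 \<le> n"
    using card_mono[OF B(1) B0(1)] B(2) by simp
  then show ?thesis
  proof (induction n rule: dec_induct)
    case base
    then show ?case
      using B0 fin by blast
  next
    case (step m)
    then obtain B' where B': "finite B'" "card B' = m" "\<not> cdependent B'" "B \<subseteq> cspan B'"
      by blast
    then obtain x where x: "x \<notin> cspan B'"
      using inf unfolding infinite_dim_def by blast
    then have "x \<notin> B'"
      using cvec.span_base by blast
    have "\<not> cdependent (insert x B')"
      using B'(3) x by (simp add: cvec.independent_insert)
    moreover have "card (insert x B') = Suc m"
      using B'(1,2) \<open>x \<notin> B'\<close> by simp
    moreover have "B \<subseteq> cspan (insert x B')"
      using B'(4) cvec.span_mono[of B' "insert x B'"] by blast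
    ultimately show ?case
      using B'(1) by blast
  qed
qed

context
  fixes A :: "'a::chilbert_space \<Rightarrow> 'a"
  assumes inf: "infinite_dim TYPE('a)" and A: "bounded_op A"
begin

lemma quadratic_form_bounded:
  obtains K where "\<And>x. norm x = 1 \<Longrightarrow> \<bar>Re \<langle>A x, x\<rangle>\<bar> \<le> K"
proof -
  obtain K where K: "\<And>x. norm (A x) \<le> norm x * K"
    using bounded_op_bound[OF A] by blast
  have "\<bar>Re \<langle>A x, x\<rangle>\<bar> \<le> K" if "norm x = 1" for x
    using abs_Re_le_cmod[of "\<langle>A x, x\<rangle>"] cmod_cinner_le[of "A x" x] K[of x] that by simp
  then show ?thesis
    by (rule that)
qed

lemma bdd_above_quadratic_form: "bdd_above ((\<lambda>x. Re \<langle>A x, x\<rangle>) ` unit_vectors_orth S)"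
proof -
  obtain K where "\<And>x. norm x = 1 \<Longrightarrow> \<bar>Re \<langle>A x, x\<rangle>\<bar> \<le> K"
    using quadratic_form_bounded by blast
  then show ?thesis
    by (intro bdd_aboveI2[where M = K]) (force simp: unit_vectors_orth_def)
qed

text \<open>A real infimum is only meaningful with a lower bound. Infinite dimension provides a unit
  vector orthogonal to \<open>S\<close>, where the form is at least \<open>- K\<close>.\<close>

lemma bdd_below_SUP_quadratic_form:
  "bdd_below ((\<lambda>S. SUP x\<in>unit_vectors_orth S. Re \<langle>A x, x\<rangle>) ` subspaces_of_dim n)"
proof -
  obtain K where K: "\<And>x. norm x = 1 \<Longrightarrow> \<bar>Re \<langle>A x, x\<rangle>\<bar> \<le> K"
    using quadratic_form_bounded by blast
  have "- K \<le> (SUP x\<in>unit_vectors_orth S. Re \<langle>A x, x\<rangle>)" if S: "S \<in> subspaces_of_dim n" for S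
  proof -
    obtain B where B: "finite B" "S = cspan B"
      using S by (auto simp: subspaces_of_dim_def)
    obtain x where x: "x \<in> unit_vectors_orth S"
      using unit_vectors_orth_nonempty[OF inf B(1)] unfolding B(2) by blast
    then have "- K \<le> Re \<langle>A x, x\<rangle>"
      using K[of x] by (simp add: unit_vectors_orth_def)
    also have "\<dots> \<le> (SUP x\<in>unit_vectors_orth S. Re \<langle>A x, x\<rangle>)"
      by (rule cSUP_upper[OF x bdd_above_quadratic_form])
    finally show ?thesis .
  qed
  then show ?thesis
    by (rule bdd_belowI2)
qed

text \<open>Together with \<open>upper_scale_less_imp\<close> this recasts the min-max definition in
  terms of finite sets of orthogonality constraints; the later estimates of the scale rest on these
  two forms.\<close>

lemma upper_scale_le:
  assumes "finite B" "card B \<le> n"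
    and "\<And>x. norm x = 1 \<Longrightarrow> (\<And>b. b \<in> B \<Longrightarrow> \<langle>x, b\<rangle> = 0) \<Longrightarrow> Re \<langle>A x, x\<rangle> \<le> c"
  shows "upper_scale A n \<le> c"
proof -
  obtain B' where B': "finite B'" "card B' = n" "\<not> cdependent B'" "B \<subseteq> cspan B'"
    using independent_superset_of_card[OF inf assms(1,2)] by blast
  have "(SUP x\<in>unit_vectors_orth (cspan B'). Re \<langle>A x, x\<rangle>) \<le> c"
  proof (rule cSUP_least)
    show "unit_vectors_orth (cspan B') \<noteq> {}"
      by (rule unit_vectors_orth_nonempty[OF inf B'(1)])
    show "Re \<langle>A x, x\<rangle> \<le> c" if "x \<in> unit_vectors_orth (cspan B')" for x
      using that B'(4) by (intro assms(3)) (auto simp: unit_vectors_orth_def)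
  qed
  moreover have "cspan B' \<in> subspaces_of_dim n"
    using B' by (auto simp: subspaces_of_dim_def)
  ultimately show ?thesis
    unfolding upper_scale_INF_SUP by (intro cINF_lower2[OF bdd_below_SUP_quadratic_form])
qed

lemma upper_scale_less_imp:
  assumes "upper_scale A n < c"
  shows "\<exists>B. finite B \<and> card B = n \<and>
    (\<forall>x. norm x = 1 \<longrightarrow> (\<forall>b\<in>B. \<langle>x, b\<rangle> = 0) \<longrightarrow> Re \<langle>A x, x\<rangle> < c)"
proof -
  have "subspaces_of_dim n \<noteq> ({} :: 'a set set)"
    using independent_superset_of_card[OF inf, of "{}" n] by (auto simp: subspaces_of_dim_def)
  then obtain S where "S \<in> subspaces_of_dim n" "(SUP x\<in>unit_vectors_orth S. Re \<langle>A x, x\<rangle>) < c"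
    using assms unfolding upper_scale_INF_SUP
    by (subst (asm) cINF_less_iff) (auto intro: bdd_below_SUP_quadratic_form)
  then obtain B where B: "finite B" "card B = n"
    "(SUP x\<in>unit_vectors_orth (cspan B). Re \<langle>A x, x\<rangle>) < c"
    by (auto simp: subspaces_of_dim_def)
  have "Re \<langle>A x, x\<rangle> < c" if "norm x = 1" "\<forall>b\<in>B. \<langle>x, b\<rangle> = 0" for x
  proof -
    have "x \<in> unit_vectors_orth (cspan B)"
      using that by (simp add: unit_vectors_orth_cspan)
    from cSUP_upper[OF this bdd_above_quadratic_form] B(3) show ?thesis
      by linarith
  qed
  with B(1,2) show ?thesis
    by blast
qed

lemma upper_scale_antimono: "m \<le> n \<Longrightarrow> upper_scale A n \<le> upper_scale A m"
proof (rule dense_ge)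
  fix c assume "m \<le> n" "upper_scale A m < c"
  then obtain B where B: "finite B" "card B = m"
    "\<And>x. norm x = 1 \<Longrightarrow> \<forall>b\<in>B. \<langle>x, b\<rangle> = 0 \<Longrightarrow> Re \<langle>A x, x\<rangle> < c"
    using upper_scale_less_imp by blast
  show "upper_scale A n \<le> c"
    by (rule upper_scale_le[of B]) (use B \<open>m \<le> n\<close> in \<open>auto intro: less_imp_le\<close>)
qed

text \<open>If no unit vector orthogonal to the first \<open>n\<close> choices exceeded
  \<open>upper_scale A n - d\<close>, these \<open>n\<close> constraints would push
  \<open>upper_scale A n\<close> below itself. The loss \<open>d\<close> accounts for suprema that
  are not attained.\<close>

lemma upper_scale_greedy:
  assumes "0 < d"
  shows "\<exists>u. orthonormal_upto n u \<and> (\<forall>i<n. upper_scale A i - d \<le> Re \<langle>A (u i), u i\<rangle>)"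
proof (induction n)
  case 0
  show ?case
    by (simp add: orthonormal_upto_def)
next
  case (Suc n)
  then obtain u where u: "orthonormal_upto n u" "\<forall>i<n. upper_scale A i - d \<le> Re \<langle>A (u i), u i\<rangle>"
    by blast
  have "card (u ` {..<n}) \<le> n"
    using card_image_le[of "{..<n}" u] by simp
  moreover have "\<not> upper_scale A n \<le> upper_scale A n - d"
    using assms by simp
  ultimately obtain x where x: "norm x = 1" "\<forall>b\<in>u ` {..<n}. \<langle>x, b\<rangle> = 0"
    "upper_scale A n - d < Re \<langle>A x, x\<rangle>"
    using upper_scale_le[of "u ` {..<n}" n "upper_scale A n - d"]
    by (meson finite_imageI finite_lessThan not_le)
  have "orthonormal_upto (Suc n) (u(n := x))"
    using u(1) x unfolding orthonormal_upto_Suc by (simp add: orthonormal_upto_update)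
  moreover have "\<forall>i<Suc n. upper_scale A i - d \<le> Re \<langle>A ((u(n := x)) i), (u(n := x)) i\<rangle>"
    using u(2) x(3) by (simp add: less_Suc_eq)
  ultimately show ?case
    by blast
qed

text \<open>The attainment half of Ky Fan's maximum principle, up to \<open>d\<close>.\<close>

lemma sum_upper_scale_approx:
  assumes "0 < d"
  obtains u where "orthonormal_upto n u"
    "(\<Sum>i<n. upper_scale A i) \<le> (\<Sum>i<n. Re \<langle>A (u i), u i\<rangle>) + d"
proof -
  \<comment> \<open>The denominator \<open>n + 1\<close> shares the error among \<open>n\<close>
    terms and avoids a division by zero for \<open>n = 0\<close>.\<close>
  obtain u where u: "orthonormal_upto n u"
    "\<And>i. i < n \<Longrightarrow> upper_scale A i - d / (real n + 1) \<le> Re \<langle>A (u i), u i\<rangle>"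
    using upper_scale_greedy[of "d / (real n + 1)" n] assms by auto
  have "(\<Sum>i<n. upper_scale A i) \<le> (\<Sum>i<n. Re \<langle>A (u i), u i\<rangle> + d / (real n + 1))"
    using u(2) by (intro sum_mono) (simp add: diff_le_eq)
  also have "\<dots> = (\<Sum>i<n. Re \<langle>A (u i), u i\<rangle>) + real n * (d / (real n + 1))"
    by (simp add: sum.distrib)
  also have "real n * (d / (real n + 1)) \<le> d"
    using assms by (simp add: field_simps)
  finally have "(\<Sum>i<n. upper_scale A i) \<le> (\<Sum>i<n. Re \<langle>A (u i), u i\<rangle>) + d"
    by simp
  then show ?thesis
    by (rule that[OF u(1)])
qed

text \<open>Ky Fan's inequality.  A dimension count gives a unit vector in the span of the \<open>u i\<close> on
  which the form is at most \<open>upper_scale A n\<close>; it is split off without changing the trace.\<close>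

lemma sum_quadratic_form_le:
  assumes "orthonormal_upto n u"
  shows "(\<Sum>i<n. Re \<langle>A (u i), u i\<rangle>) \<le> (\<Sum>i<n. upper_scale A i)"
  using assms
proof (induction n arbitrary: u)
  case (Suc n)
  show ?case
  proof (rule field_le_epsilon)
    fix d :: real assume "0 < d"
    then have "upper_scale A n < upper_scale A n + d"
      by simp
    then obtain B where B: "finite B" "card B = n"
      "\<And>x. norm x = 1 \<Longrightarrow> \<forall>b\<in>B. \<langle>x, b\<rangle> = 0 \<Longrightarrow> Re \<langle>A x, x\<rangle> < upper_scale A n + d"
      using upper_scale_less_imp by blast
    obtain w where w: "w \<in> cspan (u ` {..<Suc n})" "norm w = 1" "\<And>b. b \<in> B \<Longrightarrow> \<langle>w, b\<rangle> = 0"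
      using unit_vector_orthogonal[OF Suc.prems B(1)] B(2) by auto
    obtain v where v: "orthonormal_upto (Suc n) v" "v n = w"
      "cspan (v ` {..<Suc n}) = cspan (u ` {..<Suc n})"
      using orthonormal_upto_extend[OF Suc.prems w(1,2)] .
    have "(\<Sum>i<Suc n. \<langle>A (u i), u i\<rangle>) = (\<Sum>i<Suc n. \<langle>A (v i), v i\<rangle>)"
      using trace_invariance[OF Suc.prems v(1,3) A, of "\<lambda>x. x"] by (simp add: bounded_op_def)
    then have "(\<Sum>i<Suc n. Re \<langle>A (u i), u i\<rangle>) = (\<Sum>i<n. Re \<langle>A (v i), v i\<rangle>) + Re \<langle>A w, w\<rangle>"
      unfolding Re_sum[symmetric] by (simp add: v(2))
    also have "(\<Sum>i<n. Re \<langle>A (v i), v i\<rangle>) \<le> (\<Sum>i<n. upper_scale A i)"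
      using Suc.IH orthonormal_upto_mono[OF v(1)] by simp
    also have "Re \<langle>A w, w\<rangle> \<le> upper_scale A n + d"
      using B(3) w by (simp add: less_imp_le)
    finally show "(\<Sum>i<Suc n. Re \<langle>A (u i), u i\<rangle>) \<le> (\<Sum>i<Suc n. upper_scale A i) + d"
      by simp
  qed
qed simp

end

text \<open>Finitely many constraints bring the form of \<open>A\<close> below \<open>c\<close> and
  that of \<open>- A\<close> below \<open>d\<close>; in infinite dimension one unit vector satisfies
  all of them, and it shows \<open>- d < c\<close>.\<close>

lemma spectral_spread_nonneg:
  fixes A :: "'a::chilbert_space \<Rightarrow> 'a"
  assumes inf: "infinite_dim TYPE('a)" and A: "bounded_op A"
  shows "0 \<le> spectral_spread A n"
proof -
  have "- upper_scale A n \<le> upper_scale (\<lambda>x. - A x) n"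
  proof (rule dense_ge)
    fix d assume d: "upper_scale (\<lambda>x. - A x) n < d"
    have "- d \<le> upper_scale A n"
    proof (rule dense_ge)
      fix c assume c: "upper_scale A n < c"
      obtain B where B: "finite B"
        "\<And>x. norm x = 1 \<Longrightarrow> \<forall>b\<in>B. \<langle>x, b\<rangle> = 0 \<Longrightarrow> Re \<langle>A x, x\<rangle> < c"
        using upper_scale_less_imp[OF inf A c] by blast
      obtain B' where B': "finite B'"
        "\<And>x. norm x = 1 \<Longrightarrow> \<forall>b\<in>B'. \<langle>x, b\<rangle> = 0 \<Longrightarrow> Re \<langle>- A x, x\<rangle> < d"
        using upper_scale_less_imp[OF inf bounded_op_minus[OF A] d] by blast
      obtain x where "norm x = 1" "\<And>b. b \<in> B \<union> B' \<Longrightarrow> \<langle>x, b\<rangle> = 0"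
        using infinite_dim_orthogonal[OF inf, of "B \<union> B'"] B(1) B'(1) by (metis finite_UnI)
      with B(2)[of x] B'(2)[of x] show "- d \<le> c"
        by (simp add: cinner.minus_left)
    qed
    then show "- upper_scale A n \<le> d"
      by simp
  qed
  then show ?thesis
    by (simp add: spectral_spread_upper_scale)
qed

lemma spectral_spread_antimono:
  fixes A :: "'a::chilbert_space \<Rightarrow> 'a"
  assumes "infinite_dim TYPE('a)" "bounded_op A" "m \<le> n"
  shows "spectral_spread A n \<le> spectral_spread A m"
  unfolding spectral_spread_upper_scale
  using assms by (intro add_mono upper_scale_antimono bounded_op_minus)

section \<open>The spectral spread bounds off-diagonal blocks\<close>

lemma unimodular_multiplier: "\<exists>c. cmod c = 1 \<and> cnj c * z = complex_of_real (cmod z)"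
proof (cases "z = 0")
  case False
  have "cnj (sgn z) * z = complex_of_real (cmod z)"
    using False complex_norm_square[of z]
    by (simp add: sgn_eq field_simps power2_eq_square)
  then show ?thesis
    using False by (intro exI[of _ "sgn z"]) (simp add: norm_sgn)
qed (auto intro: exI[of _ 1])

text \<open>With phases \<open>c\<close> making \<open>\<langle>X p, c q\<rangle>\<close> non-negative, the form of \<open>X\<close> at
  \<open>(p + c q) / \<surd>2\<close> minus its value at \<open>(p - c q) / \<surd>2\<close> is \<open>2 |\<langle>X p, q\<rangle>|\<close>.\<close>

lemma sum_off_diagonal_le:
  fixes X :: "'a::chilbert_space \<Rightarrow> 'a"
  assumes inf: "infinite_dim TYPE('a)" and X: "selfadjoint_op X"
    and p: "orthonormal_upto m p" and q: "orthonormal_upto m q"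
    and pq: "\<And>i j. i < m \<Longrightarrow> j < m \<Longrightarrow> \<langle>p i, q j\<rangle> = 0"
  shows "(\<Sum>i<m. cmod \<langle>X (p i), q i\<rangle>) \<le> (\<Sum>i<m. spectral_spread X i) / 2"
proof -
  note bX = selfadjoint_bounded[OF X]
  note lin = bounded_op_simps[OF bX]
  have "\<forall>i. \<exists>c. cmod c = 1 \<and> cnj c * \<langle>X (p i), q i\<rangle> = complex_of_real (cmod \<langle>X (p i), q i\<rangle>)"
    using unimodular_multiplier by blast
  then obtain c where c: "\<And>i. cmod (c i) = 1"
    "\<And>i. cnj (c i) * \<langle>X (p i), q i\<rangle> = complex_of_real (cmod \<langle>X (p i), q i\<rangle>)"
    by metis
  define r where "r i = c i *\<^sub>C q i" for i
  have cc: "c i * cnj (c i) = 1" for i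
    using complex_norm_square[of "c i"] c(1)[of i] by simp
  have r: "\<langle>r i, r j\<rangle> = (if i = j then 1 else 0)" if "i < m" "j < m" for i j
    using cc[of j] orthonormal_uptoD[OF q that]
    by (auto simp: r_def cinner_scaleC_left cinner_scaleC_right mult.commute[of "cnj _"])
  have pr: "\<langle>p i, r j\<rangle> = 0" "\<langle>r j, p i\<rangle> = 0" if "i < m" "j < m" for i j
    using pq[OF that] cinner_commute[of "q j" "p i"]
    by (simp_all add: r_def cinner_scaleC_left cinner_scaleC_right)
  define f where "f i = (1 / sqrt 2) *\<^sub>R (p i + r i)" for i
  define g where "g i = (1 / sqrt 2) *\<^sub>R (p i - r i)" for i
  have half: "(1 / sqrt 2) *\<^sub>R (1 / sqrt 2) *\<^sub>R z = (1 / 2) *\<^sub>R z" for z :: complex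
    by simp
  have f: "orthonormal_upto m f"
    unfolding orthonormal_upto_def f_def cinner.scaleR_left cinner.scaleR_right half
    by (auto simp: cinner_add_left cinner_add_right r pr orthonormal_uptoD[OF p])
  have g: "orthonormal_upto m g"
    unfolding orthonormal_upto_def g_def cinner.scaleR_left cinner.scaleR_right half
    by (auto simp: cinner.diff_left cinner.diff_right r pr orthonormal_uptoD[OF p])
  have fg: "Re \<langle>X (f i), f i\<rangle> - Re \<langle>X (g i), g i\<rangle> = 2 * cmod \<langle>X (p i), q i\<rangle>" for i
  proof -
    have "\<langle>X (p i), r i\<rangle> = complex_of_real (cmod \<langle>X (p i), q i\<rangle>)"
      by (simp add: r_def cinner_scaleC_right c(2))
    moreover have "Re \<langle>X (r i), p i\<rangle> = Re \<langle>X (p i), r i\<rangle>"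
      using selfadjointD[OF X] Re_cinner_commute by metis
    ultimately show ?thesis
      unfolding f_def g_def lin cinner.scaleR_left cinner.scaleR_right half
      by (simp add: cinner_add_left cinner_add_right cinner.diff_left cinner.diff_right field_simps)
  qed
  have "2 * (\<Sum>i<m. cmod \<langle>X (p i), q i\<rangle>)
      = (\<Sum>i<m. Re \<langle>X (f i), f i\<rangle>) + (\<Sum>i<m. Re \<langle>- X (g i), g i\<rangle>)"
    by (simp add: sum_distrib_left fg[symmetric] sum_subtractf sum_negf cinner.minus_left)
  \<comment> \<open>Ky Fan's inequality is applied to \<open>X\<close> on the \<open>f i\<close> and
    to \<open>- X\<close> on the \<open>g i\<close>; the two upper scales add up to the
    spread.\<close>
  also have "\<dots> \<le> (\<Sum>i<m. upper_scale X i) + (\<Sum>i<m. upper_scale (\<lambda>x. - X x) i)"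
    by (intro add_mono sum_quadratic_form_le inf bX f g bounded_op_minus)
  finally show ?thesis
    by (simp add: spectral_spread_upper_scale sum.distrib)
qed

section \<open>Singular vectors on a finite-dimensional span\<close>

text \<open>Provides the compactness that a minimum on the unit sphere of the span requires.
  \<open>D\<close> arises as a Minkowski sum of \<open>n\<close> sets, each the continuous image of
  a closed disk of scalars.\<close>

lemma compact_superset_bounded_span:
  fixes u :: "nat \<Rightarrow> 'a::chilbert_space"
  shows "\<exists>D. compact D \<and> D \<subseteq> cspan (u ` {..<n}) \<and> (\<forall>c. (\<forall>i<n. cmod (c i) \<le> 1) \<longrightarrow> (\<Sum>i<n. c i *\<^sub>C u i) \<in> D)"
proof (induction n)
  case 0
  show ?case
    by (intro exI[of _ "{0}"]) (auto simp: cvec.span_zero)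
next
  case (Suc n)
  then obtain D where D: "compact D" "D \<subseteq> cspan (u ` {..<n})"
    "\<And>c. (\<forall>i<n. cmod (c i) \<le> 1) \<Longrightarrow> (\<Sum>i<n. c i *\<^sub>C u i) \<in> D"
    by blast
  define E where "E = (\<lambda>a. a *\<^sub>C u n) ` cball 0 1"
  have "compact E"
    unfolding E_def
    by (intro compact_continuous_image linear_continuous_on scaleC.bounded_linear_left compact_cball)
  then have "compact {x + y | x y. x \<in> D \<and> y \<in> E}"
    using D(1) by (intro compact_sums)
  moreover have "{x + y | x y. x \<in> D \<and> y \<in> E} \<subseteq> cspan (u ` {..<Suc n})"
  proof -
    have "D \<subseteq> cspan (u ` {..<Suc n})"
      using D(2) cvec.span_mono[of "u ` {..<n}" "u ` {..<Suc n}"] by (auto simp: lessThan_Suc)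
    moreover have "E \<subseteq> cspan (u ` {..<Suc n})"
      unfolding E_def by (auto intro!: cvec.span_scale intro: cvec.span_base)
    ultimately show ?thesis
      by (auto intro!: cvec.span_add)
  qed
  moreover have "(\<Sum>i<Suc n. c i *\<^sub>C u i) \<in> {x + y | x y. x \<in> D \<and> y \<in> E}"
    if c: "\<forall>i<Suc n. cmod (c i) \<le> 1" for c
  proof -
    have "(\<Sum>i<n. c i *\<^sub>C u i) \<in> D" "c n *\<^sub>C u n \<in> E"
      using c D(3)[of c] by (auto simp: E_def)
    then show ?thesis
      by auto
  qed
  ultimately show ?case
    by blast
qed

text \<open>The minimizer on the unit sphere is a right singular vector for the smallest singular
  value. A minimizer rather than a maximizer is taken because the induction appends the new vector
  at the end of a decreasing order.\<close>

lemma norm_minimizer_in_span: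
  assumes T: "bounded_op T" and u: "orthonormal_upto n u" and n: "0 < n"
  obtains w where "w \<in> cspan (u ` {..<n})" "norm w = 1"
    "\<And>x. x \<in> cspan (u ` {..<n}) \<Longrightarrow> norm (T w) * norm x \<le> norm (T x)"
proof -
  obtain D where D: "compact D" "D \<subseteq> cspan (u ` {..<n})"
    "\<And>c. (\<forall>i<n. cmod (c i) \<le> 1) \<Longrightarrow> (\<Sum>i<n. c i *\<^sub>C u i) \<in> D"
    using compact_superset_bounded_span[of u n] by blast
  have unit: "x \<in> D" if x: "x \<in> cspan (u ` {..<n})" "norm x = 1" for x
  proof -
    have "cmod \<langle>x, u i\<rangle> \<le> 1" if "i < n" for i
      using cmod_cinner_le[of x "u i"] orthonormal_upto_norm[OF u that] x(2) by simp
    then have "cproj n u x \<in> D"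
      unfolding cproj_def by (intro D(3)) simp
    then show ?thesis
      by (simp add: cproj_span[OF u x(1)])
  qed
  have "compact (D \<inter> sphere 0 1)"
    using D(1) unfolding sphere_def dist_0_norm
    by (intro compact_Int_closed closed_Collect_eq continuous_intros)
  moreover have "u 0 \<in> D \<inter> sphere 0 1"
    using n orthonormal_upto_norm[OF u n] by (auto intro!: unit cvec.span_base)
  moreover have "continuous_on (D \<inter> sphere 0 1) (\<lambda>x. norm (T x))"
    by (intro continuous_on_norm linear_continuous_on bounded_op_linear T)
  ultimately obtain w where w: "w \<in> D \<inter> sphere 0 1" "\<And>x. x \<in> D \<inter> sphere 0 1 \<Longrightarrow> norm (T w) \<le> norm (T x)"
    using continuous_attains_inf[of "D \<inter> sphere 0 1" "\<lambda>x. norm (T x)"] by blast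
  show ?thesis
  proof
    show "w \<in> cspan (u ` {..<n})" "norm w = 1"
      using w(1) D(2) by auto
    fix x assume x: "x \<in> cspan (u ` {..<n})"
    show "norm (T w) * norm x \<le> norm (T x)"
    proof (cases "x = 0")
      case False
      have "(1 / norm x) *\<^sub>R x \<in> cspan (u ` {..<n})"
        unfolding scaleC_of_real[symmetric] by (intro cvec.span_scale x)
      then have "(1 / norm x) *\<^sub>R x \<in> D \<inter> sphere 0 1"
        using False by (auto intro!: unit)
      from w(2)[OF this] show ?thesis
        using False by (simp add: bounded_op_simps[OF T] field_simps)
    qed (simp add: bounded_op_simps[OF T])
  qed
qed

text \<open>Moving from \<open>w\<close> to \<open>w + t z\<close> in an orthogonal direction, the
  difference of the squared sides of the minimality inequality vanishes at \<open>t = 0\<close> and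
  stays nonnegative, so its linear term is zero.\<close>

lemma norm_minimizer_orthogonal:
  assumes T: "bounded_op T" and W: "cvec.subspace W"
    and w: "w \<in> W" "norm w = 1" "\<And>x. x \<in> W \<Longrightarrow> norm (T w) * norm x \<le> norm (T x)"
    and y: "y \<in> W" "\<langle>w, y\<rangle> = 0"
  shows "\<langle>T w, T y\<rangle> = 0"
proof -
  define c where "c = \<langle>T w, T y\<rangle>"
  \<comment> \<open>Only a real part is controlled; the factor \<open>c\<close> turns
    \<open>\<langle>T w, T z\<rangle>\<close> into the squared modulus of \<open>c\<close>.\<close>
  define z where "z = c *\<^sub>C y"
  have z: "z \<in> W" "\<langle>w, z\<rangle> = 0"
    using y W by (auto simp: z_def cvec.subspace_scale cinner_scaleC_right)
  have "Re \<langle>T w, T z\<rangle> = 0"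
  proof (rule linear_term_eq_0)
    fix t :: real
    have "w + t *\<^sub>R z \<in> W"
      unfolding scaleC_of_real[symmetric] using W w(1) z(1)
      by (intro cvec.subspace_add cvec.subspace_scale)
    from w(3)[OF this] have "(norm (T w) * norm (w + t *\<^sub>R z))\<^sup>2 \<le> (norm (T (w + t *\<^sub>R z)))\<^sup>2"
      by (intro power_mono) auto
    then have "(norm (T w))\<^sup>2 * (1 + t\<^sup>2 * (norm z)\<^sup>2)
        \<le> (norm (T w))\<^sup>2 + 2 * t * Re \<langle>T w, T z\<rangle> + t\<^sup>2 * (norm (T z))\<^sup>2"
      using w(2) z(2)
      by (simp add: bounded_op_simps[OF T] norm_add_square power_mult_distrib cinner.scaleR_right
          mult.assoc)
    then show "0 \<le> 2 * t * Re \<langle>T w, T z\<rangle> + t\<^sup>2 * ((norm (T z))\<^sup>2 - (norm (T w))\<^sup>2 * (norm z)\<^sup>2)"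
      by (simp add: algebra_simps)
  qed
  moreover have "\<langle>T w, T z\<rangle> = cnj c * c"
    by (simp add: z_def bounded_op_simps[OF T] cinner_scaleC_right c_def)
  ultimately have "c = 0"
    by (simp add: complex_eq_iff)
  then show ?thesis
    by (simp add: c_def)
qed

text \<open>The minimizer over the whole span becomes the last vector, and its orthogonal complement
  in the span is treated by induction. The images \<open>T (v i)\<close> are not normalized, so
  vanishing singular values are no exception.\<close>

lemma singular_value_decomposition:
  assumes T: "bounded_op T" and u: "orthonormal_upto n u"
  shows "\<exists>v. orthonormal_upto n v \<and> cspan (v ` {..<n}) = cspan (u ` {..<n}) \<and>
    (\<forall>i<n. \<forall>j<n. i \<noteq> j \<longrightarrow> \<langle>T (v i), T (v j)\<rangle> = 0) \<and>
    (\<forall>j<n. \<forall>i\<le>j. norm (T (v j)) \<le> norm (T (v i)))"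
  using u
proof (induction n arbitrary: u)
    case (Suc n)
    let ?U = "cspan (u ` {..<Suc n})"
    obtain w where w: "w \<in> ?U" "norm w = 1" "\<And>x. x \<in> ?U \<Longrightarrow> norm (T w) * norm x \<le> norm (T x)"
      using norm_minimizer_in_span[OF T Suc.prems] by auto
    obtain a where a: "orthonormal_upto (Suc n) a" "a n = w" "cspan (a ` {..<Suc n}) = ?U"
      using orthonormal_upto_extend[OF Suc.prems w(1,2)] .
    obtain b where b: "orthonormal_upto n b" "cspan (b ` {..<n}) = cspan (a ` {..<n})"
      "\<And>i j. i < n \<Longrightarrow> j < n \<Longrightarrow> i \<noteq> j \<Longrightarrow> \<langle>T (b i), T (b j)\<rangle> = 0"
      "\<And>i j. i \<le> j \<Longrightarrow> j < n \<Longrightarrow> norm (T (b j)) \<le> norm (T (b i))"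
      using Suc.IH[OF orthonormal_upto_mono[OF a(1)]] by auto
    have bU: "b i \<in> ?U" if "i < n" for i
    proof -
      have "b i \<in> cspan (a ` {..<n})"
        unfolding b(2)[symmetric] using that by (intro cvec.span_base) auto
      also have "\<dots> \<subseteq> ?U"
        unfolding a(3)[symmetric] by (intro cvec.span_mono) auto
      finally show ?thesis .
    qed
    have wb: "\<langle>w, b i\<rangle> = 0" if "i < n" for i
    proof (rule cinner_cspan_right)
      show "b i \<in> cspan (a ` {..<n})"
        unfolding b(2)[symmetric] using that by (intro cvec.span_base) auto
      show "\<langle>w, y\<rangle> = 0" if "y \<in> a ` {..<n}" for y
        using that a(1,2) by (auto simp: orthonormal_upto_Suc)
    qed
    have Twb: "\<langle>T w, T (b i)\<rangle> = 0" if "i < n" for i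
      using that by (intro norm_minimizer_orthogonal[OF T cvec.subspace_span w] bU wb)
    have Tbw: "\<langle>T (b i), T w\<rangle> = 0" if "i < n" for i
      using Twb[OF that] cinner_commute[of "T (b i)" "T w"] by simp
    have nb: "norm (T w) \<le> norm (T (b i))" if "i < n" for i
      using w(3)[OF bU[OF that]] orthonormal_upto_norm[OF b(1) that] by simp
    have on: "orthonormal_upto (Suc n) (b(n := w))"
      using b(1) w(2) wb unfolding orthonormal_upto_Suc by (simp add: orthonormal_upto_update)
    have "cspan ((b(n := w)) ` {..<Suc n}) = ?U"
      by (rule cspan_orthonormal_eq[OF Suc.prems on]) (use bU w(1) in \<open>auto simp: less_Suc_eq\<close>)
    moreover have "\<forall>i<Suc n. \<forall>j<Suc n. i \<noteq> j \<longrightarrow> \<langle>T ((b(n := w)) i), T ((b(n := w)) j)\<rangle> = 0"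
      using b(3) Twb Tbw by (auto simp: less_Suc_eq)
    moreover have "\<forall>j<Suc n. \<forall>i\<le>j. norm (T ((b(n := w)) j)) \<le> norm (T ((b(n := w)) i))"
      using b(4) nb by (auto simp: less_Suc_eq)
    ultimately show ?case
      using on by blast
qed (simp add: orthonormal_upto_def)

text \<open>Summation by parts in inductive form.\<close>

lemma sum_mult_le_of_partial_sums_le:
  fixes a y z :: "nat \<Rightarrow> real"
  assumes a: "\<And>i. i < n \<Longrightarrow> 0 \<le> a i" "\<And>i. Suc i < n \<Longrightarrow> a (Suc i) \<le> a i"
    and le: "\<And>m. m \<le> n \<Longrightarrow> (\<Sum>i<m. y i) \<le> (\<Sum>i<m. z i)"
  shows "(\<Sum>i<n. a i * y i) \<le> (\<Sum>i<n. a i * z i)"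
proof (cases n)
  case (Suc k)
  define d where "d i = z i - y i" for i
  have D: "0 \<le> (\<Sum>i<m. d i)" if "m \<le> n" for m
    using le[OF that] by (simp add: d_def sum_subtractf)
  \<comment> \<open>The partial sums of \<open>d\<close> are nonnegative, so replacing all weights
    by the current smallest one, \<open>a m\<close>, can only lower the weighted sum.\<close>
  have "a m * (\<Sum>i<Suc m. d i) \<le> (\<Sum>i<Suc m. a i * d i)" if "m < n" for m
    using that
  proof (induction m)
    case (Suc m)
    have "a (Suc m) * (\<Sum>i<Suc (Suc m). d i) = a (Suc m) * (\<Sum>i<Suc m. d i) + a (Suc m) * d (Suc m)"
      by (simp add: distrib_left)
    also have "a (Suc m) * (\<Sum>i<Suc m. d i) \<le> a m * (\<Sum>i<Suc m. d i)"
      using Suc.prems by (intro mult_right_mono a D) auto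
    also have "\<dots> \<le> (\<Sum>i<Suc m. a i * d i)"
      using Suc by simp
    finally show ?case
      by simp
  qed simp
  from this[of k] have "0 \<le> (\<Sum>i<n. a i * d i)"
    using mult_nonneg_nonneg[OF a(1)[of k] D[of n]] Suc by simp
  then show ?thesis
    by (simp add: d_def right_diff_distrib sum_subtractf)
qed simp

section \<open>The trace bound\<close>

text \<open>Write the compression of \<open>A\<close> that maps the span of the \<open>u i\<close> into its orthogonal
  complement in singular vectors, \<open>T (v i) = s i w i\<close>.  The sum becomes
  \<open>\<Sum> s i \<langle>w i, X (J (v i))\<rangle>\<close>, and the partial sums of both factors are bounded by
  the off-diagonal estimate.\<close>

lemma off_diagonal_trace_bound:
  fixes A X J :: "'a::chilbert_space \<Rightarrow> 'a"
  assumes inf: "infinite_dim TYPE('a)" and A: "selfadjoint_op A" and X: "selfadjoint_op X"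
    and u: "orthonormal_upto n u"
    and J: "bounded_op J" "\<And>x y. \<langle>J x, J y\<rangle> = \<langle>x, y\<rangle>"
      "\<And>i. i < n \<Longrightarrow> J (u i) \<in> cspan (u ` {..<n})"
  shows "cmod (\<Sum>i<n. \<langle>A (u i) - cproj n u (A (u i)), X (J (u i)) - cproj n u (X (J (u i)))\<rangle>)
    \<le> (\<Sum>i<n. spectral_spread A i * spectral_spread X i) / 4"
proof -
  let ?U = "cspan (u ` {..<n})"
  define T where "T x = A x - cproj n u (A x)" for x
  note bA = selfadjoint_bounded[OF A] and bX = selfadjoint_bounded[OF X]
  have T: "bounded_op T"
    unfolding T_def by (intro bounded_op_diff bounded_op_compose[OF bounded_op_cproj] bA)
  have TU: "\<langle>T x, y\<rangle> = 0" "\<langle>y, T x\<rangle> = 0" if "y \<in> ?U" for x y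
    using cproj_orth[OF u that, of "A x"] cinner_commute[of y "T x"] by (simp_all add: T_def)
  have JU: "J x \<in> ?U" if "x \<in> ?U" for x
    using that
  proof (induction rule: cvec.span_induct_alt)
    case (step c x y)
    then show ?case
      using J(3) by (auto simp: bounded_op_simps[OF J(1)] intro!: cvec.span_add cvec.span_scale)
  qed (simp add: bounded_op_simps[OF J(1)] cvec.span_zero)
  obtain v where v: "orthonormal_upto n v" "cspan (v ` {..<n}) = ?U"
    "\<forall>i<n. \<forall>j<n. i \<noteq> j \<longrightarrow> \<langle>T (v i), T (v j)\<rangle> = 0"
    "\<forall>j<n. \<forall>i\<le>j. norm (T (v j)) \<le> norm (T (v i))"
    using singular_value_decomposition[OF T u] by (elim exE conjE)
  have vU: "v i \<in> ?U" if "i < n" for i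
    unfolding v(2)[symmetric] using that by (intro cvec.span_base) auto
  define s where "s i = norm (T (v i))" for i
  \<comment> \<open>Where \<open>s i = 0\<close> this is the zero vector and not a unit
    vector.\<close>
  define w where "w i = (1 / s i) *\<^sub>R T (v i)" for i
  have TT: "\<langle>T (v i), T (v i)\<rangle> = complex_of_real ((s i)\<^sup>2)" for i
    by (simp add: cinner_self s_def)
  have Tv: "T (v i) = s i *\<^sub>R w i" for i
    by (simp add: w_def s_def)
  \<comment> \<open>If \<open>s m = 0\<close>, the new term on the left is zero and the right side
    does not decrease. Otherwise the decreasing order makes \<open>s i\<close> nonzero for all
    \<open>i \<le> m\<close>, and the \<open>w i\<close> up to \<open>m\<close> form an orthonormal
    family orthogonal to the span.\<close>
  have partial: "(\<Sum>i<m. cmod \<langle>Y (p i), w i\<rangle>) \<le> (\<Sum>i<m. spectral_spread Y i) / 2"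
    if Y: "selfadjoint_op Y" and p: "orthonormal_upto n p" "\<And>i. i < n \<Longrightarrow> p i \<in> ?U" and m: "m \<le> n"
    for Y p m
    using m
  proof (induction m)
    case (Suc m)
    show ?case
    proof (cases "s m = 0")
      case True
      then show ?thesis
        using Suc spectral_spread_nonneg[OF inf selfadjoint_bounded[OF Y], of m]
        by (simp add: w_def cinner.zero_right)
    next
      case False
      have s: "s i \<noteq> 0" if "i < Suc m" for i
      proof -
        have "s m \<le> s i" "0 \<le> s m"
          using v(4) that Suc.prems by (simp_all add: s_def less_Suc_eq_le)
        then show ?thesis
          using False by linarith
      qed
      have "\<langle>w i, w j\<rangle> = (if i = j then 1 else 0)" if ij: "i < Suc m" "j < Suc m" for i j
      proof (cases "i = j")
        case True
        have "\<langle>w j, w j\<rangle> = (1 / s j) *\<^sub>R (1 / s j) *\<^sub>R complex_of_real ((s j)\<^sup>2)"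
          unfolding w_def cinner.scaleR_left cinner.scaleR_right TT ..
        also have "\<dots> = 1"
          using s[OF ij(2)] by (simp add: scaleR_conv_of_real power2_eq_square)
        finally show ?thesis
          using True by simp
      next
        case False
        then show ?thesis
          using v(3) ij Suc.prems by (simp add: w_def cinner.scaleR_left cinner.scaleR_right)
      qed
      then have "orthonormal_upto (Suc m) w"
        by (simp add: orthonormal_upto_def)
      moreover have "\<langle>p i, w j\<rangle> = 0" if "i < Suc m" for i j
        using that Suc.prems by (simp add: w_def cinner.scaleR_right TU p(2))
      ultimately show ?thesis
        using Suc.prems by (intro sum_off_diagonal_le inf Y orthonormal_upto_mono[OF p(1)])
    qed
  qed simp
  have "bounded_op (\<lambda>x. X (J x))"
    by (rule bounded_op_compose[OF bX J(1)])
  then have S: "bounded_op (\<lambda>x. X (J x) - cproj n u (X (J x)))"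
    by (intro bounded_op_diff bounded_op_compose[OF bounded_op_cproj])
  have Jv: "orthonormal_upto n (\<lambda>i. J (v i))"
    using v(1) by (simp add: orthonormal_upto_def J(2))
  \<comment> \<open>The singular values are themselves off-diagonal entries of \<open>A\<close>,
    which makes \<open>partial\<close> applicable to their sums.\<close>
  have s_A: "s i = cmod \<langle>A (v i), w i\<rangle>" for i
  proof -
    have "\<langle>cproj n u (A (v i)), w i\<rangle> = 0"
      by (simp add: w_def cinner.scaleR_right TU(2)[OF cproj_in_span])
    then have "\<langle>A (v i), w i\<rangle> = \<langle>T (v i), w i\<rangle>"
      by (simp add: T_def[of "v i"] cinner.diff_left)
    also have "\<dots> = (1 / s i) *\<^sub>R complex_of_real ((s i)\<^sup>2)"
      unfolding w_def cinner.scaleR_right TT ..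
    also have "\<dots> = complex_of_real (s i)"
      by (simp add: scaleR_conv_of_real power2_eq_square)
    finally show ?thesis
      by (simp add: s_def)
  qed
  have "(\<Sum>i<n. \<langle>A (u i) - cproj n u (A (u i)), X (J (u i)) - cproj n u (X (J (u i)))\<rangle>)
      = (\<Sum>i<n. \<langle>T (v i), X (J (v i)) - cproj n u (X (J (v i)))\<rangle>)"
    using trace_invariance[OF u v(1,2) T S] by (simp add: T_def)
  also have "\<dots> = (\<Sum>i<n. s i *\<^sub>R \<langle>w i, X (J (v i))\<rangle>)"
    unfolding cinner.diff_right TU(1)[OF cproj_in_span] by (simp add: Tv cinner.scaleR_left)
  also have "cmod \<dots> \<le> (\<Sum>i<n. s i * cmod \<langle>X (J (v i)), w i\<rangle>)"
  proof (rule order_trans[OF norm_sum], rule sum_mono)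
    fix i
    have "cmod \<langle>w i, X (J (v i))\<rangle> = cmod \<langle>X (J (v i)), w i\<rangle>"
      by (metis cinner_commute complex_mod_cnj)
    then show "norm (s i *\<^sub>R \<langle>w i, X (J (v i))\<rangle>) \<le> s i * cmod \<langle>X (J (v i)), w i\<rangle>"
      by (simp add: s_def)
  qed
  also have "\<dots> \<le> (\<Sum>i<n. s i * (spectral_spread X i / 2))"
    using partial[OF X Jv JU[OF vU]] v(4)
    by (intro sum_mult_le_of_partial_sums_le) (simp_all add: s_def flip: sum_divide_distrib)
  also have "\<dots> = (\<Sum>i<n. spectral_spread X i * (s i / 2))"
    by (simp add: mult.commute)
  \<comment> \<open>The roles are exchanged for the second summation by parts: the spreads of
    \<open>X\<close> are now the decreasing weights, and the partial sums are those of
    \<open>s i\<close>.\<close>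
  also have "\<dots> \<le> (\<Sum>i<n. spectral_spread X i * (spectral_spread A i / 4))"
    using partial[OF A v(1) vU] spectral_spread_nonneg[OF inf bX] spectral_spread_antimono[OF inf bX]
    by (intro sum_mult_le_of_partial_sums_le) (simp_all add: s_A[symmetric] mult.commute[of _ 2] flip: sum_divide_distrib)
  finally show ?thesis
    by (simp add: sum_divide_distrib mult.commute)
qed

text \<open>The operator \<open>J\<close> acts on the \<open>u i\<close> through the signs \<open>\<epsilon> i\<close>; the part of
  the trace inside the span of the \<open>u i\<close> is real because \<open>A\<close> does not mix the signs.\<close>

lemma signed_trace_bound:
  fixes A X J :: "'a::chilbert_space \<Rightarrow> 'a" and \<epsilon> :: "nat \<Rightarrow> real"
  assumes inf: "infinite_dim TYPE('a)" and A: "selfadjoint_op A" and X: "selfadjoint_op X"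
    and u: "orthonormal_upto n u"
    and J: "bounded_op J" "\<And>x y. \<langle>J x, J y\<rangle> = \<langle>x, y\<rangle>" "\<And>i. i < n \<Longrightarrow> J (u i) = \<epsilon> i *\<^sub>R u i"
    and orth: "\<And>i j. i < n \<Longrightarrow> j < n \<Longrightarrow> \<epsilon> i \<noteq> \<epsilon> j \<Longrightarrow> \<langle>A (u i), u j\<rangle> = 0"
  shows "(\<Sum>i<n. \<epsilon> i * Im \<langle>A (u i), X (u i)\<rangle>)
    \<le> (\<Sum>i<n. spectral_spread A i * spectral_spread X i) / 4"
proof -
  define a where "a i j = \<langle>A (u i), u j\<rangle>" for i j
  define x where "x i j = \<langle>u i, X (u j)\<rangle>" for i j
  have cnj: "cnj (a i j) = a j i" "cnj (x i j) = x j i" for i j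
    unfolding a_def x_def using selfadjointD[OF A] selfadjointD[OF X] cinner_commute by metis+
  define Z where "Z = (\<Sum>i<n. \<Sum>j<n. \<epsilon> i *\<^sub>R (a i j * x j i))"
  \<comment> \<open>Conjugation exchanges the indices and so moves the sign from \<open>i\<close> to
    \<open>j\<close>; wherever \<open>a i j \<noteq> 0\<close> the two signs agree.\<close>
  have "cnj Z = (\<Sum>i<n. \<Sum>j<n. \<epsilon> i *\<^sub>R (a j i * x i j))"
    by (simp add: Z_def cnj scaleR_conv_of_real)
  also have "\<dots> = (\<Sum>i<n. \<Sum>j<n. \<epsilon> j *\<^sub>R (a i j * x j i))"
    by (rule sum.swap)
  also have "\<dots> = Z"
    unfolding Z_def using orth by (intro sum.cong refl) (metis a_def lessThan_iff mult_zero_left scaleR_zero_right)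
  finally have Z: "Im Z = 0"
    by (simp add: complex_eq_iff)
  have "\<langle>A (u i) - cproj n u (A (u i)), X (J (u i)) - cproj n u (X (J (u i)))\<rangle>
      = \<epsilon> i *\<^sub>R \<langle>A (u i), X (u i)\<rangle> - (\<Sum>j<n. \<epsilon> i *\<^sub>R (a i j * x j i))" if "i < n" for i
  proof -
    have "\<langle>A (u i) - cproj n u (A (u i)), y - cproj n u y\<rangle> = \<langle>A (u i), y\<rangle> - \<langle>cproj n u (A (u i)), y\<rangle>" for y
      using cproj_orth[OF u cproj_in_span] by (simp add: cinner.diff_right cinner.diff_left)
    moreover have "X (J (u i)) = \<epsilon> i *\<^sub>R X (u i)"
      using J(3)[OF that] by (simp add: bounded_op_simps[OF selfadjoint_bounded[OF X]])
    moreover have "\<langle>cproj n u (A (u i)), X (u i)\<rangle> = (\<Sum>j<n. a i j * x j i)"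
      by (simp add: cproj_def cinner.sum_left cinner_scaleC_left a_def x_def)
    ultimately show ?thesis
      by (simp add: cinner.scaleR_right scaleR_sum_right)
  qed
  then have eq: "(\<Sum>i<n. \<langle>A (u i) - cproj n u (A (u i)), X (J (u i)) - cproj n u (X (J (u i)))\<rangle>)
      = (\<Sum>i<n. \<epsilon> i *\<^sub>R \<langle>A (u i), X (u i)\<rangle>) - Z"
    by (simp add: Z_def sum_subtractf)
  have "J (u i) \<in> cspan (u ` {..<n})" if "i < n" for i
    unfolding J(3)[OF that] scaleC_of_real[symmetric]
    using that by (intro cvec.span_scale cvec.span_base) auto
  from off_diagonal_trace_bound[OF inf A X u J(1,2) this]
  have "cmod ((\<Sum>i<n. \<epsilon> i *\<^sub>R \<langle>A (u i), X (u i)\<rangle>) - Z)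
      \<le> (\<Sum>i<n. spectral_spread A i * spectral_spread X i) / 4"
    unfolding eq by simp
  moreover have "(\<Sum>i<n. \<epsilon> i * Im \<langle>A (u i), X (u i)\<rangle>) = Im ((\<Sum>i<n. \<epsilon> i *\<^sub>R \<langle>A (u i), X (u i)\<rangle>) - Z)"
    using Z by simp
  ultimately show ?thesis
    using abs_Im_le_cmod[of "(\<Sum>i<n. \<epsilon> i *\<^sub>R \<langle>A (u i), X (u i)\<rangle>) - Z"] by linarith
qed

section \<open>The commutator and the orthogonal sum\<close>

lemma infinite_dim_prod:
  assumes "infinite_dim TYPE('a::chilbert_space)"
  shows "infinite_dim TYPE('a \<times> 'a)"
proof (rule infinite_dimI)
  fix n
  obtain u :: "nat \<Rightarrow> 'a" where "orthonormal_upto n u"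
    using orthonormal_upto_exists[OF assms] by blast
  then have "orthonormal_upto n (\<lambda>i. (u i, 0 :: 'a))"
    by (simp add: orthonormal_upto_def cinner_prod_def cinner.zero_left)
  then show "\<exists>u :: nat \<Rightarrow> 'a \<times> 'a. orthonormal_upto n u"
    by blast
qed

lemma bounded_op_map_prod:
  assumes "bounded_op A" "bounded_op B"
  shows "bounded_op (map_prod A B)"
proof -
  have "bounded_linear (\<lambda>x. (A (fst x), B (snd x)))"
    using assms
    by (intro bounded_linear_Pair bounded_linear_compose[OF bounded_op_linear bounded_linear_fst]
        bounded_linear_compose[OF bounded_op_linear bounded_linear_snd])
  then show ?thesis
    using assms by (simp add: bounded_op_def map_prod_def case_prod_unfold scaleC_prod_def)
qed

lemma selfadjoint_op_map_prod:
  assumes "selfadjoint_op A" "selfadjoint_op B"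
  shows "selfadjoint_op (map_prod A B)"
  using assms by (simp add: selfadjoint_op_def bounded_op_map_prod cinner_prod_def)

lemma sum_lessThan_add: "(\<Sum>i<p + q. f i) = (\<Sum>i<p. f i) + (\<Sum>i<q. f (p + i :: nat) :: real)"
  by (induction q) auto

lemma bounded_op_commutator: "bounded_op A \<Longrightarrow> bounded_op X \<Longrightarrow> bounded_op (\<lambda>x. A (X x) - X (A x))"
  by (rule bounded_op_diff[OF bounded_op_compose bounded_op_compose])

lemma selfadjoint_op_commutator:
  assumes A: "selfadjoint_op A" and X: "selfadjoint_op X"
  shows "selfadjoint_op (\<lambda>x. \<i> *\<^sub>C (A (X x) - X (A x)))"
  unfolding selfadjoint_op_def
proof (intro conjI allI)
  show "bounded_op (\<lambda>x. \<i> *\<^sub>C (A (X x) - X (A x)))"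
    using assms by (intro bounded_op_scaleC bounded_op_commutator selfadjoint_bounded)
  show "\<langle>\<i> *\<^sub>C (A (X x) - X (A x)), y\<rangle> = \<langle>x, \<i> *\<^sub>C (A (X y) - X (A y))\<rangle>" for x y
    by (simp add: cinner_scaleC_left cinner_scaleC_right cinner.diff_left cinner.diff_right
        selfadjointD[OF A] selfadjointD[OF X] algebra_simps)
qed

lemma commutator_quadratic_form:
  assumes A: "selfadjoint_op A" and X: "selfadjoint_op X"
  shows "Re \<langle>\<i> *\<^sub>C (A (X x) - X (A x)), x\<rangle> = 2 * Im \<langle>A x, X x\<rangle>"
proof -
  have "\<langle>\<i> *\<^sub>C (A (X x) - X (A x)), x\<rangle> = \<i> * (cnj \<langle>A x, X x\<rangle> - \<langle>A x, X x\<rangle>)"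
    unfolding cinner_scaleC_left cinner.diff_left selfadjointD[OF A, of "X x"] selfadjointD[OF X, of "A x"]
    using cinner_commute[of "X x" "A x"] by simp
  then show ?thesis
    by simp
qed

text \<open>\<open>p\<close> and \<open>q\<close> are free because it is settled only by the merging
  how many of the first singular values are charged to \<open>K\<close> and how many to
  \<open>- K\<close>.\<close>

lemma sum_commutator_scale_le:
  fixes A X :: "'a::chilbert_space \<Rightarrow> 'a"
  assumes inf: "infinite_dim TYPE('a)" and A: "selfadjoint_op A" and X: "selfadjoint_op X"
  defines "K \<equiv> \<lambda>x. \<i> *\<^sub>C (A (X x) - X (A x))"
  shows "(\<Sum>i<p. upper_scale K i) + (\<Sum>i<q. upper_scale (\<lambda>x. - K x) i)
    \<le> (\<Sum>i<p + q. spectral_spread (map_prod A A) i * spectral_spread (map_prod X X) i) / 2"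
proof (rule field_le_epsilon)
  fix d :: real assume "0 < d"
  then have d: "0 < d / 2"
    by simp
  have K: "bounded_op K"
    unfolding K_def using selfadjoint_op_commutator[OF A X] by (rule selfadjoint_bounded)
  have K_form: "Re \<langle>K x, x\<rangle> = 2 * Im \<langle>A x, X x\<rangle>" for x
    unfolding K_def by (rule commutator_quadratic_form[OF A X])
  obtain a where a: "orthonormal_upto p a"
    "(\<Sum>i<p. upper_scale K i) \<le> (\<Sum>i<p. Re \<langle>K (a i), a i\<rangle>) + d / 2"
    using sum_upper_scale_approx[OF inf K d] .
  obtain b where b: "orthonormal_upto q b"
    "(\<Sum>i<q. upper_scale (\<lambda>x. - K x) i) \<le> (\<Sum>i<q. Re \<langle>- K (b i), b i\<rangle>) + d / 2"
    using sum_upper_scale_approx[OF inf bounded_op_minus[OF K] d] .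
  define u where "u i = (if i < p then (a i, 0) else (0, b (i - p)))" for i
  define \<epsilon> where "\<epsilon> i = (if i < p then 1 else - 1 :: real)" for i
  \<comment> \<open>\<open>J\<close> changes the sign on the second summand, which carries the
    family for \<open>- K\<close>.\<close>
  define J where "J = map_prod (\<lambda>x :: 'a. x) (\<lambda>x :: 'a. - x)"
  have zero: "A 0 = 0" "X 0 = 0"
    using A X by (simp_all add: bounded_op_simps(4) selfadjoint_bounded)
  have "orthonormal_upto (p + q) u"
    using a(1) b(1)
    by (auto simp: orthonormal_upto_def u_def cinner_prod_def cinner.zero_left cinner.zero_right)
  moreover have "bounded_op J"
    unfolding J_def by (intro bounded_op_map_prod bounded_op_minus) (simp_all add: bounded_op_def)
  moreover have "\<langle>J x, J y\<rangle> = \<langle>x, y\<rangle>" for x y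
    by (simp add: J_def cinner_prod_def cinner.minus_left cinner.minus_right)
  moreover have "J (u i) = \<epsilon> i *\<^sub>R u i" for i
    by (simp add: J_def u_def \<epsilon>_def)
  moreover have "\<langle>map_prod A A (u i), u j\<rangle> = 0" if "\<epsilon> i \<noteq> \<epsilon> j" for i j
    using that
    by (auto simp: \<epsilon>_def u_def cinner_prod_def zero cinner.zero_left cinner.zero_right split: if_splits)
  ultimately have "(\<Sum>i<p + q. \<epsilon> i * Im \<langle>map_prod A A (u i), map_prod X X (u i)\<rangle>)
      \<le> (\<Sum>i<p + q. spectral_spread (map_prod A A) i * spectral_spread (map_prod X X) i) / 4"
    by (intro signed_trace_bound[where J = J] infinite_dim_prod inf selfadjoint_op_map_prod A X)
  moreover have "(\<Sum>i<p + q. \<epsilon> i * Im \<langle>map_prod A A (u i), map_prod X X (u i)\<rangle>)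
      = (\<Sum>i<p. Im \<langle>A (a i), X (a i)\<rangle>) - (\<Sum>i<q. Im \<langle>A (b i), X (b i)\<rangle>)"
    unfolding sum_lessThan_add
    by (simp add: \<epsilon>_def u_def cinner_prod_def zero cinner.zero_left sum_negf)
  moreover have "(\<Sum>i<p. Re \<langle>K (a i), a i\<rangle>) = 2 * (\<Sum>i<p. Im \<langle>A (a i), X (a i)\<rangle>)"
    "(\<Sum>i<q. Re \<langle>- K (b i), b i\<rangle>) = - 2 * (\<Sum>i<q. Im \<langle>A (b i), X (b i)\<rangle>)"
    by (simp_all add: K_form cinner.minus_left sum_distrib_left sum_negf)
  ultimately show "(\<Sum>i<p. upper_scale K i) + (\<Sum>i<q. upper_scale (\<lambda>x. - K x) i)
    \<le> (\<Sum>i<p + q. spectral_spread (map_prod A A) i * spectral_spread (map_prod X X) i) / 2 + d"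
    using a(2) b(2) by linarith
qed

section \<open>Absolute values\<close>

text \<open>The square root is \<open>1 - Z\<close>, where \<open>Z\<close> solves \<open>Z = (B + Z\<^sup>2) / 2\<close> with \<open>B = 1 - K\<^sup>2\<close>.
  The iteration for \<open>Z\<close> is dominated by the same iteration with the number \<open>1\<close> in place of
  \<open>B\<close>.\<close>

lemma positive_sqrt_contraction:
  fixes K :: "'a::chilbert_space \<Rightarrow> 'a"
  assumes K: "selfadjoint_op K" and le: "\<And>x. norm (K x) \<le> norm x"
  shows "\<exists>P. positive_op P \<and> (\<forall>x. P (P x) = K (K x)) \<and>
    (\<forall>R. bounded_linear R \<longrightarrow> (\<forall>x. R (K (K x)) = K (K (R x))) \<longrightarrow> (\<forall>x. R (P x) = P (R x)))"
proof -
  note bK = selfadjoint_bounded[OF K]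
  note linK = bounded_op_simps[OF bK]
  have KK: "bounded_linear (\<lambda>x. x - K (K x))"
    using bounded_op_linear[OF bK]
    by (intro bounded_linear_sub[OF bounded_linear_ident bounded_linear_compose])
  define B where "B = Blinfun (\<lambda>x. x - K (K x))"
  have B: "blinfun_apply B x = x - K (K x)" for x
    by (simp add: B_def bounded_linear_Blinfun_apply[OF KK])
  have normB: "norm B \<le> 1"
  proof (rule norm_blinfun_bound)
    fix x
    have "(norm (x - K (K x)))\<^sup>2 = (norm x)\<^sup>2 - 2 * (norm (K x))\<^sup>2 + (norm (K (K x)))\<^sup>2"
    proof -
      have "Re \<langle>x, K (K x)\<rangle> = (norm (K x))\<^sup>2"
        by (metis selfadjointD[OF K] Re_cinner_self)
      then show ?thesis
        using norm_add_square[of x "- K (K x)"] by (simp add: cinner.minus_right)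
    qed
    also have "\<dots> \<le> (norm x)\<^sup>2"
    proof -
      have "(norm (K (K x)))\<^sup>2 \<le> (norm (K x))\<^sup>2"
        by (intro power_mono le) simp
      then show ?thesis
        using zero_le_power2[of "norm (K x)"] by linarith
    qed
    finally show "norm (blinfun_apply B x) \<le> 1 * norm x"
      by (simp add: B abs_le_square_iff[symmetric])
  qed simp
  define Y where "Y = rec_nat 0 (\<lambda>_ Z. (1 / 2) *\<^sub>R (B + (Z o\<^sub>L Z)))"
  \<comment> \<open>Starting at 0, the scalar iterates increase and stay at most 1, hence converge.
    The increments of \<open>Y\<close> are bounded in norm by those of \<open>y\<close>, which makes
    \<open>Y\<close> Cauchy.\<close>
  define y where "y = rec_nat 0 (\<lambda>_ z. (1 + z\<^sup>2) / 2 :: real)"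
  have Y: "Y 0 = 0" "\<And>n. Y (Suc n) = (1 / 2) *\<^sub>R (B + (Y n o\<^sub>L Y n))"
    and y: "y 0 = 0" "\<And>n. y (Suc n) = (1 + (y n)\<^sup>2) / 2"
    by (simp_all add: Y_def y_def)
  have y01: "0 \<le> y n \<and> y n \<le> 1" for n
    by (induction n) (auto simp: y intro: power_le_one)
  have y_mono: "y n \<le> y (Suc n)" for n
    using zero_le_power2[of "y n - 1"] by (simp add: y power2_diff)
  \<comment> \<open>Whatever commutes with \<open>B\<close> commutes with every iterate. This yields
    that the iterates commute with each other and, in the limit, the complex linearity of
    \<open>P\<close> and the commutation clause.\<close>
  have comm: "R (blinfun_apply (Y n) x) = blinfun_apply (Y n) (R x)"
    if R: "linear R" "\<And>x. R (blinfun_apply B x) = blinfun_apply B (R x)" for R n x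
    by (induction n arbitrary: x)
      (simp_all add: Y blinfun.bilinear_simps linear_0[OF R(1)] linear_add[OF R(1)] linear_scale[OF R(1)] R(2))
  have lin: "linear (blinfun_apply F)" for F :: "'a \<Rightarrow>\<^sub>L 'a"
    by (rule bounded_linear.linear[OF blinfun.bounded_linear_right])
  have YB: "blinfun_apply (Y m) (blinfun_apply B x) = blinfun_apply B (blinfun_apply (Y m) x)" for m x
    by (rule comm[symmetric]) (simp_all add: lin)
  have YY: "blinfun_apply (Y m) (blinfun_apply (Y n) x) = blinfun_apply (Y n) (blinfun_apply (Y m) x)" for m n x
    by (rule comm) (simp_all add: lin YB)
  have normY: "norm (Y n) \<le> y n" for n
  proof (induction n)
    case (Suc n)
    have "norm (Y n o\<^sub>L Y n) \<le> (y n)\<^sup>2"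
      using norm_blinfun_compose[of "Y n" "Y n"] mult_mono[OF Suc Suc] y01[of n]
      by (simp add: power2_eq_square)
    then show ?case
      using norm_triangle_ineq[of B "Y n o\<^sub>L Y n"] normB by (simp add: Y y)
  qed (simp add: Y y)
  have step: "norm (Y (Suc n) - Y n) \<le> y (Suc n) - y n" for n
  proof (induction n)
    case 0
    then show ?case
      using normB by (simp add: Y y)
  next
    case (Suc n)
    \<comment> \<open>The difference of squares factors because \<open>Y n\<close> and
      \<open>Y (Suc n)\<close> commute.\<close>
    have "Y (Suc (Suc n)) - Y (Suc n) = (1 / 2) *\<^sub>R ((Y (Suc n) - Y n) o\<^sub>L (Y (Suc n) + Y n))"
      unfolding Y(2)[of "Suc n"] Y(2)[of n]
      by (rule blinfun_eqI)
        (simp add: blinfun.bilinear_simps YY[of n "Suc n"] flip: Y(2), simp add: Y blinfun.bilinear_simps algebra_simps)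
    then have "norm (Y (Suc (Suc n)) - Y (Suc n))
        \<le> (1 / 2) * (norm (Y (Suc n) - Y n) * norm (Y (Suc n) + Y n))"
      by (simp add: norm_blinfun_compose)
    also have "norm (Y (Suc n) - Y n) * norm (Y (Suc n) + Y n) \<le> (y (Suc n) - y n) * (y (Suc n) + y n)"
      using Suc normY[of n] normY[of "Suc n"] norm_triangle_ineq[of "Y (Suc n)" "Y n"] y_mono[of n]
      by (intro mult_mono) auto
    also have "(1 / 2) * ((y (Suc n) - y n) * (y (Suc n) + y n)) = y (Suc (Suc n)) - y (Suc n)"
      unfolding y(2)[of "Suc n"] unfolding y(2)[of n] by (simp add: algebra_simps power2_eq_square)
    finally show ?case
      by simp
  qed
  have diff: "norm (Y (n + k) - Y n) \<le> y (n + k) - y n" for n k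
  proof (induction k)
    case (Suc k)
    then show ?case
      using norm_triangle_ineq[of "Y (Suc (n + k)) - Y (n + k)" "Y (n + k) - Y n"] step[of "n + k"]
      by simp
  qed simp
  have "incseq y"
    by (rule incseq_SucI) (rule y_mono)
  then obtain l where l: "y \<longlonglongrightarrow> l" "\<And>n. y n \<le> l"
    using y01 incseq_convergent[of y 1] by metis
  have "Cauchy Y"
  proof (rule CauchyI)
    fix e :: real assume "0 < e"
    then obtain M where M: "\<And>n. n \<ge> M \<Longrightarrow> dist (y n) l < e / 2"
      using metric_LIMSEQ_D[OF l(1), of "e / 2"] by auto
    have "norm (Y m - Y M) < e / 2" if "m \<ge> M" for m
    proof -
      have "norm (Y m - Y M) \<le> y m - y M"
        using diff[of M "m - M"] that by simp
      also have "\<dots> \<le> l - y M"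
        using l(2)[of m] by simp
      also have "\<dots> < e / 2"
        using M[of M] l(2)[of M] by (simp add: dist_real_def)
      finally show ?thesis .
    qed
    then have "norm (Y m - Y n) < e" if "m \<ge> M" "n \<ge> M" for m n
      using norm_triangle_ineq4[of "Y m - Y M" "Y n - Y M"] that by (smt (verit) diff_diff_eq2 diff_add_cancel field_sum_of_halves)
    then show "\<exists>M. \<forall>m\<ge>M. \<forall>n\<ge>M. norm (Y m - Y n) < e"
      by blast
  qed
  then obtain Z where Z: "Y \<longlonglongrightarrow> Z"
    using Cauchy_convergent convergent_def by blast
  have Zx: "(\<lambda>n. blinfun_apply (Y n) x) \<longlonglongrightarrow> blinfun_apply Z x" for x
    by (intro blinfun.tendsto Z tendsto_const)
  have Z_eq: "Z = (1 / 2) *\<^sub>R (B + (Z o\<^sub>L Z))"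
  proof (rule LIMSEQ_unique)
    show "(\<lambda>n. Y (Suc n)) \<longlonglongrightarrow> Z"
      using Z by (rule LIMSEQ_Suc)
    show "(\<lambda>n. Y (Suc n)) \<longlonglongrightarrow> (1 / 2) *\<^sub>R (B + (Z o\<^sub>L Z))"
      unfolding Y(2) by (intro tendsto_intros Z bounded_bilinear.tendsto[OF bounded_bilinear_blinfun_compose])
  qed
  have normZ: "norm Z \<le> 1"
    by (rule LIMSEQ_le_const2[OF tendsto_norm[OF Z]]) (meson normY y01 order_trans)
  have Z_comm: "R (blinfun_apply Z x) = blinfun_apply Z (R x)"
    if R: "bounded_linear R" "\<And>x. R (blinfun_apply B x) = blinfun_apply B (R x)" for R x
  proof (rule LIMSEQ_unique)
    show "(\<lambda>n. R (blinfun_apply (Y n) x)) \<longlonglongrightarrow> R (blinfun_apply Z x)"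
      by (rule bounded_linear.tendsto[OF R(1) Zx])
    show "(\<lambda>n. R (blinfun_apply (Y n) x)) \<longlonglongrightarrow> blinfun_apply Z (R x)"
      using comm[OF bounded_linear.linear[OF R(1)] R(2)] Zx by simp
  qed
  have Y_sym: "\<langle>blinfun_apply (Y n) x, z\<rangle> = \<langle>x, blinfun_apply (Y n) z\<rangle>" for n x z
    by (induction n arbitrary: x z)
      (simp_all add: Y blinfun.bilinear_simps B cinner.zero_left cinner.zero_right cinner.scaleR_left
        cinner.scaleR_right cinner_add_left cinner_add_right cinner.diff_left cinner.diff_right selfadjointD[OF K])
  have Z_sym: "\<langle>blinfun_apply Z x, z\<rangle> = \<langle>x, blinfun_apply Z z\<rangle>" for x z
  proof (rule LIMSEQ_unique)
    show "(\<lambda>n. \<langle>blinfun_apply (Y n) x, z\<rangle>) \<longlonglongrightarrow> \<langle>blinfun_apply Z x, z\<rangle>"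
      by (intro cinner.tendsto Zx tendsto_const)
    show "(\<lambda>n. \<langle>blinfun_apply (Y n) x, z\<rangle>) \<longlonglongrightarrow> \<langle>x, blinfun_apply Z z\<rangle>"
      unfolding Y_sym by (intro cinner.tendsto Zx tendsto_const)
  qed
  define P where "P x = x - blinfun_apply Z x" for x
  \<comment> \<open>With this relation \<open>1 - 2 Z + Z\<^sup>2\<close>, the square of
    \<open>P\<close>, becomes \<open>1 - B = K\<^sup>2\<close>.\<close>
  have ZZ: "blinfun_apply Z (blinfun_apply Z x) = 2 *\<^sub>R blinfun_apply Z x - blinfun_apply B x" for x
    by (subst (3) Z_eq) (simp add: blinfun.bilinear_simps)
  have "positive_op P"
    unfolding positive_op_def selfadjoint_op_def bounded_op_def
  proof (intro conjI allI)
    show "bounded_linear P"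
      unfolding P_def by (intro bounded_linear_sub bounded_linear_ident blinfun.bounded_linear_right)
    \<comment> \<open>The iteration takes place among bounded real linear maps, so complex linearity
      has to be recovered: multiplication by \<open>c\<close> commutes with \<open>B\<close>, hence
      with \<open>Z\<close>.\<close>
    show "P (c *\<^sub>C x) = c *\<^sub>C P x" for c x
      using Z_comm[OF scaleC.bounded_linear_right, of c x]
      by (simp add: P_def scaleC.diff_right B linK)
    show "\<langle>P x, z\<rangle> = \<langle>x, P z\<rangle>" for x z
      by (simp add: P_def cinner.diff_left cinner.diff_right Z_sym)
    show "0 \<le> Re \<langle>P x, x\<rangle>" for x
    proof -
      have "Re \<langle>blinfun_apply Z x, x\<rangle> \<le> norm (blinfun_apply Z x) * norm x"
        using complex_Re_le_cmod cmod_cinner_le order_trans by blast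
      also have "norm (blinfun_apply Z x) \<le> 1 * norm x"
        using norm_blinfun[of Z x] mult_right_mono[OF normZ norm_ge_zero[of x]] by linarith
      finally show ?thesis
        by (simp add: P_def cinner.diff_left Re_cinner_self power2_eq_square mult_right_mono)
    qed
  qed
  moreover have "P (P x) = K (K x)" for x
    by (simp add: P_def blinfun.diff_right ZZ B scaleR_2)
  moreover have "R (P x) = P (R x)" if "bounded_linear R" "\<forall>x. R (K (K x)) = K (K (R x))" for R x
    using Z_comm[of R x] that by (simp add: P_def B linear_diff bounded_linear.linear)
  ultimately show ?thesis
    by blast
qed

text \<open>\<open>K\<close> is divided by a bound \<open>k\<close> of its norm, and the root is
  multiplied by \<open>k\<close>. The commutation clause serves twice: for the uniqueness of the
  root and for its commutation with \<open>K\<close>.\<close>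

lemma positive_sqrt:
  fixes K :: "'a::chilbert_space \<Rightarrow> 'a"
  assumes K: "selfadjoint_op K"
  shows "\<exists>P. positive_op P \<and> (\<forall>x. P (P x) = K (K x)) \<and>
    (\<forall>R. bounded_linear R \<longrightarrow> (\<forall>x. R (K (K x)) = K (K (R x))) \<longrightarrow> (\<forall>x. R (P x) = P (R x)))"
proof -
  note bK = selfadjoint_bounded[OF K]
  note linK = bounded_op_simps[OF bK]
  obtain k where k: "0 < k" "\<And>x. norm (K x) \<le> norm x * k"
    using bounded_op_bound[OF bK] by blast
  define L where "L x = complex_of_real (1 / k) *\<^sub>C K x" for x
  have L: "selfadjoint_op L"
    unfolding selfadjoint_op_def L_def
    using selfadjointD[OF K] by (simp add: bounded_op_scaleC bK cinner_scaleC_left cinner_scaleC_right)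
  have LL: "L (L x) = (1 / k\<^sup>2) *\<^sub>R K (K x)" for x
    by (simp add: L_def linK scaleC_of_real power2_eq_square del: of_real_divide)
  have "norm (L x) \<le> norm x" for x
    using k(2)[of x] k(1) by (simp add: L_def norm_scaleC norm_divide field_simps)
  from positive_sqrt_contraction[OF L this] obtain P where P: "positive_op P"
    "\<And>x. P (P x) = L (L x)"
    "\<And>R x. bounded_linear R \<Longrightarrow> \<forall>x. R (L (L x)) = L (L (R x)) \<Longrightarrow> R (P x) = P (R x)"
    by blast
  define Q where "Q x = complex_of_real k *\<^sub>C P x" for x
  have bP: "bounded_op P" and sP: "selfadjoint_op P"
    using P(1) by (simp_all add: positive_op_def selfadjoint_op_def)
  have "positive_op Q"
    using P(1) k(1) bP selfadjointD[OF sP] unfolding positive_op_def selfadjoint_op_def Q_def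
    by (simp add: bounded_op_scaleC cinner_scaleC_left cinner_scaleC_right)
  moreover have "Q (Q x) = K (K x)" for x
    using k(1) by (simp add: Q_def bounded_op_simps[OF bP] P(2) LL scaleC_of_real power2_eq_square)
  moreover have "R (Q x) = Q (R x)" if "bounded_linear R" "\<forall>x. R (K (K x)) = K (K (R x))" for R x
  proof -
    have lin: "linear R"
      using that(1) by (rule bounded_linear.linear)
    have "R (P x) = P (R x)"
      using that by (intro P(3)) (simp_all add: LL linear_scale[OF lin])
    then show ?thesis
      by (simp add: Q_def scaleC_of_real linear_scale[OF lin])
  qed
  ultimately show ?thesis
    by blast
qed

text \<open>As \<open>P\<close> and \<open>S\<close> commute, \<open>P + S\<close> annihilates
  \<open>z = P x - S x\<close>. Both forms are nonnegative, so each vanishes at \<open>z\<close>,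
  which gives \<open>P z = S z = 0\<close>; and the squared norm of \<open>z\<close> is the inner
  product of \<open>x\<close> with \<open>P z - S z\<close>.\<close>

lemma positive_sqrt_unique:
  assumes P: "positive_op P" and S: "positive_op S"
    and sq: "\<And>x. P (P x) = S (S x)" and comm: "\<And>x. P (S x) = S (P x)"
  shows "P = S"
proof
  fix x
  have sP: "selfadjoint_op P" and sS: "selfadjoint_op S"
    using P S by (simp_all add: positive_op_def)
  note linP = bounded_op_simps[OF selfadjoint_bounded[OF sP]]
  note linS = bounded_op_simps[OF selfadjoint_bounded[OF sS]]
  define z where "z = P x - S x"
  have "P z + S z = 0"
    by (simp add: z_def linP linS sq comm)
  then have "Re \<langle>P z, z\<rangle> + Re \<langle>S z, z\<rangle> = 0"
    by (metis cinner.zero_left cinner_add_left plus_complex.sel(1) zero_complex.sel(1))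
  moreover have "0 \<le> Re \<langle>P z, z\<rangle>" "0 \<le> Re \<langle>S z, z\<rangle>"
    using P S by (simp_all add: positive_op_def)
  ultimately have "P z = 0" "S z = 0"
    by (intro positive_op_kernel P S; linarith)+
  moreover have "\<langle>z, z\<rangle> = \<langle>x, P z - S z\<rangle>"
    using cinner.diff_left[of "P x" "S x" z]
    by (simp add: cinner.diff_right selfadjointD[OF sP] selfadjointD[OF sS] flip: z_def)
  ultimately have "\<langle>z, z\<rangle> = 0"
    by (simp add: cinner.zero_right)
  then show "P x = S x"
    by (simp add: cinner_self z_def)
qed

text \<open>\<open>C\<close> is skew-adjoint, so \<open>adj_op C \<circ> C\<close> is
  \<open>- C\<^sup>2 = K\<^sup>2\<close>, and the absolute value of the commutator is that of the
  self-adjoint \<open>K\<close>. The definite descriptions \<open>adj_op\<close> and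
  \<open>abs_op\<close> each require a witness and its uniqueness.\<close>

lemma abs_op_commutator:
  fixes A X :: "'a::chilbert_space \<Rightarrow> 'a"
  assumes A: "selfadjoint_op A" and X: "selfadjoint_op X"
  defines "C \<equiv> \<lambda>x. A (X x) - X (A x)"
  defines "K \<equiv> \<lambda>x. \<i> *\<^sub>C C x"
  shows "positive_op (abs_op C)" "abs_op C (abs_op C x) = K (K x)" "abs_op C (K x) = K (abs_op C x)"
proof -
  have K: "selfadjoint_op K"
    unfolding K_def C_def by (rule selfadjoint_op_commutator[OF A X])
  have bC: "bounded_op C"
    unfolding C_def by (intro bounded_op_commutator selfadjoint_bounded A X)
  have adj: "adj_op C = (\<lambda>x. - C x)"
    unfolding adj_op_def
  proof (rule the_equality)
    have skew: "\<langle>C x, y\<rangle> = \<langle>x, - C y\<rangle>" for x y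
      by (simp add: C_def cinner.diff_left cinner.diff_right selfadjointD[OF A] selfadjointD[OF X])
    then show "bounded_op (\<lambda>x. - C x) \<and> (\<forall>x y. \<langle>C x, y\<rangle> = \<langle>x, - C y\<rangle>)"
      using bC by (simp add: bounded_op_minus)
    fix S assume S: "bounded_op S \<and> (\<forall>x y. \<langle>C x, y\<rangle> = \<langle>x, S y\<rangle>)"
    show "S = (\<lambda>x. - C x)"
    proof (rule ext, rule cinner_ext)
      show "\<langle>S y, x\<rangle> = \<langle>- C y, x\<rangle>" for y x
        using S skew cinner_commute by metis
    qed
  qed
  have KK: "K (K x) = - C (C x)" for x
    by (simp add: K_def bounded_op_simps[OF bC] scaleC_scaleC scaleC.minus_left)
  then have sq: "adj_op C \<circ> C = (\<lambda>x. K (K x))"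
    by (simp add: adj fun_eq_iff)
  obtain P where P: "positive_op P" "\<And>x. P (P x) = K (K x)"
    "\<And>R x. bounded_linear R \<Longrightarrow> \<forall>x. R (K (K x)) = K (K (R x)) \<Longrightarrow> R (P x) = P (R x)"
    using positive_sqrt[OF K] by blast
  have "abs_op C = P"
    unfolding abs_op_def sq
  proof (rule the_equality)
    show "positive_op P \<and> P \<circ> P = (\<lambda>x. K (K x))"
      using P(1,2) by (simp add: fun_eq_iff)
    fix S assume S: "positive_op S \<and> S \<circ> S = (\<lambda>x. K (K x))"
    then have SS: "S (S x) = K (K x)" for x
      by (metis comp_apply)
    have "bounded_linear S"
      using S by (simp add: positive_op_def selfadjoint_op_def bounded_op_def)
    then have "S (P x) = P (S x)" for x
      by (rule P(3)) (simp flip: SS)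
    then show "S = P"
      using S SS P(1,2) by (intro positive_sqrt_unique) simp_all
  qed
  moreover have "K (P x) = P (K x)" for x
    using bounded_op_linear[OF selfadjoint_bounded[OF K]] by (rule P(3)) simp
  ultimately show "positive_op (abs_op C)" "abs_op C (abs_op C x) = K (K x)" "abs_op C (K x) = K (abs_op C x)"
    using P(1,2) by simp_all
qed

section \<open>Splitting the scale of the absolute value\<close>

text \<open>The projection theorem. The parallelogram law makes a minimizing sequence Cauchy; at its
  limit, the nearest point of \<open>M\<close>, the first-order condition is orthogonality.\<close>

lemma orthogonal_decomposition:
  fixes M :: "'a::chilbert_space set"
  assumes M: "cvec.subspace M" "closed M"
  shows "\<exists>m\<in>M. \<forall>y\<in>M. \<langle>x - m, y\<rangle> = 0"
proof -
  define d where "d = (INF m\<in>M. (norm (x - m))\<^sup>2)"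
  have ne: "M \<noteq> {}"
    using cvec.subspace_0[OF M(1)] by blast
  have bdd: "bdd_below ((\<lambda>m. (norm (x - m))\<^sup>2) ` M)"
    by (rule bdd_belowI2[where m = 0]) simp
  have d: "d \<le> (norm (x - m))\<^sup>2" if "m \<in> M" for m
    unfolding d_def by (rule cINF_lower[OF bdd that])
  have "\<exists>m\<in>M. (norm (x - m))\<^sup>2 < d + 1 / real (Suc n)" for n
  proof -
    have "d < d + 1 / real (Suc n)"
      by simp
    then show ?thesis
      unfolding d_def cINF_less_iff[OF ne bdd] by simp
  qed
  then obtain m where m: "\<And>n. m n \<in> M" "\<And>n. (norm (x - m n))\<^sup>2 < d + 1 / real (Suc n)"
    by metis
  have dist: "(norm (m i - m j))\<^sup>2 \<le> 2 / real (Suc i) + 2 / real (Suc j)" for i j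
  proof -
    define a b where "a = x - m i" and "b = x - m j"
    \<comment> \<open>The midpoint stays in \<open>M\<close>, so its squared distance to
      \<open>x\<close> is at least \<open>d\<close>; this bounds the other diagonal of the
      parallelogram from above.\<close>
    have "(1 / 2) *\<^sub>R (m i + m j) \<in> M"
      unfolding scaleC_of_real[symmetric] using m(1) M(1)
      by (intro cvec.subspace_scale cvec.subspace_add)
    then have "4 * d \<le> 4 * (norm (x - (1 / 2) *\<^sub>R (m i + m j)))\<^sup>2"
      using d by simp
    also have "x - (1 / 2) *\<^sub>R (m i + m j) = (1 / 2) *\<^sub>R (a + b)"
      by (simp add: a_def b_def algebra_simps flip: scaleR_2)
    also have "4 * (norm ((1 / 2) *\<^sub>R (a + b)))\<^sup>2 = (norm (a + b))\<^sup>2"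
      by (simp add: power_divide)
    finally have "4 * d \<le> (norm (a + b))\<^sup>2" .
    moreover have "(norm (a + b))\<^sup>2 + (norm (b - a))\<^sup>2 = 2 * (norm a)\<^sup>2 + 2 * (norm b)\<^sup>2"
      using norm_add_square[of a b] norm_add_square[of b "- a"] Re_cinner_commute[of a b]
      by (simp add: cinner.minus_right)
    moreover have "b - a = m i - m j"
      by (simp add: a_def b_def)
    ultimately show ?thesis
      using m(2)[of i] m(2)[of j] unfolding a_def b_def by simp
  qed
  have "Cauchy m"
  proof (rule CauchyI)
    fix e :: real assume e: "0 < e"
    obtain K where K: "4 / e\<^sup>2 < real K"
      using reals_Archimedean2 by blast
    have "norm (m i - m j) < e" if ij: "i \<ge> K" "j \<ge> K" for i j
    proof -
      have "0 < 4 / e\<^sup>2"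
        using e by simp
      then have K0: "0 < real K"
        using K by linarith
      have "2 / real (Suc i) + 2 / real (Suc j) \<le> 2 / real K + 2 / real K"
        using ij K0 by (intro add_mono divide_left_mono) auto
      also have "\<dots> < e\<^sup>2"
        using K K0 e by (simp add: field_simps)
      finally have "(norm (m i - m j))\<^sup>2 < e\<^sup>2"
        using dist[of i j] by linarith
      then show ?thesis
        using e by (simp add: power_less_imp_less_base)
    qed
    then show "\<exists>K. \<forall>i\<ge>K. \<forall>j\<ge>K. norm (m i - m j) < e"
      by blast
  qed
  then obtain l where l: "m \<longlonglongrightarrow> l"
    using Cauchy_convergent convergent_def by blast
  have lM: "l \<in> M"
    by (rule closed_sequentially[OF M(2) _ l]) (rule m(1))
  have ld: "(norm (x - l))\<^sup>2 \<le> d"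
  proof (rule LIMSEQ_le)
    show "(\<lambda>n. (norm (x - m n))\<^sup>2) \<longlonglongrightarrow> (norm (x - l))\<^sup>2"
      by (intro tendsto_intros l)
    show "(\<lambda>n. d + 1 / real (Suc n)) \<longlonglongrightarrow> d"
      using tendsto_add[OF tendsto_const[of d] lim_inverse_n'[THEN LIMSEQ_Suc]] by simp
    show "\<exists>N. \<forall>n\<ge>N. (norm (x - m n))\<^sup>2 \<le> d + 1 / real (Suc n)"
      using m(2) less_imp_le by blast
  qed
  have "\<langle>x - l, y\<rangle> = 0" if y: "y \<in> M" for y
  proof -
    define c where "c = \<langle>x - l, y\<rangle>"
    define z where "z = c *\<^sub>C y"
    have z: "z \<in> M"
      unfolding z_def by (rule cvec.subspace_scale[OF M(1) y])
    have "Re \<langle>x - l, z\<rangle> = 0"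
    proof (rule linear_term_eq_0)
      fix t :: real
      have "l - t *\<^sub>R z \<in> M"
        unfolding scaleC_of_real[symmetric]
        by (intro cvec.subspace_diff[OF M(1)] cvec.subspace_scale[OF M(1)] lM z)
      then have "(norm (x - l))\<^sup>2 \<le> (norm (x - (l - t *\<^sub>R z)))\<^sup>2"
        using d ld order_trans by blast
      also have "x - (l - t *\<^sub>R z) = (x - l) + t *\<^sub>R z"
        by simp
      finally have "(norm (x - l))\<^sup>2 \<le> (norm ((x - l) + t *\<^sub>R z))\<^sup>2" .
      then show "0 \<le> 2 * t * Re \<langle>x - l, z\<rangle> + t\<^sup>2 * (norm z)\<^sup>2"
        unfolding norm_add_square by (simp add: cinner.scaleR_right power_mult_distrib)
    qed
    moreover have "\<langle>x - l, z\<rangle> = cnj c * c"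
      by (simp add: z_def cinner_scaleC_right c_def)
    ultimately show ?thesis
      by (simp add: c_def complex_eq_iff)
  qed
  with lM show ?thesis
    by blast
qed

text \<open>Needed because the projections of a unit vector are no longer unit vectors. Strictness
  is lost at \<open>x = 0\<close>.\<close>

lemma quadratic_form_le_scaled:
  assumes A: "bounded_op A" and x: "\<forall>b\<in>B. \<langle>x, b\<rangle> = 0"
    and le: "\<And>x. norm x = 1 \<Longrightarrow> \<forall>b\<in>B. \<langle>x, b\<rangle> = 0 \<Longrightarrow> Re \<langle>A x, x\<rangle> < c"
  shows "Re \<langle>A x, x\<rangle> \<le> c * (norm x)\<^sup>2"
proof (cases "x = 0")
  case False
  have "Re \<langle>A ((1 / norm x) *\<^sub>R x), (1 / norm x) *\<^sub>R x\<rangle> < c"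
    using False x by (intro le) (simp_all add: cinner.scaleR_left)
  then show ?thesis
    using False
    by (simp add: bounded_op_simps[OF A] cinner.scaleR_left cinner.scaleR_right field_simps power2_eq_square)
qed (simp add: cinner.zero_right)

text \<open>Let \<open>E\<close> be the projection onto the kernel of \<open>P - K\<close> and \<open>F = 1 - E\<close>.  Then \<open>P\<close>
  acts as \<open>K\<close> on the range of \<open>E\<close> and as \<open>- K\<close> on the range of \<open>F\<close>, so constraints
  controlling \<open>K\<close> and \<open>- K\<close> may be pushed forward by \<open>E\<close> and \<open>F\<close>.\<close>

lemma upper_scale_abs_le_max:
  fixes P K :: "'a::chilbert_space \<Rightarrow> 'a"
  assumes inf: "infinite_dim TYPE('a)" and P: "selfadjoint_op P" and K: "selfadjoint_op K"
    and sq: "\<And>x. P (P x) = K (K x)" and comm: "\<And>x. P (K x) = K (P x)"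
  shows "upper_scale P (p + q) \<le> max (upper_scale K p) (upper_scale (\<lambda>x. - K x) q)"
proof (rule dense_ge)
  note bP = selfadjoint_bounded[OF P] and bK = selfadjoint_bounded[OF K]
  note linP = bounded_op_simps[OF bP] and linK = bounded_op_simps[OF bK]
  fix c assume c: "max (upper_scale K p) (upper_scale (\<lambda>x. - K x) q) < c"
  obtain B1 where B1: "finite B1" "card B1 = p"
    "\<And>x. norm x = 1 \<Longrightarrow> \<forall>b\<in>B1. \<langle>x, b\<rangle> = 0 \<Longrightarrow> Re \<langle>K x, x\<rangle> < c"
    using upper_scale_less_imp[OF inf bK, of p c] c by auto
  obtain B2 where B2: "finite B2" "card B2 = q"
    "\<And>x. norm x = 1 \<Longrightarrow> \<forall>b\<in>B2. \<langle>x, b\<rangle> = 0 \<Longrightarrow> Re \<langle>- K x, x\<rangle> < c"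
    using upper_scale_less_imp[OF inf bounded_op_minus[OF bK], of q c] c by auto
  define M where "M = {x. P x - K x = 0}"
  have "cvec.subspace M"
    unfolding M_def by (rule cvec.subspaceI) (simp_all add: linP linK)
  moreover have "closed M"
    unfolding M_def
    by (intro closed_Collect_eq continuous_intros linear_continuous_on bounded_op_linear bP bK)
  ultimately have "\<forall>x. \<exists>m\<in>M. \<forall>y\<in>M. \<langle>x - m, y\<rangle> = 0"
    using orthogonal_decomposition by blast
  then obtain E where E: "\<And>x. E x \<in> M" "\<And>x y. y \<in> M \<Longrightarrow> \<langle>x - E x, y\<rangle> = 0"
    by metis
  define F where "F x = x - E x" for x
  have EF: "x = E x + F x" for x
    by (simp add: F_def)
  have FM: "\<langle>F x, y\<rangle> = 0" "\<langle>y, F x\<rangle> = 0" if "y \<in> M" for x y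
    using E(2)[OF that, of x] cinner_commute[of y "F x"] by (simp_all add: F_def)
  have PE: "P (E x) = K (E x)" for x
    using E(1)[of x] by (simp add: M_def)
  have PEM: "P (E x) \<in> M" for x
    using PE[of x] by (simp add: M_def sq comm)
  \<comment> \<open>\<open>(P - K) (P + K) = 0\<close>, since the squares agree and the operators
    commute. Hence \<open>P + K\<close> maps into \<open>M\<close> and, being self-adjoint, vanishes
    on vectors orthogonal to \<open>M\<close>.\<close>
  have range: "P y + K y \<in> M" for y
    by (simp add: M_def linP linK sq comm)
  have PF: "P (F x) = - K (F x)" for x
  proof -
    have "\<langle>P (F x) + K (F x), y\<rangle> = 0" for y
      using FM(1)[OF range, of x y]
      by (simp add: cinner_add_left cinner_add_right selfadjointD[OF P] selfadjointD[OF K])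
    then have "P (F x) + K (F x) = 0"
      by (intro cinner_ext) (simp add: cinner.zero_left)
    then show ?thesis
      by (simp add: eq_neg_iff_add_eq_0)
  qed
  have form: "\<langle>P x, x\<rangle> = \<langle>K (E x), E x\<rangle> + \<langle>- K (F x), F x\<rangle>" for x
  proof -
    have "\<langle>P x, x\<rangle> = \<langle>P (E x) + P (F x), E x + F x\<rangle>"
      using EF[of x] linP(1) by metis
    also have "\<dots> = \<langle>P (E x), E x\<rangle> + \<langle>P (F x), F x\<rangle>"
      using FM[OF PEM, of x x]
      by (simp add: cinner_add_left cinner_add_right selfadjointD[OF P, of "F x" "E x"])
    finally show ?thesis
      by (simp only: PE PF)
  qed
  have pythagoras: "(norm x)\<^sup>2 = (norm (E x))\<^sup>2 + (norm (F x))\<^sup>2" for x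
    using norm_add_square[of "E x" "F x"] FM(2)[OF E(1), of x x] EF[of x] by simp
  \<comment> \<open>Symmetry of \<open>E\<close> and \<open>F\<close> turns a constraint on
    \<open>E x\<close> or \<open>F x\<close> into one on \<open>x\<close>.\<close>
  have E_sym: "\<langle>E x, b\<rangle> = \<langle>x, E b\<rangle>" and F_sym: "\<langle>F x, b\<rangle> = \<langle>x, F b\<rangle>" for x b
  proof -
    have "\<langle>E x + F x, E b\<rangle> = \<langle>E x, E b + F b\<rangle>"
      by (simp add: cinner_add_left cinner_add_right FM E(1))
    then show "\<langle>E x, b\<rangle> = \<langle>x, E b\<rangle>"
      using EF[of x] EF[of b] by simp
    then show "\<langle>F x, b\<rangle> = \<langle>x, F b\<rangle>"
      by (simp add: F_def cinner.diff_left cinner.diff_right)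
  qed
  show "upper_scale P (p + q) \<le> c"
  proof (rule upper_scale_le[OF inf bP])
    show "finite (E ` B1 \<union> F ` B2)"
      using B1(1) B2(1) by simp
    show "card (E ` B1 \<union> F ` B2) \<le> p + q"
      using card_Un_le[of "E ` B1" "F ` B2"] card_image_le[OF B1(1), of E] card_image_le[OF B2(1), of F]
        B1(2) B2(2) by linarith
    fix x assume x: "norm x = 1" "\<And>b. b \<in> E ` B1 \<union> F ` B2 \<Longrightarrow> \<langle>x, b\<rangle> = 0"
    have "\<forall>b\<in>B1. \<langle>E x, b\<rangle> = 0" "\<forall>b\<in>B2. \<langle>F x, b\<rangle> = 0"
      using x(2) by (auto simp: E_sym F_sym)
    then have "Re \<langle>K (E x), E x\<rangle> \<le> c * (norm (E x))\<^sup>2" "Re \<langle>- K (F x), F x\<rangle> \<le> c * (norm (F x))\<^sup>2"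
      using quadratic_form_le_scaled[OF bK _ B1(3)]
        quadratic_form_le_scaled[OF bounded_op_minus[OF bK] _ B2(3)] by blast+
    then have "Re \<langle>P x, x\<rangle> \<le> c * (norm (E x))\<^sup>2 + c * (norm (F x))\<^sup>2"
      unfolding form by simp
    also have "\<dots> = c"
      using pythagoras[of x] x(1) by (simp flip: distrib_left)
    finally show "Re \<langle>P x, x\<rangle> \<le> c" .
  qed
qed

text \<open>Greedy merging: once \<open>p + q = k\<close> terms are used, the next term is at most
  the larger of \<open>a p\<close> and \<open>b q\<close>, and the sequence that attains it is
  advanced.\<close>

lemma sum_le_sum_merge:
  fixes s a b :: "nat \<Rightarrow> real"
  assumes "\<And>p q. s (p + q) \<le> max (a p) (b q)"
  shows "\<exists>p q. p + q = k \<and> (\<Sum>i<k. s i) \<le> (\<Sum>i<p. a i) + (\<Sum>i<q. b i)"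
proof (induction k)
  case (Suc k)
  then obtain p q where pq: "p + q = k" "(\<Sum>i<k. s i) \<le> (\<Sum>i<p. a i) + (\<Sum>i<q. b i)"
    by blast
  show ?case
  proof (cases "a p \<le> b q")
    case True
    then have "(\<Sum>i<Suc k. s i) \<le> (\<Sum>i<p. a i) + (\<Sum>i<Suc q. b i)"
      using assms[of p q] pq by simp
    then show ?thesis
      using pq(1) by (intro exI[of _ p] exI[of _ "Suc q"]) simp
  next
    case False
    then have "(\<Sum>i<Suc k. s i) \<le> (\<Sum>i<Suc p. a i) + (\<Sum>i<q. b i)"
      using assms[of p q] pq by simp
    then show ?thesis
      using pq(1) by (intro exI[of _ "Suc p"] exI[of _ q]) simp
  qed
qed simp

lemma sum_singular_values_commutator_le:
  fixes A X :: "'a::chilbert_space \<Rightarrow> 'a"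
  assumes inf: "infinite_dim TYPE('a)" and A: "selfadjoint_op A" and X: "selfadjoint_op X"
  shows "(\<Sum>i<k. singular_values (\<lambda>x. A (X x) - X (A x)) i)
    \<le> (\<Sum>i<k. 1 / 2 * (spectral_spread (map_prod A A) i * spectral_spread (map_prod X X) i))"
proof -
  let ?P = "abs_op (\<lambda>x. A (X x) - X (A x))" and ?K = "\<lambda>x. \<i> *\<^sub>C (A (X x) - X (A x))"
  have "selfadjoint_op ?P"
    using abs_op_commutator(1)[OF A X] by (simp add: positive_op_def)
  then have "upper_scale ?P (p + q) \<le> max (upper_scale ?K p) (upper_scale (\<lambda>x. - ?K x) q)" for p q
    by (intro upper_scale_abs_le_max inf selfadjoint_op_commutator abs_op_commutator(2,3) A X)
  then obtain p q where pq: "p + q = k"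
    "(\<Sum>i<k. upper_scale ?P i) \<le> (\<Sum>i<p. upper_scale ?K i) + (\<Sum>i<q. upper_scale (\<lambda>x. - ?K x) i)"
    using sum_le_sum_merge[of "upper_scale ?P"] by blast
  then show ?thesis
    using sum_commutator_scale_le[OF inf A X, of p q]
    by (simp add: singular_values_def upper_scale_def sum_divide_distrib)
qed

lemma upper_scale_nonneg:
  fixes P :: "'a::chilbert_space \<Rightarrow> 'a"
  assumes inf: "infinite_dim TYPE('a)" and P: "positive_op P"
  shows "0 \<le> upper_scale P n"
proof (rule dense_ge)
  have bP: "bounded_op P"
    using P by (simp add: positive_op_def selfadjoint_op_def)
  fix c assume "upper_scale P n < c"
  then obtain B where B: "finite B"
    "\<And>x. norm x = 1 \<Longrightarrow> \<forall>b\<in>B. \<langle>x, b\<rangle> = 0 \<Longrightarrow> Re \<langle>P x, x\<rangle> < c"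
    using upper_scale_less_imp[OF inf bP] by blast
  obtain x where x: "norm x = 1" "\<And>b. b \<in> B \<Longrightarrow> \<langle>x, b\<rangle> = 0"
    using infinite_dim_orthogonal[OF inf B(1)] by metis
  have "0 \<le> Re \<langle>P x, x\<rangle>"
    using P by (simp add: positive_op_def)
  also have "\<dots> < c"
    using x by (intro B(2)) auto
  finally show "0 \<le> c"
    by simp
qed

section \<open>Decreasing rearrangements\<close>

definition unit_ell2 :: "'i \<Rightarrow> 'i ell2" where
  "unit_ell2 i = Abs_ell2 (\<lambda>j. if j = i then 1 else 0)"

lemma ell2_nth_unit: "ell2_nth (unit_ell2 i) j = (if j = i then 1 else 0)"
proof -
  have "(\<lambda>j. (cmod (if j = i then 1 else 0))\<^sup>2) summable_on UNIV"
    by (rule finite_nonzero_values_imp_summable_on) (simp add: if_distrib cong: if_cong)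
  then show ?thesis
    by (simp add: unit_ell2_def Abs_ell2_inverse)
qed

lemma cinner_unit_ell2: "\<langle>x, unit_ell2 i\<rangle> = ell2_nth x i"
proof -
  have "\<langle>x, unit_ell2 i\<rangle> = (\<Sum>\<^sub>\<infinity>j. ell2_nth x j * cnj (if j = i then 1 else 0))"
    by (simp add: cinner_ell2.rep_eq ell2_nth_unit)
  also have "\<dots> = (\<Sum>\<^sub>\<infinity>j\<in>{i}. ell2_nth x j)"
    by (rule infsum_cong_neutral) auto
  finally show ?thesis
    by simp
qed

lemma orthonormal_upto_unit_ell2: "orthonormal_upto n (unit_ell2 :: nat \<Rightarrow> nat ell2)"
  by (simp add: orthonormal_upto_def cinner_unit_ell2 ell2_nth_unit)

lemma infinite_dim_ell2: "infinite_dim TYPE(nat ell2)"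
  using orthonormal_upto_unit_ell2 by (intro infinite_dimI) blast

lemma norm_ell2_square: "(norm x)\<^sup>2 = (\<Sum>\<^sub>\<infinity>i. (cmod (ell2_nth x i))\<^sup>2)"
  by (simp add: norm_ell2.rep_eq infsum_nonneg)

lemma ell2_eqI: "(\<And>i. ell2_nth x i = ell2_nth y i) \<Longrightarrow> x = y"
  by (simp add: ell2_nth_inject[symmetric] fun_eq_iff)

context
  fixes a :: "'i \<Rightarrow> real" and K :: real
  assumes a: "\<And>i. \<bar>a i\<bar> \<le> K"
begin

lemma diag_ell2_term_le: "(cmod (complex_of_real (a i) * z))\<^sup>2 \<le> K\<^sup>2 * (cmod z)\<^sup>2"
  unfolding norm_mult power_mult_distrib using power_mono[OF a[of i], of 2]
  by (intro mult_right_mono) simp_all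

lemma diag_ell2_summable:
  "(\<lambda>i. (cmod (complex_of_real (a i) * ell2_nth x i))\<^sup>2) summable_on UNIV"
  by (rule summable_on_comparison_test[OF summable_on_cmult_right[OF ell2_summable]])
    (auto intro: diag_ell2_term_le)

lemma ell2_nth_diag: "ell2_nth (diag_ell2 a x) i = complex_of_real (a i) * ell2_nth x i"
  using diag_ell2_summable[of x] by (simp add: diag_ell2_def Abs_ell2_inverse)

lemma bounded_op_diag_ell2: "bounded_op (diag_ell2 a)"
proof (rule bounded_opI[where K = K])
  show "diag_ell2 a (x + y) = diag_ell2 a x + diag_ell2 a y" for x y
    by (rule ell2_eqI) (simp add: ell2_nth_diag plus_ell2.rep_eq distrib_left)
  show "diag_ell2 a (c *\<^sub>C x) = c *\<^sub>C diag_ell2 a x" for c x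
    by (rule ell2_eqI) (simp add: ell2_nth_diag scaleC_ell2.rep_eq)
  show "norm (diag_ell2 a x) \<le> norm x * K" for x
  proof -
    \<comment> \<open>Types are nonempty, so any index, here \<open>undefined\<close>, shows that
      the bound is nonnegative.\<close>
    have "0 \<le> K"
      using a[of undefined] by linarith
    have "(norm (diag_ell2 a x))\<^sup>2 \<le> (\<Sum>\<^sub>\<infinity>i. K\<^sup>2 * (cmod (ell2_nth x i))\<^sup>2)"
      unfolding norm_ell2_square ell2_nth_diag
      by (intro infsum_mono diag_ell2_summable summable_on_cmult_right ell2_summable diag_ell2_term_le)
    also have "\<dots> = (norm x * K)\<^sup>2"
      by (simp add: infsum_cmult_right' norm_ell2_square power_mult_distrib mult.commute)
    finally show ?thesis
      using \<open>0 \<le> K\<close> by (simp add: power2_le_iff_abs_le)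
  qed
qed

lemma diag_ell2_form_summable: "(\<lambda>i. a i * (cmod (ell2_nth x i))\<^sup>2) summable_on UNIV"
proof (rule Infinite_Sum.abs_summable_summable, rule summable_on_comparison_test)
  show "(\<lambda>i. K * (cmod (ell2_nth x i))\<^sup>2) summable_on UNIV"
    by (intro summable_on_cmult_right ell2_summable)
  show "norm (a i * (cmod (ell2_nth x i))\<^sup>2) \<le> K * (cmod (ell2_nth x i))\<^sup>2" for i
    using a[of i] by (simp add: abs_mult mult_right_mono)
qed simp

lemma diag_ell2_form: "Re \<langle>diag_ell2 a x, x\<rangle> = (\<Sum>\<^sub>\<infinity>i. a i * (cmod (ell2_nth x i))\<^sup>2)"
proof -
  have "\<langle>diag_ell2 a x, x\<rangle> = (\<Sum>\<^sub>\<infinity>i. complex_of_real (a i * (cmod (ell2_nth x i))\<^sup>2))"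
    unfolding cinner_ell2.rep_eq ell2_nth_diag of_real_mult complex_norm_square by (simp add: mult.assoc)
  also have "\<dots> = complex_of_real (\<Sum>\<^sub>\<infinity>i. a i * (cmod (ell2_nth x i))\<^sup>2)"
    by (intro infsumI has_sum_of_real_iff[THEN iffD2] has_sum_infsum diag_ell2_form_summable)
  finally show ?thesis
    by simp
qed

end

text \<open>Reduces \<open>\<prec>\<^sub>w\<close> between decreasing nonnegative sequences to
  partial sums. The first \<open>n\<close> unit vectors, taken as constraints, give the upper bound;
  for the lower one, any \<open>n\<close> constraints leave a unit vector in the span of the first
  \<open>n + 1\<close>.\<close>

lemma decr_rearrangement_antimono:
  assumes dec: "\<And>i j. i \<le> j \<Longrightarrow> a j \<le> a i" and nonneg: "\<And>i. 0 \<le> a i"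
  shows "decr_rearrangement a n = a n"
proof -
  have a: "\<bar>a i\<bar> \<le> a 0" for i
    using dec[of 0 i] nonneg by simp
  have D: "bounded_op (diag_ell2 a)"
    using a by (rule bounded_op_diag_ell2)
  have unit: "(\<Sum>\<^sub>\<infinity>i. (cmod (ell2_nth x i))\<^sup>2) = 1" if "norm x = 1" for x :: "nat ell2"
    using norm_ell2_square[of x] that by simp
  have "upper_scale (diag_ell2 a) n = a n"
  proof (rule antisym)
    show "upper_scale (diag_ell2 a) n \<le> a n"
    proof (rule upper_scale_le[OF infinite_dim_ell2 D])
      show "finite (unit_ell2 ` {..<n})" "card (unit_ell2 ` {..<n}) \<le> n"
        using card_image_le[of "{..<n}" unit_ell2] by simp_all
      fix x :: "nat ell2"
      assume x: "norm x = 1" "\<And>b. b \<in> unit_ell2 ` {..<n} \<Longrightarrow> \<langle>x, b\<rangle> = 0"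
      have "ell2_nth x i = 0" if "i < n" for i
        using x(2)[of "unit_ell2 i"] that by (simp add: cinner_unit_ell2)
      then have "a i * (cmod (ell2_nth x i))\<^sup>2 \<le> a n * (cmod (ell2_nth x i))\<^sup>2" for i
        using dec[of n i] by (cases "i < n") (simp_all add: mult_right_mono)
      then have "Re \<langle>diag_ell2 a x, x\<rangle> \<le> (\<Sum>\<^sub>\<infinity>i. a n * (cmod (ell2_nth x i))\<^sup>2)"
        unfolding diag_ell2_form[OF a]
        by (intro infsum_mono diag_ell2_form_summable[OF a] summable_on_cmult_right ell2_summable)
      also have "\<dots> = a n"
        by (simp add: infsum_cmult_right' unit[OF x(1)])
      finally show "Re \<langle>diag_ell2 a x, x\<rangle> \<le> a n" .
    qed
    show "a n \<le> upper_scale (diag_ell2 a) n"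
    proof (rule dense_ge)
      fix c assume "upper_scale (diag_ell2 a) n < c"
      then obtain B :: "nat ell2 set" where B: "finite B" "card B = n"
        "\<And>x. norm x = 1 \<Longrightarrow> \<forall>b\<in>B. \<langle>x, b\<rangle> = 0 \<Longrightarrow> Re \<langle>diag_ell2 a x, x\<rangle> < c"
        using upper_scale_less_imp[OF infinite_dim_ell2 D] by blast
      obtain x where x: "x \<in> cspan (unit_ell2 ` {..<Suc n})" "norm x = 1" "\<And>b. b \<in> B \<Longrightarrow> \<langle>x, b\<rangle> = 0"
        using unit_vector_orthogonal[OF orthonormal_upto_unit_ell2 B(1), of "Suc n"] B(2) by auto
      have zero: "ell2_nth x i = 0" if "n < i" for i
      proof -
        have "\<langle>unit_ell2 i, x\<rangle> = 0"
          by (rule cinner_cspan_right[OF x(1)]) (use that in \<open>auto simp: cinner_unit_ell2 ell2_nth_unit\<close>)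
        then show ?thesis
          using cinner_commute[of x "unit_ell2 i"] by (simp add: cinner_unit_ell2)
      qed
      have "a n * (cmod (ell2_nth x i))\<^sup>2 \<le> a i * (cmod (ell2_nth x i))\<^sup>2" for i
        using dec[of i n] zero[of i] by (cases "n < i") (simp_all add: mult_right_mono)
      then have "(\<Sum>\<^sub>\<infinity>i. a n * (cmod (ell2_nth x i))\<^sup>2) \<le> Re \<langle>diag_ell2 a x, x\<rangle>"
        unfolding diag_ell2_form[OF a]
        by (intro infsum_mono diag_ell2_form_summable[OF a] summable_on_cmult_right ell2_summable)
      then have "a n \<le> Re \<langle>diag_ell2 a x, x\<rangle>"
        by (simp add: infsum_cmult_right' unit[OF x(2)])
      also have "\<dots> < c"
        using x by (intro B(3)) auto
      finally show "a n \<le> c"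
        by simp
    qed
  qed
  then show ?thesis
    by (simp add: decr_rearrangement_def upper_scale_def)
qed

section \<open>Symmetric gauge functions\<close>

text \<open>Where \<open>s k > t k\<close>, domination of the partial sums provides an earlier \<open>j\<close> with
  \<open>s j < t j\<close>.  Moving mass from \<open>j\<close> to \<open>k\<close> until one of the two entries agrees
  with \<open>s\<close> averages \<open>t\<close> with its transposition and keeps the domination.\<close>

lemma weak_majorization_mono:
  fixes \<Phi> :: "(nat \<Rightarrow> real) \<Rightarrow> real"
  assumes mono: "\<And>s t. (\<And>i. i < n \<Longrightarrow> 0 \<le> s i \<and> s i \<le> t i) \<Longrightarrow> \<Phi> s \<le> \<Phi> t"
    and average: "\<And>t j k \<theta>. j < n \<Longrightarrow> k < n \<Longrightarrow> 0 \<le> \<theta> \<Longrightarrow> \<theta> \<le> 1 \<Longrightarrow>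
      \<Phi> (\<lambda>i. (1 - \<theta>) * t i + \<theta> * t ((id(j := k, k := j)) i)) \<le> \<Phi> t"
    and s: "\<And>i j. i \<le> j \<Longrightarrow> s j \<le> s i" "\<And>i. 0 \<le> s i"
    and le: "\<And>m. m \<le> n \<Longrightarrow> (\<Sum>i<m. s i) \<le> (\<Sum>i<m. t i)"
  shows "\<Phi> s \<le> \<Phi> t"
  using le
proof (induction "card {i. i < n \<and> s i \<noteq> t i}" arbitrary: t rule: less_induct)
  case less
  show ?case
  proof (cases "\<forall>i<n. s i \<le> t i")
    case True
    then show ?thesis
      using s(2) by (intro mono) auto
  next
    case False
    define k where "k = (LEAST k. k < n \<and> t k < s k)"
    have k: "k < n" "t k < s k"
      unfolding k_def using LeastI_ex[of "\<lambda>k. k < n \<and> t k < s k"] False by (auto simp: not_le)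
    have below: "s i \<le> t i" if "i < k" for i
      using not_less_Least[of i "\<lambda>k. k < n \<and> t k < s k"] that k(1) unfolding k_def[symmetric]
      by (auto simp: not_less)
    have "\<exists>j<k. s j < t j"
    proof (rule ccontr)
      assume "\<not> (\<exists>j<k. s j < t j)"
      then have "(\<Sum>i<k. t i) \<le> (\<Sum>i<k. s i)"
        by (intro sum_mono) (metis lessThan_iff not_less)
      then have "(\<Sum>i<Suc k. t i) < (\<Sum>i<Suc k. s i)"
        using k(2) by simp
      then show False
        using less.prems[of "Suc k"] k(1) by simp
    qed
    then obtain j where j: "j < k" "s j < t j"
      by blast
    define d where "d = min (t j - s j) (s k - t k)"
    \<comment> \<open>Averaging with the transposition at weight \<open>\<theta>\<close> moves the
      amount \<open>\<theta> * (t j - t k)\<close>, here \<open>d\<close>, from \<open>j\<close> to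
      \<open>k\<close>.\<close>
    define \<theta> where "\<theta> = d / (t j - t k)"
    define t' where "t' i = (1 - \<theta>) * t i + \<theta> * t ((id(j := k, k := j)) i)" for i
    have d: "0 < d" "d \<le> t j - s j" "d \<le> s k - t k"
      using j k by (simp_all add: d_def)
    have tjk: "d < t j - t k"
      using s(1)[of j k] j k(2) d by simp
    have \<theta>: "0 \<le> \<theta>" "\<theta> \<le> 1" "\<theta> * (t j - t k) = d"
      using d(1) tjk by (simp_all add: \<theta>_def)
    have t'_eq: "t' i = t i - (if i = j then d else 0) + (if i = k then d else 0)" for i
    proof -
      consider "i = j" | "i = k" | "i \<noteq> j" "i \<noteq> k"
        by blast
      then show ?thesis
        using j(1) \<theta>(3) by cases (simp_all add: t'_def algebra_simps)
    qed
    have "\<Phi> s \<le> \<Phi> t'"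
    proof (rule less.hyps)
      have eq: "{i. i < n \<and> s i \<noteq> t' i} \<subseteq> {i. i < n \<and> s i \<noteq> t i}"
        using j k by (auto simp: t'_eq)
      have "s j = t' j \<or> s k = t' k"
        using j(1) by (auto simp: t'_eq d_def min_def)
      then have "{i. i < n \<and> s i \<noteq> t' i} \<subset> {i. i < n \<and> s i \<noteq> t i}"
        using eq j k by auto
      then show "card {i. i < n \<and> s i \<noteq> t' i} < card {i. i < n \<and> s i \<noteq> t i}"
        by (intro psubset_card_mono) auto
      show "(\<Sum>i<m. s i) \<le> (\<Sum>i<m. t' i)" if m: "m \<le> n" for m
      proof -
        have sum: "(\<Sum>i<m. t' i) = (\<Sum>i<m. t i) - (if j < m then d else 0) + (if k < m then d else 0)"
          by (simp add: t'_eq sum.distrib sum_subtractf)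
        \<comment> \<open>Only the partial sums with \<open>j < m \<le> k\<close> lose
          \<open>d\<close>. All their terms satisfy \<open>s i \<le> t i\<close>, and the term
          \<open>j\<close> alone provides a surplus \<open>t j - s j \<ge> d\<close>.\<close>
        show ?thesis
        proof (cases "j < m \<and> \<not> k < m")
          case True
          then have "t j - s j \<le> (\<Sum>i<m. t i - s i)"
            using below by (intro member_le_sum) auto
          then show ?thesis
            using True d(2) unfolding sum by (simp add: sum_subtractf)
        next
          case False
          then show ?thesis
            using less.prems[OF m] j(1) d(1) unfolding sum by auto
        qed
      qed
    qed
    also have "\<Phi> t' \<le> \<Phi> t"
      unfolding t'_def using j(1) k(1) \<theta>(1,2) by (intro average) auto
    finally show ?thesis .
  qed
qed

section \<open>Norms of finite diagonal operators and Fan dominance\<close>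

context
  fixes e :: "nat \<Rightarrow> 'a::chilbert_space" and C :: "('a \<Rightarrow> 'a) set" and N :: "('a \<Rightarrow> 'a) \<Rightarrow> real"
  assumes e: "orthonormal_basis e" and N: "unitarily_invariant_norm e C N"
begin

lemma orthonormal_upto_basis: "orthonormal_upto n e"
  using e by (simp add: orthonormal_basis_def orthonormal_upto_def)

lemma norm_basis: "norm (e i) = 1"
  using orthonormal_upto_norm[OF orthonormal_upto_basis, of i "Suc i"] by simp

lemma ideal_zero: "(\<lambda>_. 0) \<in> C"
  and ideal_add: "S \<in> C \<Longrightarrow> T \<in> C \<Longrightarrow> (\<lambda>x. S x + T x) \<in> C"
  and norm_nonneg: "T \<in> C \<Longrightarrow> 0 \<le> N T"
  and norm_scale: "T \<in> C \<Longrightarrow> N (\<lambda>x. c *\<^sub>C T x) = cmod c * N T"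
  and norm_triangle: "S \<in> C \<Longrightarrow> T \<in> C \<Longrightarrow> N (\<lambda>x. S x + T x) \<le> N S + N T"
  and norm_compose: "T \<in> C \<Longrightarrow> bounded_op D \<Longrightarrow> bounded_op E \<Longrightarrow> N (D \<circ> T \<circ> E) \<le> onorm D * N T * onorm E"
  and rank_one_ideal: "bounded_op T \<Longrightarrow> range T \<in> subspaces_of_dim 1 \<Longrightarrow> T \<in> C"
  and norm_gauge: "T \<in> C \<Longrightarrow> ennreal (N T) = gauge_function e N (singular_values T)"
  using N unfolding unitarily_invariant_norm_def proper_ideal_def by blast+

lemma norm_compose_contractions:
  assumes T: "T \<in> C" and D: "bounded_op D" "\<And>x. norm (D x) \<le> norm x"
    and E: "bounded_op E" "\<And>x. norm (E x) \<le> norm x"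
  shows "N (D \<circ> T \<circ> E) \<le> N T"
proof -
  have "onorm D \<le> 1" "onorm E \<le> 1"
    using D(2) E(2) by (auto intro!: onorm_bound)
  moreover have "0 \<le> onorm E"
    by (rule onorm_pos_le[OF bounded_op_linear[OF E(1)]])
  ultimately have "onorm D * N T * onorm E \<le> 1 * N T * 1"
    using norm_nonneg[OF T] by (intro mult_mono) auto
  then show ?thesis
    using norm_compose[OF T D(1) E(1)] by simp
qed

lemma bounded_op_diag_op: "bounded_op (diag_op e a n)"
proof -
  have "bounded_op (\<lambda>x. \<Sum>i<n. complex_of_real (a i) *\<^sub>C \<langle>x, e i\<rangle> *\<^sub>C e i)"
    by (intro bounded_op_sum bounded_op_scaleC bounded_op_rank_one)
  then show ?thesis
    by (simp add: diag_op_def[abs_def] scaleC_scaleC)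
qed

text \<open>The norm axioms apply only inside the ideal; a finite diagonal operator belongs to it as
  a sum of rank-one operators.\<close>

lemma diag_op_ideal: "diag_op e a n \<in> C"
proof (induction n)
  case 0
  show ?case
    using ideal_zero by (simp add: diag_op_def[abs_def])
next
  case (Suc n)
  define T where "T x = (complex_of_real (a n) * \<langle>x, e n\<rangle>) *\<^sub>C e n" for x
  \<comment> \<open>A zero coefficient is treated separately because the range is then not
    one-dimensional.\<close>
  have "T \<in> C"
  proof (cases "a n = 0")
    case True
    then have "T = (\<lambda>_. 0)"
      by (simp add: T_def fun_eq_iff scaleC.zero_left)
    then show ?thesis
      using ideal_zero by simp
  next
    case False
    have "bounded_op (\<lambda>x. complex_of_real (a n) *\<^sub>C \<langle>x, e n\<rangle> *\<^sub>C e n)"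
      by (intro bounded_op_scaleC bounded_op_rank_one)
    then have "bounded_op T"
      by (simp add: T_def[abs_def] scaleC_scaleC)
    moreover have "range T = cspan {e n}"
    proof
      show "range T \<subseteq> cspan {e n}"
        by (auto simp: T_def intro!: cvec.span_scale intro: cvec.span_base)
      have "k *\<^sub>C e n = T ((k / complex_of_real (a n)) *\<^sub>C e n)" for k
        using False by (simp add: T_def cinner_scaleC_left cinner_self norm_basis)
      then show "cspan {e n} \<subseteq> range T"
        unfolding cvec.span_singleton by (metis image_subsetI rangeI)
    qed
    moreover have "e n \<noteq> 0"
      using norm_basis[of n] by auto
    ultimately show ?thesis
      by (intro rank_one_ideal) (auto simp: subspaces_of_dim_def intro!: exI[of _ "{e n}"])
  qed
  from ideal_add[OF Suc this] show ?case
    by (simp add: diag_op_def[abs_def] T_def)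
qed

text \<open>The operator for \<open>s\<close> is the one for \<open>t\<close> followed by the
  diagonal contraction with the quotients as entries.\<close>

lemma norm_diag_op_mono:
  assumes st: "\<And>i. i < n \<Longrightarrow> 0 \<le> s i \<and> s i \<le> t i"
  shows "N (diag_op e s n) \<le> N (diag_op e t n)"
proof -
  \<comment> \<open>Where \<open>t i = 0\<close> also \<open>s i = 0\<close>, and the quotient is 0
    by the convention on division.\<close>
  define d where "d i = s i / t i" for i
  have d: "0 \<le> d i" "d i \<le> 1" "d i * t i = s i" if "i < n" for i
    using st[OF that] by (auto simp: d_def divide_le_eq_1)
  have nth: "\<langle>diag_op e t n x, e i\<rangle> = complex_of_real (t i) * \<langle>x, e i\<rangle>" if "i < n" for x i
    unfolding diag_op_def by (rule cinner_sum_orthonormal[OF orthonormal_upto_basis that])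
  have "diag_op e d n (diag_op e t n x) = diag_op e s n x" for x
    unfolding diag_op_def[of e d] diag_op_def[of e s]
    by (intro sum.cong refl) (simp add: nth d(3)[symmetric])
  then have "diag_op e s n = diag_op e d n \<circ> diag_op e t n \<circ> (\<lambda>x. x)"
    by (simp add: fun_eq_iff)
  moreover have "norm (diag_op e d n x) \<le> norm x" for x
  proof -
    have "(norm (diag_op e d n x))\<^sup>2 = (\<Sum>i<n. (d i)\<^sup>2 * (cmod \<langle>x, e i\<rangle>)\<^sup>2)"
      unfolding diag_op_def norm_sum_orthonormal[OF orthonormal_upto_basis]
      by (simp add: norm_mult power_mult_distrib)
    also have "\<dots> \<le> (\<Sum>i<n. 1 * (cmod \<langle>x, e i\<rangle>)\<^sup>2)"
      using d by (intro sum_mono mult_right_mono) (auto intro: power_le_one)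
    also have "\<dots> \<le> (norm x)\<^sup>2"
      using bessel[OF orthonormal_upto_basis] by simp
    finally show ?thesis
      by (simp add: power2_le_iff_abs_le)
  qed
  moreover have "bounded_op (\<lambda>x :: 'a. x)"
    by (simp add: bounded_op_def)
  ultimately show ?thesis
    using norm_compose_contractions[OF diag_op_ideal bounded_op_diag_op] by simp
qed

text \<open>\<open>W\<close> permutes the first \<open>n\<close> basis vectors and annihilates what
  is orthogonal to them, so it is a contraction. As the permutation is an involution, the same
  \<open>W\<close> serves on both sides.\<close>

lemma norm_diag_op_transpose:
  assumes jk: "j < n" "k < n"
  shows "N (diag_op e (\<lambda>i. t ((id(j := k, k := j)) i)) n) \<le> N (diag_op e t n)"
proof -
  define \<pi> where "\<pi> = id(j := k, k := j)"
  have \<pi>: "\<pi> i < n" if "i < n" for i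
    using that jk by (simp add: \<pi>_def)
  have \<pi>\<pi>: "\<pi> (\<pi> i) = i" for i
    by (simp add: \<pi>_def)
  have bij: "bij_betw \<pi> {..<n} {..<n}"
    by (rule bij_betwI[where g = \<pi>]) (auto simp: \<pi> \<pi>\<pi>)
  define W where "W x = (\<Sum>i<n. \<langle>x, e (\<pi> i)\<rangle> *\<^sub>C e i)" for x
  have W: "bounded_op W"
    unfolding W_def by (intro bounded_op_sum bounded_op_rank_one)
  have norm_W: "norm (W x) \<le> norm x" for x
  proof -
    have "(norm (W x))\<^sup>2 = (\<Sum>i<n. (cmod \<langle>x, e (\<pi> i)\<rangle>)\<^sup>2)"
      unfolding W_def by (rule norm_sum_orthonormal[OF orthonormal_upto_basis])
    also have "\<dots> = (\<Sum>i<n. (cmod \<langle>x, e i\<rangle>)\<^sup>2)"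
      by (rule sum.reindex_bij_betw[OF bij])
    also have "\<dots> \<le> (norm x)\<^sup>2"
      by (rule bessel[OF orthonormal_upto_basis])
    finally show ?thesis
      by (simp add: power2_le_iff_abs_le)
  qed
  have W_nth: "\<langle>W x, e i\<rangle> = \<langle>x, e (\<pi> i)\<rangle>" if "i < n" for x i
    unfolding W_def by (rule cinner_sum_orthonormal[OF orthonormal_upto_basis that])
  have diag_nth: "\<langle>diag_op e t n x, e i\<rangle> = complex_of_real (t i) * \<langle>x, e i\<rangle>" if "i < n" for x i
    unfolding diag_op_def by (rule cinner_sum_orthonormal[OF orthonormal_upto_basis that])
  have "W (diag_op e t n (W x)) = diag_op e (\<lambda>i. t (\<pi> i)) n x" for x
    unfolding W_def[of "diag_op e t n (W x)"] diag_op_def[of e "\<lambda>i. t (\<pi> i)"]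
    by (intro sum.cong refl) (simp add: diag_nth W_nth \<pi> \<pi>\<pi>)
  then have "diag_op e (\<lambda>i. t (\<pi> i)) n = W \<circ> diag_op e t n \<circ> W"
    by (simp add: fun_eq_iff)
  then show ?thesis
    using norm_compose_contractions[OF diag_op_ideal W norm_W W norm_W] by (simp add: \<pi>_def)
qed

lemma diag_op_scale: "diag_op e (\<lambda>i. c * a i) n = (\<lambda>x. complex_of_real c *\<^sub>C diag_op e a n x)"
  by (simp add: diag_op_def fun_eq_iff scaleC.sum_right scaleC_scaleC mult.assoc)

lemma norm_diag_op_scale: "0 \<le> c \<Longrightarrow> N (diag_op e (\<lambda>i. c * a i) n) = c * N (diag_op e a n)"
  unfolding diag_op_scale by (subst norm_scale[OF diag_op_ideal]) simp

lemma norm_diag_op_average: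
  assumes "j < n" "k < n" "0 \<le> \<theta>" "\<theta> \<le> 1"
  shows "N (diag_op e (\<lambda>i. (1 - \<theta>) * t i + \<theta> * t ((id(j := k, k := j)) i)) n) \<le> N (diag_op e t n)"
proof -
  let ?p = "\<lambda>i. t ((id(j := k, k := j)) i)"
  have "diag_op e (\<lambda>i. (1 - \<theta>) * t i + \<theta> * ?p i) n
      = (\<lambda>x. diag_op e (\<lambda>i. (1 - \<theta>) * t i) n x + diag_op e (\<lambda>i. \<theta> * ?p i) n x)"
    by (simp add: diag_op_def fun_eq_iff scaleC_add_left distrib_right sum.distrib)
  then have "N (diag_op e (\<lambda>i. (1 - \<theta>) * t i + \<theta> * ?p i) n)
      \<le> N (diag_op e (\<lambda>i. (1 - \<theta>) * t i) n) + N (diag_op e (\<lambda>i. \<theta> * ?p i) n)"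
    using norm_triangle[OF diag_op_ideal diag_op_ideal] by simp
  also have "\<dots> = (1 - \<theta>) * N (diag_op e t n) + \<theta> * N (diag_op e ?p n)"
    using assms by (simp add: norm_diag_op_scale)
  also have "\<dots> \<le> (1 - \<theta>) * N (diag_op e t n) + \<theta> * N (diag_op e t n)"
    using assms by (intro add_left_mono mult_left_mono norm_diag_op_transpose) auto
  finally show ?thesis
    by (simp add: algebra_simps)
qed

text \<open>Fan dominance, proved for each truncation: the norm of the truncated diagonal operator
  is monotone in its entries and does not grow under averaging with a transposition.\<close>

lemma gauge_function_mono:
  assumes s: "\<And>i j. i \<le> j \<Longrightarrow> s j \<le> s i" "\<And>i. 0 \<le> s i"
    and le: "\<And>m. (\<Sum>i<m. s i) \<le> (\<Sum>i<m. t i)"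
  shows "gauge_function e N s \<le> gauge_function e N t"
  unfolding gauge_function_def
proof (rule SUP_mono')
  fix n
  have "N (diag_op e s n) \<le> N (diag_op e t n)"
  proof (rule weak_majorization_mono[where n = n and \<Phi> = "\<lambda>a. N (diag_op e a n)"])
    show "N (diag_op e a n) \<le> N (diag_op e b n)" if "\<And>i. i < n \<Longrightarrow> 0 \<le> a i \<and> a i \<le> b i" for a b
      using that by (rule norm_diag_op_mono)
    show "N (diag_op e (\<lambda>i. (1 - \<theta>) * a i + \<theta> * a ((id(j := k, k := j)) i)) n) \<le> N (diag_op e a n)"
      if "j < n" "k < n" "0 \<le> \<theta>" "\<theta> \<le> 1" for a j k \<theta>
      using that by (rule norm_diag_op_average)
  qed (use assms in auto)
  then show "ennreal (N (diag_op e s n)) \<le> ennreal (N (diag_op e t n))"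
    by (rule ennreal_leI)
qed

lemma gauge_function_half: "gauge_function e N (\<lambda>i. 1 / 2 * a i) = 1 / 2 * gauge_function e N a"
proof -
  have "ennreal (1 / 2) = 1 / 2"
    using divide_ennreal[of 1 2] by simp
  then show ?thesis
    unfolding gauge_function_def SUP_mult_left_ennreal
    by (simp only: norm_diag_op_scale ennreal_mult norm_nonneg[OF diag_op_ideal] zero_le_divide_1_iff
        zero_le_numeral)
qed

text \<open>Inside the ideal the two branches agree because there \<open>N\<close> is determined by
  its gauge function.\<close>

lemma ext_norm_eq_gauge_function: "ext_norm e C N T = gauge_function e N (singular_values T)"
  by (simp add: ext_norm_def norm_gauge)

end

theorem theorem4p5:
  fixes A X :: "'a::chilbert_space \<Rightarrow> 'a"
  assumes "separable_space (euclidean :: 'a topology)"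
    and "infinite_dim TYPE('a)"
    and "selfadjoint_op A" and "selfadjoint_op X"
  shows "singular_values (\<lambda>x. A (X x) - X (A x)) \<prec>\<^sub>w
      (\<lambda>n. 1 / 2 * (spectral_spread (map_prod A A) n * spectral_spread (map_prod X X) n))
    \<and> (compact_op A \<or> compact_op X \<longrightarrow>
      (\<forall>e C N. orthonormal_basis e \<and> unitarily_invariant_norm e C N \<longrightarrow>
        ext_norm e C N (\<lambda>x. A (X x) - X (A x)) \<le>
          1 / 2 * gauge_function e N
            (\<lambda>n. spectral_spread (map_prod A A) n * spectral_spread (map_prod X X) n)))"
proof -
  note inf = assms(2) and A = assms(3) and X = assms(4)
  let ?C = "\<lambda>x. A (X x) - X (A x)"
  let ?\<delta> = "\<lambda>n. spectral_spread (map_prod A A) n * spectral_spread (map_prod X X) n"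
  have pos: "positive_op (abs_op ?C)"
    by (rule abs_op_commutator(1)[OF A X])
  then have bounded: "bounded_op (abs_op ?C)"
    by (simp add: positive_op_def selfadjoint_op_def)
  have s: "singular_values ?C j \<le> singular_values ?C i" if "i \<le> j" for i j
    using upper_scale_antimono[OF inf bounded that] by (simp add: singular_values_def upper_scale_def)
  have s_nonneg: "0 \<le> singular_values ?C i" for i
    using upper_scale_nonneg[OF inf pos, of i] by (simp add: singular_values_def upper_scale_def)
  note bounded_prod = bounded_op_map_prod[OF selfadjoint_bounded selfadjoint_bounded]
  note spread = spectral_spread_nonneg[OF infinite_dim_prod[OF inf] bounded_prod]
    spectral_spread_antimono[OF infinite_dim_prod[OF inf] bounded_prod]
  have t: "1 / 2 * ?\<delta> j \<le> 1 / 2 * ?\<delta> i" if "i \<le> j" for i j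
    using A X that by (intro mult_left_mono mult_mono spread) simp_all
  have t_nonneg: "0 \<le> 1 / 2 * ?\<delta> i" for i
    using spread(1)[OF A A, of i] spread(1)[OF X X, of i] by simp
  note le = sum_singular_values_commutator_le[OF inf A X]
  \<comment> \<open>Both sequences are nonnegative and decreasing, hence equal to their
    rearrangements, and the claim becomes \<open>le\<close>.\<close>
  have "singular_values ?C \<prec>\<^sub>w (\<lambda>n. 1 / 2 * ?\<delta> n)"
    unfolding submajorized_def
    using le decr_rearrangement_antimono[of "singular_values ?C", OF s s_nonneg]
      decr_rearrangement_antimono[of "\<lambda>n. 1 / 2 * ?\<delta> n", OF t t_nonneg]
    by (simp del: times_divide_eq_left)
  moreover have "ext_norm e C N ?C \<le> 1 / 2 * gauge_function e N ?\<delta>"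
    if e: "orthonormal_basis e" and N: "unitarily_invariant_norm e C N" for e C N
    unfolding ext_norm_eq_gauge_function[OF e N] gauge_function_half[OF e N, symmetric]
    by (rule gauge_function_mono[OF e N s s_nonneg le])
  ultimately show ?thesis
    by blast
qed

end
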